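(* For every fixed $K$, the problem SVDST restricted to instances with $\sum_{i=1}^k|S_i|=K$ can be reduced in polynomial time to BMST restricted to instances with exactly $K$ edges controlled by the follower ($|E^f|=K$); that is, a polynomial-time algorithm for the latter yields a polynomial-time algorithm for the former.
   Context: SVDST (shortest vertex-disjoint Steiner trees): given a connected graph $G=(V,E)$ with edge lengths $\ell\colon E\to\mathbb{R}_{\ge0}$ and $k$ pairwise disjoint sets $S_1,\dots,S_k\subseteq V$, find pairwise vertex-disjoint trees $T_1,\dots,T_k\subseteq E$ such that $T_i$ spans $S_i$ for all $i$, minimizing $\sum_i\ell(T_i)$, or decide that no such trees exist. An instance of BMST consists of a finite connected undirected graph $G=(V,E)$, possibly with parallel edges, whose edge set is partitioned into disjoint sets $E^\ell$ (leader's edges) and $E^f$ (follower's edges), cost functions $c,d\colon E\to\mathbb{R}_{\ge 0}$, and a fixed linear order $e_1,\dots,e_m$ of $E^f$ nondecreasing in $d$. For $Z\subseteq E$, $c(Z)=\sum_{e\in Z}c(e)$. A leader's choice is a cycle-free $X\subseteq E^\ell$, feasible if $(V,X\cup E^f)$ is connected. The follower's response $Y$ to $X$: start with $Y=\emptyset$, for $i=1,\dots,m$ add $e_i$ if $X\cup Y\cup\{e_i\}$ is cycle-free. The leader seeks a feasible $X$ minimizing $c(X\cup Y)$. *)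

theory Defs
  imports Complex_Main "HOL-Library.Log_Nat" "HOL-Computational_Algebra.Polynomial"
begin

section \<open>Undirected multigraphs\<close>

text \<open>
  Edges are named objects and \<open>ends e\<close> is the set of the two end vertices of \<open>e\<close>, so parallel
  edges are distinct names with the same value of \<open>ends\<close>.
\<close>

record ('v, 'e) graph =
  verts :: "'v set"
  edges :: "'e set"
  ends :: "'e \<Rightarrow> 'v set"

definition multigraph :: "('v, 'e, 'x) graph_scheme \<Rightarrow> bool" where
  "multigraph G \<longleftrightarrow> finite (verts G) \<and> finite (edges G) \<and>
     (\<forall>e\<in>edges G. ends G e \<subseteq> verts G \<and> card (ends G e) = 2)"

definition connected_graph :: "('e \<Rightarrow> 'v set) \<Rightarrow> 'v set \<Rightarrow> 'e set \<Rightarrow> bool" where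
  "connected_graph en W F \<longleftrightarrow>
     (\<forall>u\<in>W. \<forall>v\<in>W. (u, v) \<in> {(a, b). \<exists>e\<in>F. en e = {a, b}}\<^sup>*)"

text \<open>Two parallel edges form a cycle of length 2.\<close>

definition is_cycle :: "('e \<Rightarrow> 'v set) \<Rightarrow> 'v list \<Rightarrow> 'e list \<Rightarrow> bool" where
  "is_cycle en vs es \<longleftrightarrow> es \<noteq> [] \<and> length vs = length es \<and> distinct vs \<and> distinct es \<and>
     (\<forall>i<length es. en (es ! i) = {vs ! i, vs ! (Suc i mod length es)})"

definition cycle_free :: "('e \<Rightarrow> 'v set) \<Rightarrow> 'e set \<Rightarrow> bool" where
  "cycle_free en F \<longleftrightarrow> \<not> (\<exists>vs es. set es \<subseteq> F \<and> is_cycle en vs es)"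


section \<open>Shortest vertex-disjoint Steiner trees\<close>

record ('v, 'e) svdst = "('v, 'e) graph" +
  len :: "'e \<Rightarrow> real"
  terminals :: "'v set list"

definition svdst_instance :: "('v, 'e) svdst \<Rightarrow> bool" where
  "svdst_instance I \<longleftrightarrow> multigraph I \<and> connected_graph (ends I) (verts I) (edges I) \<and>
     (\<forall>e\<in>edges I. 0 \<le> len I e) \<and>
     (\<forall>S\<in>set (terminals I). S \<subseteq> verts I) \<and>
     (\<forall>i j. i < j \<longrightarrow> j < length (terminals I) \<longrightarrow> terminals I ! i \<inter> terminals I ! j = {})"

definition num_terminals :: "('v, 'e) svdst \<Rightarrow> nat" where
  "num_terminals I = (\<Sum>S\<leftarrow>terminals I. card S)"

text \<open>
  The vertex set of the tree \<open>T\<close> spanning \<open>S\<close>. The terminals are included explicitly because of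
  the one-vertex tree, which has no edges but still occupies its terminal.
\<close>

definition tree_verts :: "('e \<Rightarrow> 'v set) \<Rightarrow> 'v set \<Rightarrow> 'e set \<Rightarrow> 'v set" where
  "tree_verts en S T = S \<union> \<Union> (en ` T)"

definition spanning_tree_of :: "('e \<Rightarrow> 'v set) \<Rightarrow> 'v set \<Rightarrow> 'e set \<Rightarrow> bool" where
  "spanning_tree_of en S T \<longleftrightarrow> connected_graph en (tree_verts en S T) T \<and> cycle_free en T"

definition svdst_feasible :: "('v, 'e) svdst \<Rightarrow> 'e set list \<Rightarrow> bool" where
  "svdst_feasible I Ts \<longleftrightarrow> length Ts = length (terminals I) \<and>
     (\<forall>i<length Ts. Ts ! i \<subseteq> edges I \<and> spanning_tree_of (ends I) (terminals I ! i) (Ts ! i)) \<and>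
     (\<forall>i j. i < j \<longrightarrow> j < length Ts \<longrightarrow>
        tree_verts (ends I) (terminals I ! i) (Ts ! i) \<inter>
        tree_verts (ends I) (terminals I ! j) (Ts ! j) = {})"

definition svdst_cost :: "('v, 'e) svdst \<Rightarrow> 'e set list \<Rightarrow> real" where
  "svdst_cost I Ts = (\<Sum>T\<leftarrow>Ts. \<Sum>e\<in>T. len I e)"

definition svdst_optimal :: "('v, 'e) svdst \<Rightarrow> 'e set list \<Rightarrow> bool" where
  "svdst_optimal I Ts \<longleftrightarrow> svdst_feasible I Ts \<and>
     (\<forall>Ts'. svdst_feasible I Ts' \<longrightarrow> svdst_cost I Ts \<le> svdst_cost I Ts')"


section \<open>Bilevel minimum spanning tree\<close>

text \<open>\<open>follower_order\<close> lists the follower's edges in the order in which they are considered.\<close>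

record ('v, 'e) bmst = "('v, 'e) graph" +
  leader_edges :: "'e set"
  follower_edges :: "'e set"
  leader_cost :: "'e \<Rightarrow> real"
  follower_cost :: "'e \<Rightarrow> real"
  follower_order :: "'e list"

definition bmst_instance :: "('v, 'e) bmst \<Rightarrow> bool" where
  "bmst_instance B \<longleftrightarrow> multigraph B \<and> connected_graph (ends B) (verts B) (edges B) \<and>
     edges B = leader_edges B \<union> follower_edges B \<and> leader_edges B \<inter> follower_edges B = {} \<and>
     (\<forall>e\<in>edges B. 0 \<le> leader_cost B e \<and> 0 \<le> follower_cost B e) \<and>
     set (follower_order B) = follower_edges B \<and> distinct (follower_order B) \<and>
     sorted (map (follower_cost B) (follower_order B))"

fun greedy_response :: "('e \<Rightarrow> 'v set) \<Rightarrow> 'e set \<Rightarrow> 'e set \<Rightarrow> 'e list \<Rightarrow> 'e set" where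
  "greedy_response en X Y [] = Y"
| "greedy_response en X Y (e # es) =
     greedy_response en X (if cycle_free en (X \<union> Y \<union> {e}) then insert e Y else Y) es"

definition response :: "('v, 'e) bmst \<Rightarrow> 'e set \<Rightarrow> 'e set" where
  "response B X = greedy_response (ends B) X {} (follower_order B)"

definition bmst_feasible :: "('v, 'e) bmst \<Rightarrow> 'e set \<Rightarrow> bool" where
  "bmst_feasible B X \<longleftrightarrow> X \<subseteq> leader_edges B \<and> cycle_free (ends B) X \<and>
     connected_graph (ends B) (verts B) (X \<union> follower_edges B)"

definition bmst_cost :: "('v, 'e) bmst \<Rightarrow> 'e set \<Rightarrow> real" where
  "bmst_cost B X = (\<Sum>e\<in>X \<union> response B X. leader_cost B e)"

definition bmst_optimal :: "('v, 'e) bmst \<Rightarrow> 'e set \<Rightarrow> bool" where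
  "bmst_optimal B X \<longleftrightarrow> bmst_feasible B X \<and>
     (\<forall>X'. bmst_feasible B X' \<longrightarrow> bmst_cost B X \<le> bmst_cost B X')"


section \<open>Polynomial-time computation\<close>

text \<open>
  The machine model is a WHILE language on binary trees with natural numbers at the leaves.
  A program transforms one tree into another one. Time is charged at logarithmic cost: the size of
  a number is its number of binary digits, and every elementary step is charged the full size of
  the tree it reads and of the tree it produces. Hence a run of time \<open>t\<close> on an input of size \<open>s\<close>
  only handles trees of size at most \<open>s + t\<close>, each step can be simulated by a Turing machine in
  time polynomial in its charge, and conversely a Turing machine step is a bounded number of
  elementary steps on its configuration; polynomial time has its usual meaning.
\<close>

datatype val = Num nat | Node val val

fun vsize :: "val \<Rightarrow> nat" where
  "vsize (Num n) = Suc (nat (bitlen (int n)))"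
| "vsize (Node a b) = Suc (vsize a + vsize b)"

datatype prim = Id | Const nat | Fst | Snd | IsNode | Add | Sub | Mult | Less | Eq

fun arith :: "(nat \<Rightarrow> nat \<Rightarrow> nat) \<Rightarrow> val \<Rightarrow> val" where
  "arith f (Node (Num a) (Num b)) = Num (f a b)"
| "arith f v = Num 0"

fun prim_val :: "prim \<Rightarrow> val \<Rightarrow> val" where
  "prim_val Id v = v"
| "prim_val (Const n) v = Num n"
| "prim_val Fst v = (case v of Node a b \<Rightarrow> a | Num n \<Rightarrow> Num 0)"
| "prim_val Snd v = (case v of Node a b \<Rightarrow> b | Num n \<Rightarrow> Num 0)"
| "prim_val IsNode v = (case v of Node a b \<Rightarrow> Num 1 | Num n \<Rightarrow> Num 0)"
| "prim_val Add v = arith (+) v"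
| "prim_val Sub v = arith (-) v"
| "prim_val Mult v = arith (*) v"
| "prim_val Less v = arith (\<lambda>a b. if a < b then 1 else 0) v"
| "prim_val Eq v = arith (\<lambda>a b. if a = b then 1 else 0) v"

datatype prog =
    Prim prim
  | Seq prog prog
  | Fork prog prog
  | Cond prog prog prog
  | While prog prog

text \<open>\<open>exec p x y t\<close>: on input \<open>x\<close>, program \<open>p\<close> halts with output \<open>y\<close> after time \<open>t\<close>.
  In tests, \<open>Num 0\<close> means false and every other tree means true.\<close>

inductive exec :: "prog \<Rightarrow> val \<Rightarrow> val \<Rightarrow> nat \<Rightarrow> bool" where
  Prim: "exec (Prim f) x (prim_val f x) (Suc (vsize x + vsize (prim_val f x)))"
| Seq: "exec p x y t \<Longrightarrow> exec q y z u \<Longrightarrow> exec (Seq p q) x z (Suc (t + u))"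
| Fork: "exec p x y t \<Longrightarrow> exec q x z u \<Longrightarrow> exec (Fork p q) x (Node y z) (Suc (vsize x + t + u))"
| CondTrue: "exec b x v s \<Longrightarrow> v \<noteq> Num 0 \<Longrightarrow> exec p x y t \<Longrightarrow>
    exec (Cond b p q) x y (Suc (vsize x + s + t))"
| CondFalse: "exec b x (Num 0) s \<Longrightarrow> exec q x y t \<Longrightarrow>
    exec (Cond b p q) x y (Suc (vsize x + s + t))"
| WhileTrue: "exec b x v s \<Longrightarrow> v \<noteq> Num 0 \<Longrightarrow> exec p x y t \<Longrightarrow> exec (While b p) y z u \<Longrightarrow>
    exec (While b p) x z (Suc (vsize x + s + t + u))"
| WhileFalse: "exec b x (Num 0) s \<Longrightarrow> exec (While b p) x x (Suc (vsize x + s))"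

text \<open>\<open>correct P x\<close> is the set of acceptable answers to the instance \<open>x\<close>.\<close>

record ('i, 'o) problem =
  insts :: "'i set"
  correct :: "'i \<Rightarrow> 'o set"
  enc_in :: "'i \<Rightarrow> val"
  enc_out :: "'o \<Rightarrow> val"

definition ptime_solvable :: "('i, 'o) problem \<Rightarrow> bool" where
  "ptime_solvable P \<longleftrightarrow> (\<exists>p (r :: nat poly). \<forall>x\<in>insts P. \<exists>y\<in>correct P x. \<exists>t.
     exec p (enc_in P x) (enc_out P y) t \<and> t \<le> poly r (vsize (enc_in P x)))"

text \<open>
  A polynomial-time reduction from \<open>P\<close> to \<open>Q\<close>: the program \<open>f\<close> turns instances of \<open>P\<close> into
  instances of \<open>Q\<close>, and the program \<open>g\<close> turns every correct answer to the latter, given together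
  with the original instance, into a correct answer to the former.
\<close>

definition ptime_reducible :: "('i, 'o) problem \<Rightarrow> ('j, 'p) problem \<Rightarrow> bool" where
  "ptime_reducible P Q \<longleftrightarrow> (\<exists>f g (r :: nat poly). \<forall>x\<in>insts P. \<exists>x'\<in>insts Q.
     (\<exists>t. exec f (enc_in P x) (enc_in Q x') t \<and> t \<le> poly r (vsize (enc_in P x))) \<and>
     (\<forall>y'\<in>correct Q x'. \<exists>y\<in>correct P x. \<exists>t.
        exec g (Node (enc_in P x) (enc_out Q y')) (enc_out P y) t \<and>
        t \<le> poly r (vsize (Node (enc_in P x) (enc_out Q y')))))"


section \<open>The two problems as computational problems\<close>

text \<open>
  Inputs have rational costs, represented by reduced fractions in binary. Vertices are natural
  numbers, and the edges of an input are numbered by their positions in the list of edges. Finite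
  sets are given by lists without repetitions.
\<close>

fun enc_list :: "('a \<Rightarrow> val) \<Rightarrow> 'a list \<Rightarrow> val" where
  "enc_list f [] = Num 0"
| "enc_list f (x # xs) = Node (f x) (enc_list f xs)"

definition enc_rat :: "rat \<Rightarrow> val" where
  "enc_rat q = (case quotient_of q of (a, b) \<Rightarrow> Node (Num (nat a)) (Num (nat b)))"

record svdst_input =
  sv_verts :: "nat list"
  sv_edges :: "(nat \<times> nat \<times> rat) list"
  sv_terminals :: "nat list list"

definition svdst_of :: "svdst_input \<Rightarrow> (nat, nat) svdst" where
  "svdst_of I =
     \<lparr>verts = set (sv_verts I),
      edges = {..<length (sv_edges I)},
      ends = (\<lambda>i. case sv_edges I ! i of (u, v, l) \<Rightarrow> {u, v}),
      len = (\<lambda>i. case sv_edges I ! i of (u, v, l) \<Rightarrow> of_rat l),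
      terminals = map set (sv_terminals I)\<rparr>"

definition enc_svdst :: "svdst_input \<Rightarrow> val" where
  "enc_svdst I =
     Node (enc_list Num (sv_verts I))
       (Node (enc_list (\<lambda>(u, v, l). Node (Num u) (Node (Num v) (enc_rat l))) (sv_edges I))
         (enc_list (enc_list Num) (sv_terminals I)))"

text \<open>The answer \<open>None\<close> states that no vertex-disjoint Steiner trees exist.\<close>

definition SVDST :: "nat \<Rightarrow> (svdst_input, nat list list option) problem" where
  "SVDST K =
     \<lparr>insts = {I. distinct (sv_verts I) \<and> (\<forall>S\<in>set (sv_terminals I). distinct S) \<and>
        svdst_instance (svdst_of I) \<and> num_terminals (svdst_of I) = K},
      correct = (\<lambda>I. {ans. case ans of
          None \<Rightarrow> \<not> (\<exists>Ts. svdst_feasible (svdst_of I) Ts)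
        | Some Ts \<Rightarrow> (\<forall>T\<in>set Ts. distinct T) \<and> svdst_optimal (svdst_of I) (map set Ts)}),
      enc_in = enc_svdst,
      enc_out = (\<lambda>ans. case ans of
          None \<Rightarrow> Num 0
        | Some Ts \<Rightarrow> Node (Num 1) (enc_list (enc_list Num) Ts))\<rparr>"

text \<open>
  An edge entry \<open>(u, v, c, d)\<close> consists of the two ends and the costs for leader and follower.
  The leader's edges are numbered first; the follower's edges are listed in their linear order.
\<close>

record bmst_input =
  bm_verts :: "nat list"
  bm_leader :: "(nat \<times> nat \<times> rat \<times> rat) list"
  bm_follower :: "(nat \<times> nat \<times> rat \<times> rat) list"

definition bmst_of :: "bmst_input \<Rightarrow> (nat, nat) bmst" where
  "bmst_of J =
     (let es = bm_leader J @ bm_follower J; n = length (bm_leader J); m = length es in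
     \<lparr>verts = set (bm_verts J),
      edges = {..<m},
      ends = (\<lambda>i. case es ! i of (u, v, c, d) \<Rightarrow> {u, v}),
      leader_edges = {..<n},
      follower_edges = {n..<m},
      leader_cost = (\<lambda>i. case es ! i of (u, v, c, d) \<Rightarrow> of_rat c),
      follower_cost = (\<lambda>i. case es ! i of (u, v, c, d) \<Rightarrow> of_rat d),
      follower_order = [n..<m]\<rparr>)"

definition enc_bmst :: "bmst_input \<Rightarrow> val" where
  "enc_bmst J =
     (let enc_edges = enc_list (\<lambda>(u, v, c, d).
            Node (Num u) (Node (Num v) (Node (enc_rat c) (enc_rat d)))) in
     Node (enc_list Num (bm_verts J))
       (Node (enc_edges (bm_leader J)) (enc_edges (bm_follower J))))"

definition BMST :: "nat \<Rightarrow> (bmst_input, nat list) problem" where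
  "BMST K =
     \<lparr>insts = {J. distinct (bm_verts J) \<and> bmst_instance (bmst_of J) \<and>
        card (follower_edges (bmst_of J)) = K},
      correct = (\<lambda>J. {X. distinct X \<and> bmst_optimal (bmst_of J) (set X)}),
      enc_in = enc_bmst,
      enc_out = enc_list Num\<rparr>"

end

theory Submission
  imports Defs
begin

text \<open>
  Add a vertex \<open>h\<close> to the graph and let the leader control the edges of the graph, at cost
  \<open>len e + L\<close>, and an edge from \<open>h\<close> to every vertex, at cost \<open>L\<close>, where \<open>L\<close> exceeds the total
  length. For every nonempty terminal set \<open>S\<close> with first element \<open>s\<close>, the follower controls the links
  from \<open>s\<close> to the other elements of \<open>S\<close>, each of leader's cost \<open>2 * L\<close>, and considers them before
  the star edges from \<open>h\<close> to each \<open>s\<close>, of cost 0. This makes one follower's edge per terminal.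

  All spanning trees have the same size, so every edge that the follower takes saves the leader one
  edge. The leading term in \<open>L\<close> is hence minimal exactly if the follower takes all star edges and no
  link. No link is taken iff each \<open>S\<close> lies in one component of the leader's choice, and then all
  star edges are taken iff the vertices \<open>s\<close> and \<open>h\<close> lie in pairwise different components. So the
  leader's choice contains vertex-disjoint Steiner trees, and among these choices the cost is
  governed by their total length. Going back, the components of the terminals are computed
  and the answer is \<open>None\<close> if they fail to separate the terminal sets.
\<close>

section \<open>Polynomial-time functions\<close>

text \<open>Every leader's edge costs \<open>L\<close>, plus a length if it comes from the graph,
  and a feasible choice together with its response is a spanning tree with \<open>card V\<close>
  edges on \<open>V\<close> and the hub. Writing out the cost gives
  \<open>L * (card V + links taken - star edges taken)\<close> plus the chosen length: a link
  replaces a leader's edge but is charged \<open>2 * L\<close>, so it loses \<open>L\<close>,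
  whereas a free star edge gains \<open>L\<close>. The bracket is an integer and \<open>L\<close>
  exceeds every possible total length, so a single unit outweighs all lengths. The leader's edges at
  the hub serve to attach the vertices that lie on no Steiner tree.

  The reduction also has to be an actual program. Polynomial time is proved by closure rules for
  functions between encoded types; the critical rule is iteration over a list, where the size of the
  accumulator must be controlled. These rules speak of all values of a type, so the programs are
  written on unrestricted tuples of numbers and only afterwards shown to agree with the construction
  on rational costs.\<close>

lemma poly_nat_mono:
  fixes r :: "nat poly"
  assumes "m \<le> n"
  shows "poly r m \<le> poly r n"
  using assms by (induction r) (auto intro!: add_mono mult_mono)

lemma vsize_pos: "0 < vsize v"
  by (cases v) auto

section \<open>Numbers of binary digits of sums and products\<close>

lemma less_power_bitlen: "n < 2 ^ nat (bitlen (int n))"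
  by (simp add: less_power_nat_iff_bitlen bitlen_nonneg)

lemma nat_bitlen_le: "n < 2 ^ k \<Longrightarrow> nat (bitlen (int n)) \<le> k"
  by (simp add: less_power_nat_iff_bitlen)

lemma bitlen_add_le: "nat (bitlen (int (a + b))) \<le> nat (bitlen (int a)) + nat (bitlen (int b))"
proof (rule nat_bitlen_le)
  have "a + b < (a + 1) * (b + 1)" by (simp add: algebra_simps)
  also have "\<dots> \<le> 2 ^ nat (bitlen (int a)) * 2 ^ nat (bitlen (int b))"
    using less_power_bitlen[of a] less_power_bitlen[of b] by (intro mult_mono) auto
  finally show "a + b < 2 ^ (nat (bitlen (int a)) + nat (bitlen (int b)))"
    by (simp only: power_add)
qed

lemma bitlen_mult_le: "nat (bitlen (int (a * b))) \<le> nat (bitlen (int a)) + nat (bitlen (int b))"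
proof (rule nat_bitlen_le)
  show "a * b < 2 ^ (nat (bitlen (int a)) + nat (bitlen (int b)))"
    unfolding power_add
    using less_power_bitlen[of a] less_power_bitlen[of b] by (intro mult_strict_mono') auto
qed

text \<open>Bounding the digit count by the value itself is crude, but harmless for counters that
  never exceed the length of an input list, as in \<open>ptime_enumerate\<close>.\<close>

lemma vsize_Num_le: "vsize (Num n) \<le> Suc n"
using nat_bitlen_le[of n n] by simp

lemma vsize_Num_0 [simp]: "vsize (Num 0) = 1"
  by (simp add: bitlen_alt_def)

text \<open>Every step is charged for what it produces, so a time bound is also a size bound for the
  output. Intermediate results of composed programs therefore need no size estimates of their
  own.\<close>

lemma exec_vsize: "exec p x y t \<Longrightarrow> vsize y \<le> t"
  by (induction rule: exec.induct) auto

definition runs :: "prog \<Rightarrow> val \<Rightarrow> val \<Rightarrow> nat \<Rightarrow> bool" where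
  "runs p x y b \<longleftrightarrow> (\<exists>t\<le>b. exec p x y t)"

section \<open>Time bounds for the program constructors\<close>

lemma runs_mono: "runs p x y b \<Longrightarrow> b \<le> c \<Longrightarrow> runs p x y c"
  unfolding runs_def by (meson order_trans)

lemma runs_Prim: "prim_val f x = y \<Longrightarrow> runs (Prim f) x y (Suc (vsize x + vsize y))"
  unfolding runs_def using exec.Prim by blast

lemma runs_Seq:
  assumes "runs p x y b" "runs q y z c"
  shows "runs (Seq p q) x z (Suc (b + c))"
proof -
  obtain t u where "exec p x y t" "exec q y z u" "t \<le> b" "u \<le> c"
    using assms unfolding runs_def by blast
  then show ?thesis
    unfolding runs_def by (intro exI[of _ "Suc (t + u)"]) (simp add: exec.Seq)
qed

lemma runs_Fork:
  assumes "runs p x y b" "runs q x z c"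
  shows "runs (Fork p q) x (Node y z) (Suc (vsize x + b + c))"
proof -
  obtain t u where "exec p x y t" "exec q x z u" "t \<le> b" "u \<le> c"
    using assms unfolding runs_def by blast
  then show ?thesis
    unfolding runs_def by (intro exI[of _ "Suc (vsize x + t + u)"]) (simp add: exec.Fork)
qed

lemma runs_Cond:
  assumes "runs b x v s" "v \<noteq> Num 0 \<Longrightarrow> runs p x y t" "v = Num 0 \<Longrightarrow> runs q x y t"
  shows "runs (Cond b p q) x y (Suc (vsize x + s + t))"
proof -
  obtain s' where s': "exec b x v s'" "s' \<le> s"
    using assms(1) unfolding runs_def by blast
  have "runs (if v = Num 0 then q else p) x y t" using assms(2,3) by simp
  then obtain t' where "exec (if v = Num 0 then q else p) x y t'" "t' \<le> t"
    unfolding runs_def by blast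
  with s' show ?thesis
    unfolding runs_def
    by (intro exI[of _ "Suc (vsize x + s' + t')"])
      (auto intro: exec.CondTrue exec.CondFalse split: if_splits)
qed

lemma runs_WhileTrue:
  assumes "runs b x v s" "v \<noteq> Num 0" "runs p x y t" "runs (While b p) y z u"
  shows "runs (While b p) x z (Suc (vsize x + s + t + u))"
proof -
  obtain s' t' u' where "exec b x v s'" "exec p x y t'" "exec (While b p) y z u'"
    "s' \<le> s" "t' \<le> t" "u' \<le> u"
    using assms unfolding runs_def by blast
  then show ?thesis
    unfolding runs_def using assms(2)
    by (intro exI[of _ "Suc (vsize x + s' + t' + u')"]) (simp add: exec.WhileTrue)
qed

lemma runs_WhileFalse:
  assumes "runs b x (Num 0) s"
  shows "runs (While b p) x x (Suc (vsize x + s))"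
proof -
  obtain s' where "exec b x (Num 0) s'" "s' \<le> s"
    using assms unfolding runs_def by blast
  then show ?thesis
    unfolding runs_def by (intro exI[of _ "Suc (vsize x + s')"]) (simp add: exec.WhileFalse)
qed

lemma runs_vsize: "runs p x y b \<Longrightarrow> vsize y \<le> b"
  unfolding runs_def using exec_vsize order_trans by blast

section \<open>Functions computed in polynomial time on encodings\<close>

fun enc_pair :: "('a \<Rightarrow> val) \<Rightarrow> ('b \<Rightarrow> val) \<Rightarrow> 'a \<times> 'b \<Rightarrow> val" where
  "enc_pair e e' (a, b) = Node (e a) (e' b)"

definition enc_bool :: "bool \<Rightarrow> val" where
  "enc_bool b = Num (if b then 1 else 0)"

text \<open>The requirement covers all values of the type \<open>'a\<close>, not only problem
  instances; the encodings \<open>e\<close> and \<open>e'\<close> take the place of types on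
  trees.\<close>

definition ptime_fun :: "('a \<Rightarrow> val) \<Rightarrow> ('b \<Rightarrow> val) \<Rightarrow> ('a \<Rightarrow> 'b) \<Rightarrow> bool" where
  "ptime_fun e e' f \<longleftrightarrow> (\<exists>p (r :: nat poly). \<forall>x. runs p (e x) (e' (f x)) (poly r (vsize (e x))))"

lemma ptime_funI:
  fixes r :: "nat poly"
  assumes "\<And>x. runs p (e x) (e' (f x)) (poly r (vsize (e x)))"
  shows "ptime_fun e e' f"
  using assms unfolding ptime_fun_def by blast

lemma ptime_funE:
  assumes "ptime_fun e e' f"
  obtains p and r :: "nat poly" where "\<And>x. runs p (e x) (e' (f x)) (poly r (vsize (e x)))"
  using assms unfolding ptime_fun_def by blast

lemma ptime_vsize:
  assumes "ptime_fun e e' f"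
  obtains r :: "nat poly" where "\<And>x. vsize (e' (f x)) \<le> poly r (vsize (e x))"
  using ptime_funE[OF assms] runs_vsize by meson

text \<open>Different encodings may produce the same tree, for instance those of a nonempty list and
  of the pair of its head and tail. The program for one function then serves for the other.\<close>

lemma ptime_recode:
  assumes "ptime_fun e e2 f" "\<And>x. e2 (f x) = e3 (g x)"
  shows "ptime_fun e e3 g"
  using assms unfolding ptime_fun_def by simp

lemma ptime_prim:
  assumes "\<And>x. prim_val f (e x) = e' (g x)" "\<And>x. vsize (e' (g x)) \<le> vsize (e x) + c"
  shows "ptime_fun e e' g"
proof (rule ptime_funI[where r = "[:Suc c, 2:]"])
  show "runs (Prim f) (e x) (e' (g x)) (poly [:Suc c, 2:] (vsize (e x)))" for x
    by (rule runs_mono[OF runs_Prim[OF assms(1)]]) (use assms(2)[of x] in simp)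
qed

lemma ptime_comp:
  assumes "ptime_fun e2 e3 g" "ptime_fun e1 e2 f"
  shows "ptime_fun e1 e3 (\<lambda>x. g (f x))"
proof -
  obtain p r where p: "\<And>x. runs p (e1 x) (e2 (f x)) (poly r (vsize (e1 x)))"
    using ptime_funE[OF assms(2)] by blast
  obtain q s where q: "\<And>x. runs q (e2 x) (e3 (g x)) (poly s (vsize (e2 x)))"
    using ptime_funE[OF assms(1)] by blast
  show ?thesis
  proof (rule ptime_funI[where p = "Seq p q" and r = "[:1:] + r + s \<circ>\<^sub>p r"])
    fix x
    \<comment> \<open>The second program runs on an intermediate result whose size is at most the
      running time of the first; hence the composed polynomial.\<close>
    have "poly s (vsize (e2 (f x))) \<le> poly s (poly r (vsize (e1 x)))"
      by (rule poly_nat_mono) (rule runs_vsize[OF p])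
    then show "runs (Seq p q) (e1 x) (e3 (g (f x))) (poly ([:1:] + r + s \<circ>\<^sub>p r) (vsize (e1 x)))"
      by - (rule runs_mono[OF runs_Seq[OF p q]], simp add: poly_pcompose)
  qed
qed

lemma ptime_pair:
  assumes "ptime_fun e e1 f" "ptime_fun e e2 g"
  shows "ptime_fun e (enc_pair e1 e2) (\<lambda>x. (f x, g x))"
proof -
  obtain p r where p: "\<And>x. runs p (e x) (e1 (f x)) (poly r (vsize (e x)))"
    using ptime_funE[OF assms(1)] by blast
  obtain q s where q: "\<And>x. runs q (e x) (e2 (g x)) (poly s (vsize (e x)))"
    using ptime_funE[OF assms(2)] by blast
  show ?thesis
  proof (rule ptime_funI[where p = "Fork p q" and r = "[:1, 1:] + r + s"])
    show "runs (Fork p q) (e x) (enc_pair e1 e2 (f x, g x))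
        (poly ([:1, 1:] + r + s) (vsize (e x)))" for x
      unfolding enc_pair.simps by (rule runs_mono[OF runs_Fork[OF p q]]) simp
  qed
qed

lemma ptime_if:
  assumes "ptime_fun e enc_bool b" "ptime_fun e e' f" "ptime_fun e e' g"
  shows "ptime_fun e e' (\<lambda>x. if b x then f x else g x)"
proof -
  obtain c l where c: "\<And>x. runs c (e x) (enc_bool (b x)) (poly l (vsize (e x)))"
    using ptime_funE[OF assms(1)] by blast
  obtain p r where p: "\<And>x. runs p (e x) (e' (f x)) (poly r (vsize (e x)))"
    using ptime_funE[OF assms(2)] by blast
  obtain q s where q: "\<And>x. runs q (e x) (e' (g x)) (poly s (vsize (e x)))"
    using ptime_funE[OF assms(3)] by blast
  show ?thesis
  proof (rule ptime_funI[where p = "Cond c p q" and r = "[:1, 1:] + l + (r + s)"])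
    fix x
    have "runs p (e x) (e' (if b x then f x else g x)) (poly (r + s) (vsize (e x)))"
      if "enc_bool (b x) \<noteq> Num 0"
      using that runs_mono[OF p] by (auto simp: enc_bool_def split: if_splits)
    moreover have "runs q (e x) (e' (if b x then f x else g x)) (poly (r + s) (vsize (e x)))"
      if "enc_bool (b x) = Num 0"
      using that runs_mono[OF q] by (auto simp: enc_bool_def split: if_splits)
    ultimately show "runs (Cond c p q) (e x) (e' (if b x then f x else g x))
        (poly ([:1, 1:] + l + (r + s)) (vsize (e x)))"
      by - (rule runs_mono[OF runs_Cond[OF c]], assumption+, simp)
  qed
qed

section \<open>Elementary operations on numbers, truth values and lists\<close>

lemma ptime_id: "ptime_fun e e (\<lambda>x. x)"
  by (rule ptime_prim[of Id]) auto

lemma ptime_fst: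
  assumes "ptime_fun e (enc_pair e1 e2) f"
  shows "ptime_fun e e1 (\<lambda>x. fst (f x))"
proof (rule ptime_comp[OF _ assms])
  show "ptime_fun (enc_pair e1 e2) e1 fst"
    by (rule ptime_prim[where f = Fst and c = 0]) auto
qed

lemma ptime_snd:
  assumes "ptime_fun e (enc_pair e1 e2) f"
  shows "ptime_fun e e2 (\<lambda>x. snd (f x))"
proof (rule ptime_comp[OF _ assms])
  show "ptime_fun (enc_pair e1 e2) e2 snd"
    by (rule ptime_prim[where f = Snd and c = 0]) auto
qed

lemma ptime_nat: "ptime_fun e Num (\<lambda>x. n)"
  by (rule ptime_prim[where f = "Const n" and c = "vsize (Num n)"]) auto

lemma ptime_True: "ptime_fun e enc_bool (\<lambda>x. True)"
  by (rule ptime_prim[where f = "Const 1" and c = 2]) (auto simp: enc_bool_def bitlen_alt_def)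

lemma ptime_False: "ptime_fun e enc_bool (\<lambda>x. False)"
  by (rule ptime_prim[where f = "Const 0" and c = 2]) (auto simp: enc_bool_def bitlen_alt_def)

lemma ptime_Nil: "ptime_fun e (enc_list e') (\<lambda>x. [])"
  by (rule ptime_prim[where f = "Const 0" and c = 1]) auto

lemma ptime_add:
  assumes "ptime_fun e Num f" "ptime_fun e Num g"
  shows "ptime_fun e Num (\<lambda>x. f x + g x)"
proof -
  have "ptime_fun (enc_pair Num Num) Num (\<lambda>x. fst x + snd x)"
  proof (rule ptime_prim[where f = Add and c = 0])
    show "vsize (Num (fst x + snd x)) \<le> vsize (enc_pair Num Num x) + 0" for x
      using bitlen_add_le[of "fst x" "snd x"] by (cases x) simp
  qed auto
  from ptime_comp[OF this ptime_pair[OF assms]] show ?thesis by simp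
qed

lemma ptime_mult:
  assumes "ptime_fun e Num f" "ptime_fun e Num g"
  shows "ptime_fun e Num (\<lambda>x. f x * g x)"
proof -
  have "ptime_fun (enc_pair Num Num) Num (\<lambda>x. fst x * snd x)"
  proof (rule ptime_prim[where f = Mult and c = 0])
    show "vsize (Num (fst x * snd x)) \<le> vsize (enc_pair Num Num x) + 0" for x
      using bitlen_mult_le[of "fst x" "snd x"] by (cases x) simp
  qed auto
  from ptime_comp[OF this ptime_pair[OF assms]] show ?thesis by simp
qed

lemma ptime_Suc: "ptime_fun e Num f \<Longrightarrow> ptime_fun e Num (\<lambda>x. Suc (f x))"
  using ptime_add[OF ptime_nat, of e f 1] by simp

lemma ptime_eq_nat:
  assumes "ptime_fun e Num f" "ptime_fun e Num g"
  shows "ptime_fun e enc_bool (\<lambda>x. f x = g x)"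
proof -
  have "ptime_fun (enc_pair Num Num) enc_bool (\<lambda>x. fst x = snd x)"
    by (rule ptime_prim[where f = Eq and c = 2]) (auto simp: enc_bool_def bitlen_alt_def)
  from ptime_comp[OF this ptime_pair[OF assms]] show ?thesis by simp
qed

lemma ptime_Not:
  assumes "ptime_fun e enc_bool b"
  shows "ptime_fun e enc_bool (\<lambda>x. \<not> b x)"
proof -
  have "(\<lambda>x. \<not> b x) = (\<lambda>x. if b x then False else True)" by auto
  then show ?thesis using ptime_if[OF assms ptime_False ptime_True] by simp
qed

lemma ptime_iff:
  assumes "ptime_fun e enc_bool b" "ptime_fun e enc_bool c"
  shows "ptime_fun e enc_bool (\<lambda>x. b x \<longleftrightarrow> c x)"
proof -
  have "(\<lambda>x. b x \<longleftrightarrow> c x) = (\<lambda>x. if b x then c x else \<not> c x)" by auto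
  then show ?thesis using ptime_if[OF assms ptime_Not[OF assms(2)]] by simp
qed

lemma ptime_Cons:
  assumes "ptime_fun e e' f" "ptime_fun e (enc_list e') g"
  shows "ptime_fun e (enc_list e') (\<lambda>x. f x # g x)"
  by (rule ptime_recode[OF ptime_pair[OF assms]]) simp

lemma ptime_tl:
  assumes "ptime_fun e (enc_list e') f"
  shows "ptime_fun e (enc_list e') (\<lambda>x. tl (f x))"
proof -
  have "ptime_fun (enc_list e') (enc_list e') tl"
  proof (rule ptime_prim[where f = Snd and c = 0])
    show "prim_val Snd (enc_list e' x) = enc_list e' (tl x)"
      "vsize (enc_list e' (tl x)) \<le> vsize (enc_list e' x) + 0" for x
      by (cases x; simp)+
  qed
  from ptime_comp[OF this assms] show ?thesis .
qed

text \<open>The encoding of the empty list is that of 0.\<close>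

definition head0 :: "nat list \<Rightarrow> nat" where
  "head0 xs = (case xs of [] \<Rightarrow> 0 | x # _ \<Rightarrow> x)"

lemma ptime_head0:
  assumes "ptime_fun e (enc_list Num) f"
  shows "ptime_fun e Num (\<lambda>x. head0 (f x))"
proof -
  have "ptime_fun (enc_list Num) Num head0"
  proof (rule ptime_prim[where f = Fst and c = 0])
    show "prim_val Fst (enc_list Num x) = Num (head0 x)"
      "vsize (Num (head0 x)) \<le> vsize (enc_list Num x) + 0" for x
      by (cases x; simp add: head0_def)+
  qed
  from ptime_comp[OF this assms] show ?thesis .
qed

lemma ptime_is_Nil:
  assumes "ptime_fun e (enc_list e') f"
  shows "ptime_fun e enc_bool (\<lambda>x. f x = [])"
proof -
  have "ptime_fun (enc_list e') enc_bool (\<lambda>x. x \<noteq> [])"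
  proof (rule ptime_prim[where f = IsNode and c = 2])
    show "prim_val IsNode (enc_list e' x) = enc_bool (x \<noteq> [])" 
      "vsize (enc_bool (x \<noteq> [])) \<le> vsize (enc_list e' x) + 2" for x
      by (cases x; simp add: enc_bool_def bitlen_alt_def)+
  qed
  from ptime_Not[OF ptime_comp[OF this assms]] show ?thesis by simp
qed

section \<open>Sizes of lists and iteration over a list\<close>

lemma vsize_enc_list_append:
  "Suc (vsize (enc_list e (xs @ ys))) = vsize (enc_list e xs) + vsize (enc_list e ys)"
  by (induction xs) auto

lemma vsize_enc_list: "vsize (enc_list e xs) = Suc (\<Sum>x\<leftarrow>xs. Suc (vsize (e x)))"
  by (induction xs) auto

lemma vsize_enc_list_mem: "x \<in> set xs \<Longrightarrow> vsize (e x) < vsize (enc_list e xs)"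
  by (induction xs) auto

lemma length_less_vsize: "length xs < vsize (enc_list e xs)"
proof (induction xs)
  case (Cons x xs)
  then show ?case by simp
qed simp

text \<open>The state consists of a parameter, the remaining list and the accumulator. Each round
  hands the parameter, the head of the list and the accumulator to \<open>p\<close>, whose output
  becomes the new accumulator.\<close>

definition fold_loop :: "prog \<Rightarrow> prog" where
  "fold_loop p = While (Seq (Prim Snd) (Seq (Prim Fst) (Prim IsNode)))
      (Fork (Prim Fst) (Fork (Seq (Prim Snd) (Seq (Prim Fst) (Prim Snd)))
        (Seq (Fork (Prim Fst) (Fork (Seq (Prim Snd) (Seq (Prim Fst) (Prim Fst)))
            (Seq (Prim Snd) (Prim Snd)))) p)))"

text \<open>\<open>M\<close> bounds the accumulator after every prefix and \<open>N\<close> the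
  parameter together with the list, so a state has size at most \<open>N + M + 2\<close>. The factor
  100 absorbs the projections and copies of one round, and the additional round in
  \<open>Suc (length xs)\<close> pays for the final failing test.\<close>

lemma runs_fold_loop:
  assumes step: "\<And>x a. x \<in> set xs \<Longrightarrow> vsize (eA a) \<le> M \<Longrightarrow>
      runs p (Node z (Node (eX x) (eA a))) (eA (f x a)) T"
    and bound: "\<And>ys zs. xs = ys @ zs \<Longrightarrow> vsize (eA (fold f ys a)) \<le> M"
    and size: "vsize z + vsize (enc_list eX xs) \<le> N"
  shows "runs (fold_loop p) (Node z (Node (enc_list eX xs) (eA a)))
    (Node z (Node (Num 0) (eA (fold f xs a)))) (Suc (length xs) * (T + 100 * (N + M + 2)))"
  using step bound size
proof (induction xs arbitrary: a)
  case Nil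
  have M: "vsize (eA a) \<le> M" using Nil(2)[of "[]" "[]"] by simp
  have "runs (fold_loop p) (Node z (Node (Num 0) (eA a))) (Node z (Node (Num 0) (eA a)))
      (30 + 2 * vsize z + 4 * vsize (eA a))"
    unfolding fold_loop_def
    by (rule runs_mono, rule runs_WhileFalse, rule runs_Seq, rule runs_Prim, simp,
        rule runs_Seq, rule runs_Prim, simp, rule runs_Prim, simp, simp)
  then show ?case
    unfolding enc_list.simps fold_simps by (rule runs_mono) (use M Nil(3) in simp)
next
  case (Cons x xs)
  let ?s = "Node z (Node (Node (eX x) (enc_list eX xs)) (eA a))"
  have M: "vsize (eA a) \<le> M" "vsize (eA (f x a)) \<le> M"
    using Cons.prems(2)[of "[]" "x # xs"] Cons.prems(2)[of "[x]" xs] by simp_all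
  have t: "runs p (Node z (Node (eX x) (eA a))) (eA (f x a)) T"
    using Cons.prems(1)[OF _ M(1), of x] by simp
  have u: "runs (fold_loop p) (Node z (Node (enc_list eX xs) (eA (f x a))))
      (Node z (Node (Num 0) (eA (fold f xs (f x a))))) (Suc (length xs) * (T + 100 * (N + M + 2)))"
  proof (rule Cons.IH)
    show "runs p (Node z (Node (eX y) (eA b))) (eA (f y b)) T"
      if "y \<in> set xs" "vsize (eA b) \<le> M" for y b
      using Cons.prems(1) that by simp
    show "vsize (eA (fold f ys (f x a))) \<le> M" if "xs = ys @ zs" for ys zs
      using Cons.prems(2)[of "x # ys" zs] that by simp
  qed (use Cons.prems(3) in simp)
  have test: "runs (Seq (Prim Snd) (Seq (Prim Fst) (Prim IsNode))) ?s (Num 1) (10 * vsize ?s)"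
    by (rule runs_mono, rule runs_Seq, rule runs_Prim, simp,
        rule runs_Seq, rule runs_Prim, simp, rule runs_Prim, simp, simp del: One_nat_def add: bitlen_alt_def)
  have body: "runs (Fork (Prim Fst) (Fork (Seq (Prim Snd) (Seq (Prim Fst) (Prim Snd)))
        (Seq (Fork (Prim Fst) (Fork (Seq (Prim Snd) (Seq (Prim Fst) (Prim Fst)))
            (Seq (Prim Snd) (Prim Snd)))) p)))
      ?s (Node z (Node (enc_list eX xs) (eA (f x a)))) (T + 40 * vsize ?s)"
    by (rule runs_mono, rule runs_Fork, rule runs_Prim, simp, rule runs_Fork,
        rule runs_Seq, rule runs_Prim, simp, rule runs_Seq, rule runs_Prim, simp,
        rule runs_Prim, simp, rule runs_Seq, rule runs_Fork, rule runs_Prim, simp, rule runs_Fork,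
        rule runs_Seq, rule runs_Prim, simp, rule runs_Seq, rule runs_Prim, simp,
        rule runs_Prim, simp, rule runs_Seq, rule runs_Prim, simp, rule runs_Prim, simp,
        rule t, simp)
  have "vsize ?s \<le> N + M + 2" using Cons.prems(3) M by simp
  then have le: "Suc (vsize ?s + 10 * vsize ?s + (T + 40 * vsize ?s) +
      Suc (length xs) * (T + 100 * (N + M + 2))) \<le>
      Suc (length (x # xs)) * (T + 100 * (N + M + 2))"
    by (simp del: vsize.simps)
  have "runs (fold_loop p) ?s (Node z (Node (Num 0) (eA (fold f xs (f x a)))))
      (Suc (vsize ?s + 10 * vsize ?s + (T + 40 * vsize ?s) +
      Suc (length xs) * (T + 100 * (N + M + 2))))"
    unfolding fold_loop_def
    by (rule runs_WhileTrue[OF test _ body u[unfolded fold_loop_def]]) simp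
  from runs_mono[OF this le] show ?case by simp
qed

text \<open>A step that doubles its accumulator takes polynomial time but produces exponential size
  when iterated. The accumulators after all prefixes are therefore required to stay within a
  polynomial \<open>q\<close> of the size of the parameter.\<close>

lemma ptime_fold_bounded:
  fixes q :: "nat poly"
  assumes xs: "ptime_fun e (enc_list eX) xs"
    and a: "ptime_fun e eA a"
    and step: "ptime_fun (enc_pair e (enc_pair eX eA)) eA (\<lambda>w. f (fst w) (fst (snd w)) (snd (snd w)))"
    and bound: "\<And>z ys zs. xs z = ys @ zs \<Longrightarrow>
      vsize (eA (fold (f z) ys (a z))) \<le> poly q (vsize (e z))"
  shows "ptime_fun e eA (\<lambda>z. fold (f z) (xs z) (a z))"
proof -
  obtain px rx where px: "\<And>z. runs px (e z) (enc_list eX (xs z)) (poly rx (vsize (e z)))"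
    using ptime_funE[OF xs] by blast
  obtain pa ra where pa: "\<And>z. runs pa (e z) (eA (a z)) (poly ra (vsize (e z)))"
    using ptime_funE[OF a] by blast
  obtain ps rs where ps: "\<And>w. runs ps (enc_pair e (enc_pair eX eA) w)
      (eA (f (fst w) (fst (snd w)) (snd (snd w)))) (poly rs (vsize (enc_pair e (enc_pair eX eA) w)))"
    using ptime_funE[OF step] by blast
  \<comment> \<open>\<open>rN\<close> bounds the parameter with the list and hence also the number
    of rounds, \<open>rT\<close> the time of a step on a triple of admissible size, and
    \<open>rL\<close> the whole loop.\<close>
  define rN where "rN = [:0, 1:] + rx"
  define rT where "rT = rs \<circ>\<^sub>p ([:2:] + rN + q)"
  define rL where "rL = rN * (rT + [:100:] * (rN + q + [:2:]))"
  define r where "r = [:20:] + [:20:] * rN + [:20:] * rx + [:20:] * ra + [:20:] * q + rL"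
  show ?thesis
  proof (rule ptime_funI[where p = "Seq (Fork (Prim Id) (Fork px pa)) (Seq (fold_loop ps)
        (Seq (Prim Snd) (Prim Snd)))" and r = r])
    fix z
    let ?n = "vsize (e z)"
    have xs_size: "vsize (enc_list eX (xs z)) \<le> poly rx ?n"
      by (rule runs_vsize[OF px])
    have a_size: "vsize (eA (a z)) \<le> poly ra ?n"
      by (rule runs_vsize[OF pa])
    have res_size: "vsize (eA (fold (f z) (xs z) (a z))) \<le> poly q ?n"
      using bound[of z "xs z" "[]"] by simp
    have loop: "runs (fold_loop ps) (Node (e z) (Node (enc_list eX (xs z)) (eA (a z))))
        (Node (e z) (Node (Num 0) (eA (fold (f z) (xs z) (a z)))))
        (Suc (length (xs z)) * (poly rT ?n + 100 * (poly rN ?n + poly q ?n + 2)))"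
    proof (rule runs_fold_loop)
      fix x b
      assume x: "x \<in> set (xs z)" and b: "vsize (eA b) \<le> poly q ?n"
      have "vsize (eX x) \<le> poly rx ?n"
        using vsize_enc_list_mem[OF x, of eX] xs_size by simp
      then have "vsize (enc_pair e (enc_pair eX eA) (z, x, b)) \<le> poly ([:2:] + rN + q) ?n"
        using b by (simp add: rN_def)
      from poly_nat_mono[OF this, of rs]
      have "poly rs (vsize (enc_pair e (enc_pair eX eA) (z, x, b))) \<le> poly rT ?n"
        by (simp add: rT_def poly_pcompose)
      from runs_mono[OF ps this]
      show "runs ps (Node (e z) (Node (eX x) (eA b))) (eA (f z x b)) (poly rT ?n)" by simp
    next
      show "vsize (e z) + vsize (enc_list eX (xs z)) \<le> poly rN ?n"
        using xs_size by (simp add: rN_def)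
    qed (use bound in auto)
    have "Suc (length (xs z)) \<le> poly rN ?n"
      using xs_size length_less_vsize[of "xs z" eX] by (simp add: rN_def)
    then have "Suc (length (xs z)) * (poly rT ?n + 100 * (poly rN ?n + poly q ?n + 2)) \<le> poly rL ?n"
      unfolding rL_def by (simp only: poly_mult poly_add) (rule mult_mono, simp_all)
    note loop' = runs_mono[OF loop this]
    show "runs (Seq (Fork (Prim Id) (Fork px pa)) (Seq (fold_loop ps)
        (Seq (Prim Snd) (Prim Snd)))) (e z) (eA (fold (f z) (xs z) (a z))) (poly r ?n)"
    proof (rule runs_mono, rule runs_Seq, rule runs_Fork, rule runs_Prim)
      show "prim_val Id (e z) = e z" by simp
      show "runs (Fork px pa) (e z) (Node (enc_list eX (xs z)) (eA (a z)))
          (Suc (vsize (e z) + poly rx ?n + poly ra ?n))"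
        by (rule runs_Fork[OF px pa])
      show "runs (Seq (fold_loop ps) (Seq (Prim Snd) (Prim Snd)))
          (Node (e z) (Node (enc_list eX (xs z)) (eA (a z)))) (eA (fold (f z) (xs z) (a z)))
          (Suc (poly rL ?n + (20 + 2 * ?n + 6 * poly q ?n)))"
      proof (rule runs_Seq[OF loop'])
        show "runs (Seq (Prim Snd) (Prim Snd))
          (Node (e z) (Node (Num 0) (eA (fold (f z) (xs z) (a z)))))
          (eA (fold (f z) (xs z) (a z))) (20 + 2 * ?n + 6 * poly q ?n)"
          by (rule runs_mono, rule runs_Seq, rule runs_Prim, simp, rule runs_Prim, simp)
            (use res_size in simp)
      qed
      show "Suc (Suc (vsize (e z) + Suc (vsize (e z) + vsize (e z)) +
          Suc (vsize (e z) + poly rx ?n + poly ra ?n)) +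
          Suc (poly rL ?n + (20 + 2 * ?n + 6 * poly q ?n))) \<le> poly r ?n"
        using vsize_pos[of "e z"] by (simp add: r_def rN_def)
    qed
  qed
qed

text \<open>If a step enlarges the accumulator by an amount depending on parameter and element only,
  the enlargements add up to at most the list length times one polynomial.\<close>

lemma ptime_fold:
  fixes q :: "nat poly"
  assumes xs: "ptime_fun e (enc_list eX) xs"
    and a: "ptime_fun e eA a"
    and step: "ptime_fun (enc_pair e (enc_pair eX eA)) eA (\<lambda>w. f (fst w) (fst (snd w)) (snd (snd w)))"
    and growth: "\<And>z x a. vsize (eA (f z x a)) \<le> vsize (eA a) + poly q (vsize (e z) + vsize (eX x))"
  shows "ptime_fun e eA (\<lambda>z. fold (f z) (xs z) (a z))"
proof -
  obtain rx where rx: "\<And>z. vsize (enc_list eX (xs z)) \<le> poly rx (vsize (e z))"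
    using ptime_vsize[OF xs] by blast
  obtain ra where ra: "\<And>z. vsize (eA (a z)) \<le> poly ra (vsize (e z))"
    using ptime_vsize[OF a] by blast
  define rN where "rN = [:0, 1:] + rx"
  show ?thesis
  proof (rule ptime_fold_bounded[OF xs a step, where q = "ra + rx * (q \<circ>\<^sub>p rN)"])
    fix z ys zs
    assume eq: "xs z = ys @ zs"
    have "vsize (eA (fold (f z) ys b)) \<le> vsize (eA b) + length ys * poly q (poly rN (vsize (e z)))"
      if "set ys \<subseteq> set (xs z)" for ys b
      using that
    proof (induction ys arbitrary: b)
      case (Cons x ys)
      have "vsize (eX x) \<le> poly rx (vsize (e z))"
        using vsize_enc_list_mem[of x "xs z" eX] rx[of z] Cons.prems by simp
      then have "vsize (e z) + vsize (eX x) \<le> poly rN (vsize (e z))"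
        by (simp add: rN_def)
      from poly_nat_mono[OF this, of q]
      have "vsize (eA (f z x b)) \<le> vsize (eA b) + poly q (poly rN (vsize (e z)))"
        using growth[of z x b] by linarith
      then show ?case using Cons.IH[of "f z x b"] Cons.prems by simp
    qed simp
    from this[of ys "a z"]
    have *: "vsize (eA (fold (f z) ys (a z))) \<le>
        vsize (eA (a z)) + length ys * poly q (poly rN (vsize (e z)))"
      using eq by simp
    have "length ys \<le> poly rx (vsize (e z))"
      using rx[of z] length_less_vsize[of "xs z" eX] eq by simp
    then have "length ys * poly q (poly rN (vsize (e z))) \<le>
        poly rx (vsize (e z)) * poly q (poly rN (vsize (e z)))"
      by (rule mult_right_mono) simp
    then show "vsize (eA (fold (f z) ys (a z))) \<le> poly (ra + rx * (q \<circ>\<^sub>p rN)) (vsize (e z))"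
      using * ra[of z] unfolding poly_add poly_mult poly_pcompose by linarith
  qed
qed

section \<open>List operations obtained by iteration\<close>

lemmas ptime_basic = ptime_id ptime_pair ptime_fst ptime_snd ptime_if ptime_nat ptime_add ptime_mult ptime_Suc ptime_eq_nat
  ptime_True ptime_False ptime_Not ptime_iff ptime_Nil ptime_Cons ptime_tl ptime_head0 ptime_is_Nil

lemma ptime_rev:
  assumes "ptime_fun e (enc_list e') f"
  shows "ptime_fun e (enc_list e') (\<lambda>z. rev (f z))"
proof -
  have "ptime_fun e (enc_list e') (\<lambda>z. fold Cons (f z) [])"
    by (rule ptime_fold[where q = "[:1, 1:]" and f = "\<lambda>_. Cons", OF assms ptime_Nil])
      ((rule ptime_basic)+, simp)
  then show ?thesis by (simp add: fold_Cons_rev)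
qed

lemma ptime_append:
  assumes "ptime_fun e (enc_list e') f" "ptime_fun e (enc_list e') g"
  shows "ptime_fun e (enc_list e') (\<lambda>z. f z @ g z)"
proof -
  have "ptime_fun e (enc_list e') (\<lambda>z. fold Cons (rev (f z)) (g z))"
    by (rule ptime_fold[where q = "[:1, 1:]" and f = "\<lambda>_. Cons", OF ptime_rev[OF assms(1)] assms(2)])
      ((rule ptime_basic)+, simp)
  then show ?thesis by (simp add: fold_Cons_rev)
qed

lemma ptime_map:
  assumes "ptime_fun e (enc_list eX) xs" "ptime_fun (enc_pair e eX) eY (\<lambda>w. g (fst w) (snd w))"
  shows "ptime_fun e (enc_list eY) (\<lambda>z. map (g z) (xs z))"
proof -
  obtain q where q: "\<And>w. vsize (eY (g (fst w) (snd w))) \<le> poly q (vsize (enc_pair e eX w))"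
    using ptime_vsize[OF assms(2)] by blast
  have "ptime_fun e (enc_list eY) (\<lambda>z. fold (\<lambda>x a. g z x # a) (xs z) [])"
  proof (rule ptime_fold[where q = "[:1:] + q \<circ>\<^sub>p [:1, 1:]", OF assms(1) ptime_Nil])
    have "ptime_fun (enc_pair e (enc_pair eX (enc_list eY))) (enc_pair e eX)
        (\<lambda>w. (fst w, fst (snd w)))"
      by (rule ptime_basic)+
    from ptime_comp[OF assms(2) this]
    have "ptime_fun (enc_pair e (enc_pair eX (enc_list eY))) eY (\<lambda>w. g (fst w) (fst (snd w)))"
      by simp
    note g = this
    show "ptime_fun (enc_pair e (enc_pair eX (enc_list eY))) (enc_list eY)
        (\<lambda>w. g (fst w) (fst (snd w)) # snd (snd w))"
      by (rule g ptime_basic)+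
    show "vsize (enc_list eY (g z x # a)) \<le>
        vsize (enc_list eY a) + poly ([:1:] + q \<circ>\<^sub>p [:1, 1:]) (vsize (e z) + vsize (eX x))" for z x a
      using q[of "(z, x)"] by (simp add: poly_pcompose)
  qed
  moreover have "fold (\<lambda>x a. g z x # a) ys b = rev (map (g z) ys) @ b" for z ys b
    by (induction ys arbitrary: b) auto
  ultimately have "ptime_fun e (enc_list eY) (\<lambda>z. rev (map (g z) (xs z)))" by simp
  from ptime_rev[OF this] show ?thesis by simp
qed

lemma ptime_filter:
  assumes "ptime_fun e (enc_list eX) xs" "ptime_fun (enc_pair e eX) enc_bool (\<lambda>w. b (fst w) (snd w))"
  shows "ptime_fun e (enc_list eX) (\<lambda>z. filter (b z) (xs z))"
proof -
  have "ptime_fun e (enc_list eX) (\<lambda>z. fold (\<lambda>x a. if b z x then x # a else a) (xs z) [])"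
  proof (rule ptime_fold[where q = "[:1, 1:]", OF assms(1) ptime_Nil])
    have "ptime_fun (enc_pair e (enc_pair eX (enc_list eX))) (enc_pair e eX) (\<lambda>w. (fst w, fst (snd w)))"
      by (rule ptime_basic)+
    from ptime_comp[OF assms(2) this]
    have "ptime_fun (enc_pair e (enc_pair eX (enc_list eX))) enc_bool (\<lambda>w. b (fst w) (fst (snd w)))"
      by simp
    note g = this
    show "ptime_fun (enc_pair e (enc_pair eX (enc_list eX))) (enc_list eX)
        (\<lambda>w. if b (fst w) (fst (snd w)) then fst (snd w) # snd (snd w) else snd (snd w))"
      by (rule g ptime_basic)+
  qed simp
  moreover have "fold (\<lambda>x a. if b z x then x # a else a) ys c = rev (filter (b z) ys) @ c" for z ys c
    by (induction ys arbitrary: c) auto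
  ultimately have "ptime_fun e (enc_list eX) (\<lambda>z. rev (filter (b z) (xs z)))" by simp
  from ptime_rev[OF this] show ?thesis by simp
qed

lemma ptime_concat:
  assumes "ptime_fun e (enc_list (enc_list e')) f"
  shows "ptime_fun e (enc_list e') (\<lambda>z. concat (f z))"
proof -
  have "ptime_fun e (enc_list e') (\<lambda>z. fold append (rev (f z)) [])"
  proof (rule ptime_fold[where q = "[:0, 1:]" and f = "\<lambda>_. append", OF ptime_rev[OF assms] ptime_Nil])
    show "ptime_fun (enc_pair e (enc_pair (enc_list e') (enc_list e'))) (enc_list e')
        (\<lambda>w. fst (snd w) @ snd (snd w))"
      by (rule ptime_append ptime_basic)+
    show "vsize (enc_list e' (x @ a)) \<le>
        vsize (enc_list e' a) + poly [:0, 1:] (vsize (e z) + vsize (enc_list e' x))" for z x a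
      using vsize_enc_list_append[of e' x a] by simp
  qed
  then show ?thesis by (simp add: fold_append_concat_rev)
qed

lemma ptime_Ball:
  assumes "ptime_fun e (enc_list eX) xs" "ptime_fun (enc_pair e eX) enc_bool (\<lambda>w. b (fst w) (snd w))"
  shows "ptime_fun e enc_bool (\<lambda>z. \<forall>x\<in>set (xs z). b z x)"
proof -
  have "ptime_fun e enc_bool (\<lambda>z. filter (\<lambda>x. \<not> b z x) (xs z) = [])"
    by (rule assms ptime_is_Nil ptime_filter ptime_Not)+
  then show ?thesis by (simp add: filter_empty_conv)
qed

lemma ptime_mem:
  assumes "ptime_fun e Num f" "ptime_fun e (enc_list Num) xs"
  shows "ptime_fun e enc_bool (\<lambda>z. f z \<in> set (xs z))"
proof -
  have f: "ptime_fun (enc_pair e Num) Num (\<lambda>w. f (fst w))"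
    by (rule ptime_comp[OF assms(1)]) (rule ptime_basic)+
  have "ptime_fun e enc_bool (\<lambda>z. \<not> (\<forall>x\<in>set (xs z). \<not> x = f z))"
    by (rule f assms(2) ptime_Ball ptime_basic)+
  then show ?thesis
    by (rule ptime_recode) (auto intro!: arg_cong[where f = enc_bool])
qed

lemma ptime_sum_list:
  assumes "ptime_fun e (enc_list Num) xs"
  shows "ptime_fun e Num (\<lambda>z. sum_list (xs z))"
proof -
  have "ptime_fun e Num (\<lambda>z. fold (+) (xs z) 0)"
  proof (rule ptime_fold[where q = "[:0, 1:]" and f = "\<lambda>_. (+)", OF assms ptime_nat])
    show "ptime_fun (enc_pair e (enc_pair Num Num)) Num (\<lambda>w. fst (snd w) + snd (snd w))"
      by (rule ptime_basic)+
    show "vsize (Num (x + a)) \<le> vsize (Num a) + poly [:0, 1:] (vsize (e z) + vsize (Num x))"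
      for z x a
      using bitlen_add_le[of x a] by simp
  qed
  then show ?thesis by (simp add: fold_plus_sum_list_rev)
qed

text \<open>The step copies the counter from the accumulator into the list, so its growth depends on
  the accumulator and \<open>ptime_fold\<close> does not apply. The size is bounded directly
  instead, with every index estimated by its value.\<close>

lemma ptime_enumerate:
  assumes "ptime_fun e (enc_list eX) xs"
  shows "ptime_fun e (enc_list (enc_pair Num eX)) (\<lambda>z. List.enumerate 0 (xs z))"
proof -
  obtain r where r: "\<And>z. vsize (enc_list eX (xs z)) \<le> poly r (vsize (e z))"
    using ptime_vsize[OF assms] by blast
  let ?f = "\<lambda>x a. (Suc (fst a), (fst a, x) # snd a)"
  let ?E = "enc_pair Num (enc_list (enc_pair Num eX))"
  have fold_eq: "fold ?f ys (n, b) = (n + length ys, rev (List.enumerate n ys) @ b)" for ys :: "'b list" and n b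
    by (induction ys arbitrary: n b) auto
  have size: "vsize (enc_list (enc_pair Num eX) (List.enumerate n ys)) \<le>
      vsize (enc_list eX ys) * (n + length ys + 4)" for n and ys :: "'b list"
  proof (induction ys arbitrary: n)
    case (Cons y ys)
    have "vsize (Num n) \<le> Suc n" by (rule vsize_Num_le)
    then have "vsize (enc_list (enc_pair Num eX) (List.enumerate n (y # ys))) \<le>
        n + 3 + vsize (eX y) + vsize (enc_list eX ys) * (Suc n + length ys + 4)"
      using Cons.IH[of "Suc n"] by simp
    also have "\<dots> \<le> vsize (enc_list eX (y # ys)) * (n + length (y # ys) + 4)"
      by (simp add: algebra_simps)
    finally show ?case .
  qed simp
  have rev_size: "vsize (enc_list e' (rev ys)) = vsize (enc_list e' ys)" for e' :: "'c \<Rightarrow> val" and ys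
    by (simp only: vsize_enc_list rev_map[symmetric] sum_list_rev)
  have "ptime_fun e ?E (\<lambda>z. fold ?f (xs z) (0, []))"
  proof (rule ptime_fold_bounded[where f = "\<lambda>_. ?f" and q = "[:5:] + r + r * (r + [:4:])", OF assms])
    show "ptime_fun e ?E (\<lambda>z. (0, []))" by (rule ptime_basic)+
    show "ptime_fun (enc_pair e (enc_pair eX ?E)) ?E
        (\<lambda>w. (Suc (fst (snd (snd w))), (fst (snd (snd w)), fst (snd w)) # snd (snd (snd w))))"
      by (rule ptime_basic)+
    fix z ys zs
    assume eq: "xs z = ys @ zs"
    have "vsize (enc_list eX ys) \<le> poly r (vsize (e z))"
      using r[of z] vsize_enc_list_append[of eX ys zs] vsize_pos[of "enc_list eX zs"] eq by simp
    moreover from this have "length ys \<le> poly r (vsize (e z))"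
      using length_less_vsize[of ys eX] by simp
    ultimately have "vsize (enc_list eX ys) * (0 + length ys + 4) \<le>
        poly r (vsize (e z)) * (poly r (vsize (e z)) + 4)"
      by (intro mult_mono) auto
    with size[of 0 ys] have "vsize (enc_list (enc_pair Num eX) (List.enumerate 0 ys)) \<le>
        poly r (vsize (e z)) * (poly r (vsize (e z)) + 4)" by linarith
    then show "vsize (?E (fold ?f ys (0, []))) \<le>
        poly ([:5:] + r + r * (r + [:4:])) (vsize (e z))"
      using vsize_Num_le[of "length ys"] \<open>length ys \<le> _\<close> by (simp add: fold_eq rev_size)
  qed
  from ptime_rev[OF ptime_snd[OF this]]
  have "ptime_fun e (enc_list (enc_pair Num eX)) (\<lambda>z. rev (snd (fold ?f (xs z) (0, []))))" .
  then show ?thesis by (simp add: fold_eq)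
qed

lemmas ptime_intros = ptime_basic ptime_rev ptime_append ptime_map ptime_filter ptime_concat ptime_Ball ptime_mem
  ptime_sum_list ptime_enumerate

section \<open>Reachability and forests\<close>

definition reach :: "('e \<Rightarrow> 'v set) \<Rightarrow> 'e set \<Rightarrow> ('v \<times> 'v) set" where
  "reach en F = {(a, b). \<exists>e\<in>F. en e = {a, b}}\<^sup>*"

lemma connected_graph_iff: "connected_graph en W F \<longleftrightarrow> (\<forall>u\<in>W. \<forall>v\<in>W. (u, v) \<in> reach en F)"
  by (simp add: connected_graph_def reach_def)

lemma reach_refl [simp, intro]: "(a, a) \<in> reach en F"
  by (simp add: reach_def)

lemma reach_trans: "(a, b) \<in> reach en F \<Longrightarrow> (b, c) \<in> reach en F \<Longrightarrow> (a, c) \<in> reach en F"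
  unfolding reach_def by (rule rtrancl_trans)

lemma reach_sym: "(a, b) \<in> reach en F \<Longrightarrow> (b, a) \<in> reach en F"
proof -
  have "sym {(a, b). \<exists>e\<in>F. en e = {a, b}}"
  proof (rule symI)
    fix a b
    assume "(a, b) \<in> {(a, b). \<exists>e\<in>F. en e = {a, b}}"
    then obtain e where "e \<in> F" "en e = {a, b}" by blast
    moreover from this have "en e = {b, a}" by auto
    ultimately show "(b, a) \<in> {(a, b). \<exists>e\<in>F. en e = {a, b}}" by blast
  qed
  from sym_rtrancl[OF this] show "(a, b) \<in> reach en F \<Longrightarrow> (b, a) \<in> reach en F"
    unfolding reach_def by (rule symD)
qed

lemma reach_edge: "e \<in> F \<Longrightarrow> en e = {a, b} \<Longrightarrow> (a, b) \<in> reach en F"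
  unfolding reach_def by blast

lemma reach_induct [consumes 1, case_names refl step]:
  assumes "(a, b) \<in> reach en F" "P a"
    "\<And>x y e. (a, x) \<in> reach en F \<Longrightarrow> e \<in> F \<Longrightarrow> en e = {x, y} \<Longrightarrow> P x \<Longrightarrow> P y"
  shows "P b"
  using assms(1)[unfolded reach_def]
proof (induction rule: rtrancl_induct)
  case base
  show ?case by (rule assms(2))
next
  case (step y z)
  then show ?case using assms(3)[of y _ z] unfolding reach_def by blast
qed

lemma reach_subsetI:
  assumes "\<And>e a b. e \<in> F \<Longrightarrow> en e = {a, b} \<Longrightarrow> (a, b) \<in> reach en G"
  shows "reach en F \<subseteq> reach en G"
proof clarify
  fix a b
  assume "(a, b) \<in> reach en F"
  then show "(a, b) \<in> reach en G"
  proof (induction rule: reach_induct)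
    case (step x y e)
    then show ?case using reach_trans assms by meson
  qed simp
qed

lemma reach_class_eq:
  assumes "(a, b) \<in> reach en F"
  shows "reach en F `` {a} = reach en F `` {b}"
proof (intro equalityI subsetI; unfold Image_singleton_iff)
  show "(b, c) \<in> reach en F" if "(a, c) \<in> reach en F" for c
    by (rule reach_trans[OF reach_sym[OF assms] that])
  show "(a, c) \<in> reach en F" if "(b, c) \<in> reach en F" for c
    by (rule reach_trans[OF assms that])
qed

lemma reach_mono: "F \<subseteq> G \<Longrightarrow> reach en F \<subseteq> reach en G"
  by (rule reach_subsetI) (auto intro: reach_edge)

lemma reach_empty [simp]: "reach en {} = Relation.Id"
  by (simp add: reach_def)

lemma reach_closed:
  assumes "(a, b) \<in> reach en F" "a \<in> A"
    "\<And>e x y. e \<in> F \<Longrightarrow> en e = {x, y} \<Longrightarrow> x \<in> A \<Longrightarrow> y \<in> A"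
  shows "b \<in> A"
  using assms(1)
proof (induction rule: reach_induct)
  case (step x y e)
  then show ?case using assms(3) by blast
qed (rule assms(2))

text \<open>One crossing of the new edge \<open>e\<close> is enough, since a further one only
  returns to a vertex already reached. The disjuncts are: no crossing, from \<open>a\<close> to
  \<open>b\<close>, from \<open>b\<close> to \<open>a\<close>.\<close>

lemma reach_insert:
  assumes "en e = {a, b}"
  shows "(c, d) \<in> reach en (insert e F) \<longleftrightarrow> (c, d) \<in> reach en F \<or>
    (c, a) \<in> reach en F \<and> (b, d) \<in> reach en F \<or> (c, b) \<in> reach en F \<and> (a, d) \<in> reach en F"
    (is "_ \<longleftrightarrow> ?R d")
proof
  assume "(c, d) \<in> reach en (insert e F)"
  then show "?R d"
  proof (induction rule: reach_induct)
    case (step x y f)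
    show ?case
    proof (cases "f \<in> F")
      case True
      with step.hyps have "(x, y) \<in> reach en F" by (auto intro: reach_edge)
      with step.IH show ?thesis using reach_trans by meson
    next
      case False
      with step.hyps assms have "x = a \<and> y = b \<or> x = b \<and> y = a"
        by (auto simp: doubleton_eq_iff)
      with step.IH show ?thesis by auto
    qed
  qed simp
next
  have "(a, b) \<in> reach en (insert e F)" "(b, a) \<in> reach en (insert e F)"
    using assms reach_edge[of e "insert e F" en] by (simp_all add: insert_commute)
  moreover have "reach en F \<subseteq> reach en (insert e F)" by (rule reach_mono) auto
  ultimately show "?R d \<Longrightarrow> (c, d) \<in> reach en (insert e F)"
    using reach_trans by (metis subsetD)
qed

text \<open>Every edge is a bridge. This form of acyclicity avoids lists of vertices and edges; it
  also excludes loops, since \<open>(a, a)\<close> is always reachable.\<close>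

definition forest :: "('e \<Rightarrow> 'v set) \<Rightarrow> 'e set \<Rightarrow> bool" where
  "forest en F \<longleftrightarrow> (\<forall>e\<in>F. \<forall>a b. en e = {a, b} \<longrightarrow> (a, b) \<notin> reach en (F - {e}))"

lemma forest_mono: "forest en F \<Longrightarrow> G \<subseteq> F \<Longrightarrow> forest en G"
  unfolding forest_def using reach_mono[of "G - {e}" "F - {e}" en for e] by blast

text \<open>This is the test of Kruskal's algorithm, through which every decision of the follower is
  evaluated.\<close>

lemma forest_insert:
  assumes e: "e \<notin> F" "en e = {a, b}"
  shows "forest en (insert e F) \<longleftrightarrow> forest en F \<and> (a, b) \<notin> reach en F"
proof safe
  assume f: "forest en (insert e F)"
  show "forest en F" by (rule forest_mono[OF f]) auto
  assume "(a, b) \<in> reach en F"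
  moreover have "insert e F - {e} = F" using e by auto
  ultimately show False using f e unfolding forest_def by auto
next
  assume f: "forest en F" and ab: "(a, b) \<notin> reach en F"
  show "forest en (insert e F)"
    unfolding forest_def
  proof (intro ballI allI impI notI)
    fix f c d
    assume fF: "f \<in> insert e F" and cd: "en f = {c, d}"
      and r: "(c, d) \<in> reach en (insert e F - {f})"
    show False
    proof (cases "f = e")
      case True
      then have "insert e F - {f} = F" using e by auto
      moreover have "a = c \<and> b = d \<or> a = d \<and> b = c" 
        using cd e True by (auto simp: doubleton_eq_iff)
      ultimately show False using r ab reach_sym[of c d en F] by auto
    next
      case False
      then have fF: "f \<in> F" and eq: "insert e F - {f} = insert e (F - {f})" using fF by auto
      have sub: "reach en (F - {f}) \<subseteq> reach en F" by (rule reach_mono) auto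
      have "(c, d) \<notin> reach en (F - {f})" using f fF cd unfolding forest_def by blast
      \<comment> \<open>A detour around the old edge \<open>f\<close> that exists only thanks to
        \<open>e\<close> must cross \<open>e\<close>; its remaining pieces together with
        \<open>f\<close> connect \<open>a\<close> and \<open>b\<close> inside
        \<open>F\<close>.\<close>
      then have "(c, a) \<in> reach en F \<and> (b, d) \<in> reach en F \<or> (c, b) \<in> reach en F \<and> (a, d) \<in> reach en F"
        using r sub unfolding eq reach_insert[of en e, OF e(2)] by blast
      moreover have "(c, d) \<in> reach en F" using fF cd by (rule reach_edge)
      ultimately show False using ab by (meson reach_sym reach_trans)
    qed
  qed
qed

text \<open>A walk that returns to a visited vertex is cut back to the earlier visit, so the
  vertices stay distinct, as is required for closing the path to a cycle.\<close>

lemma reach_path: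
  assumes "(a, b) \<in> reach en F"
  shows "\<exists>vs es. distinct vs \<and> length vs = Suc (length es) \<and> vs ! 0 = a \<and>
    vs ! length es = b \<and> (\<forall>i<length es. es ! i \<in> F \<and> en (es ! i) = {vs ! i, vs ! Suc i})"
  using assms
proof (induction rule: reach_induct)
  case refl
  show ?case by (rule exI[of _ "[a]"], rule exI[of _ "[]"]) simp
next
  case (step x y e)
  then obtain vs es where vs: "distinct vs" "length vs = Suc (length es)" "vs ! 0 = a"
    "vs ! length es = x" and es: "\<And>i. i < length es \<Longrightarrow> es ! i \<in> F \<and> en (es ! i) = {vs ! i, vs ! Suc i}"
    by blast
  show ?case
  proof (cases "y \<in> set vs")
    case True
    then obtain k where k: "k < length vs" "vs ! k = y" by (auto simp: in_set_conv_nth)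
    then have "k \<le> length es" using vs by simp
    then show ?thesis
      by (intro exI[of _ "take (Suc k) vs"] exI[of _ "take k es"])
        (use vs es k in \<open>auto simp: min.absorb2\<close>)
  next
    case False
    show ?thesis
      by (rule exI[of _ "vs @ [y]"], rule exI[of _ "es @ [e]"])
        (use vs es False step.hyps in \<open>auto simp: nth_append less_Suc_eq\<close>)
  qed
qed

text \<open>If the ends of \<open>e\<close> are connected without \<open>e\<close>, a simple path
  between them closes with \<open>e\<close> to a cycle; conversely, the other edges of a cycle
  connect the ends of its last edge.\<close>

lemma cycle_free_iff_forest: "cycle_free en F \<longleftrightarrow> forest en F"
proof
  assume cf: "cycle_free en F"
  show "forest en F"
    unfolding forest_def
  proof (intro ballI allI impI notI)
    fix e a b
    assume e: "e \<in> F" "en e = {a, b}" and r: "(a, b) \<in> reach en (F - {e})"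
    obtain vs es where vs: "distinct vs" "length vs = Suc (length es)" "vs ! 0 = a"
      "vs ! length es = b"
      and es: "\<And>i. i < length es \<Longrightarrow> es ! i \<in> F - {e} \<and> en (es ! i) = {vs ! i, vs ! Suc i}"
      using reach_path[OF r] by blast
    have "distinct es"
      unfolding distinct_conv_nth
    proof (intro allI impI notI)
      fix i j
      assume ij: "i < length es" "j < length es" "i \<noteq> j" "es ! i = es ! j"
      then have "{vs ! i, vs ! Suc i} = {vs ! j, vs ! Suc j}" using es[of i] es[of j] by auto
      then show False using ij vs(1,2) by (auto simp: doubleton_eq_iff nth_eq_iff_index_eq)
    qed
    moreover have "e \<notin> set es" using es by (auto simp: in_set_conv_nth)
    moreover have "en ((es @ [e]) ! i) = {vs ! i, vs ! (Suc i mod length (es @ [e]))}"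
      if "i < length (es @ [e])" for i
    proof (cases "i = length es")
      case True
      then show ?thesis using e vs by (auto simp: insert_commute)
    next
      case False
      then show ?thesis using that es[of i] by (auto simp: nth_append)
    qed
    ultimately have "is_cycle en vs (es @ [e])"
      unfolding is_cycle_def using vs by auto
    moreover have "set (es @ [e]) \<subseteq> F" using es e by (auto simp: in_set_conv_nth)
    ultimately show False using cf unfolding cycle_free_def by blast
  qed
next
  assume f: "forest en F"
  show "cycle_free en F"
    unfolding cycle_free_def
  proof (intro notI, elim exE conjE)
    fix vs es
    assume sub: "set es \<subseteq> F" and cyc: "is_cycle en vs es"
    define n where "n = length es - 1"
    have n: "length es = Suc n" using cyc by (cases es) (auto simp: is_cycle_def n_def)
    have en: "en (es ! i) = {vs ! i, vs ! (Suc i mod Suc n)}" if "i \<le> n" for i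
      using cyc that n unfolding is_cycle_def by auto
    have "(vs ! 0, vs ! k) \<in> reach en (F - {es ! n})" if "k \<le> n" for k
      using that
    proof (induction k)
      case (Suc k)
      have "es ! k \<in> F - {es ! n}"
        using Suc.prems sub n cyc by (auto simp: is_cycle_def nth_eq_iff_index_eq)
      moreover have "en (es ! k) = {vs ! k, vs ! Suc k}" using en[of k] Suc.prems by simp
      ultimately show ?case using Suc by (meson Suc_leD reach_edge reach_trans)
    qed simp
    then have "(vs ! n, vs ! 0) \<in> reach en (F - {es ! n})" by (simp add: reach_sym)
    moreover have "en (es ! n) = {vs ! n, vs ! 0}" using en[of n] by simp
    moreover have "es ! n \<in> F" using sub n by auto
    ultimately show False using f unfolding forest_def by blast
  qed
qed

text \<open>Components are counted as classes of \<open>W\<close>. Starting with one class per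
  vertex, each edge of a forest merges two different classes.\<close>

lemma card_forest:
  assumes "finite W" "finite F" "\<And>e. e \<in> F \<Longrightarrow> \<exists>a\<in>W. \<exists>b\<in>W. en e = {a, b}" "forest en F"
  shows "card F + card ((\<lambda>v. reach en F `` {v}) ` W) = card W"
  using assms(2-4)
proof (induction F)
  case empty
  have "card ((\<lambda>v. Relation.Id `` {v}) ` W) = card W" by (rule card_image) (auto intro!: inj_onI)
  then show ?case by simp
next
  case (insert e F)
  obtain a b where ab: "a \<in> W" "b \<in> W" "en e = {a, b}" using insert.prems(1)[of e] by auto
  have f: "forest en F" and nab: "(a, b) \<notin> reach en F"
    using insert.prems(2) forest_insert[of e F en, OF insert.hyps(2) ab(3)] by auto
  define C where "C v = reach en F `` {v}" for v
  have C_eq: "C u = C v" if "u \<in> C v" for u v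
    using that reach_class_eq[of v u en F] unfolding C_def by auto
  have C_refl: "v \<in> C v" for v by (simp add: C_def)
  have ne: "C a \<noteq> C b" using nab C_refl[of b] by (auto simp: C_def)
  have C': "reach en (insert e F) `` {v} = (if v \<in> C a \<union> C b then C a \<union> C b else C v)" for v
  proof -
    have "w \<in> reach en (insert e F) `` {v} \<longleftrightarrow> w \<in> C v \<or> v \<in> C a \<and> w \<in> C b \<or> v \<in> C b \<and> w \<in> C a" for w
      unfolding C_def Image_singleton_iff reach_insert[of en e, OF ab(3)]
      using reach_sym[of _ _ en F] by blast
    then have eq: "reach en (insert e F) `` {v} =
        C v \<union> (if v \<in> C a then C b else {}) \<union> (if v \<in> C b then C a else {})"
      by auto
    show ?thesis unfolding eq using C_eq[of v a] C_eq[of v b] by auto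
  qed
  \<comment> \<open>The union contains \<open>a\<close>, so a class equal to it would be
    \<open>C a\<close>, which has been removed.\<close>
  have new: "C a \<union> C b \<notin> C ` W - {C a, C b}"
    using C_eq C_refl by blast
  have "(\<lambda>v. reach en (insert e F) `` {v}) ` W = insert (C a \<union> C b) (C ` W - {C a, C b})"
    (is "?L = ?R")
  proof
    show "?L \<subseteq> ?R" unfolding C' using C_refl by auto
    show "?R \<subseteq> ?L"
    proof
      fix D
      assume "D \<in> ?R"
      then consider "D = C a \<union> C b" | v where "v \<in> W" "D = C v" "C v \<noteq> C a" "C v \<noteq> C b" by auto
      then show "D \<in> ?L"
      proof cases
        case 1
        then have "D = reach en (insert e F) `` {a}" unfolding C' using C_refl by auto
        then show ?thesis using ab by blast
      next
        case 2
        then have "D = reach en (insert e F) `` {v}" unfolding C' using C_eq by auto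
        then show ?thesis using 2 by blast
      qed
    qed
  qed
  then have "card ((\<lambda>v. reach en (insert e F) `` {v}) ` W) = Suc (card (C ` W - {C a, C b}))"
    using new assms(1) by simp
  moreover have "card (C ` W - {C a, C b}) = card (C ` W) - 2"
    using ne ab by (subst card_Diff_subset) auto
  moreover have "card {C a, C b} \<le> card (C ` W)"
    using ab assms(1) by (intro card_mono) auto
  then have "2 \<le> card (C ` W)" using ne by simp
  moreover have "card F + card (C ` W) = card W"
    using insert.IH f insert.prems(1) unfolding C_def by simp
  ultimately show ?case using insert.hyps by simp
qed

lemma card_spanning_tree:
  assumes "finite W" "finite F" "\<And>e. e \<in> F \<Longrightarrow> \<exists>a\<in>W. \<exists>b\<in>W. en e = {a, b}"
    "forest en F" "connected_graph en W F" "W \<noteq> {}"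
  shows "Suc (card F) = card W"
proof -
  obtain w where w: "w \<in> W" using assms(6) by blast
  have "reach en F `` {v} = reach en F `` {w}" if "v \<in> W" for v
    using that w assms(5) by (intro reach_class_eq) (simp add: connected_graph_iff)
  then have "(\<lambda>v. reach en F `` {v}) ` W = (\<lambda>v. reach en F `` {w}) ` W"
    by (intro image_cong refl)
  also have "\<dots> = {reach en F `` {w}}" using w by (rule image_constant)
  finally have "(\<lambda>v. reach en F `` {v}) ` W = {reach en F `` {w}}" .
  moreover have "card F + card ((\<lambda>v. reach en F `` {v}) ` W) = card W"
    by (rule card_forest) (fact assms)+
  ultimately show ?thesis by simp
qed

section \<open>Invariants of the greedy response\<close>

lemma greedy_response_append:
  "greedy_response en X Y (es @ fs) = greedy_response en X (greedy_response en X Y es) fs"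
  by (induction es arbitrary: Y) auto

lemma greedy_response_supset: "Y \<subseteq> greedy_response en X Y es"
proof (induction es arbitrary: Y)
  case (Cons e es)
  show ?case using Cons[of Y] Cons[of "insert e Y"] by auto
qed simp

lemma greedy_response_subset: "greedy_response en X Y es \<subseteq> Y \<union> set es"
proof (induction es arbitrary: Y)
  case (Cons e es)
  show ?case using Cons[of Y] Cons[of "insert e Y"] by auto
qed simp

lemma forest_greedy_response:
  "forest en (X \<union> Y) \<Longrightarrow> forest en (X \<union> greedy_response en X Y es)"
  by (induction es arbitrary: Y) (auto simp: cycle_free_iff_forest)

text \<open>A rejected edge has its ends connected already, so it can be added or left out without
  changing reachability.\<close>

lemma reach_greedy_response:
  assumes "forest en (X \<union> Y)" "\<And>e. e \<in> set es \<Longrightarrow> \<exists>a b. en e = {a, b}"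
  shows "reach en (X \<union> greedy_response en X Y es) = reach en (X \<union> Y \<union> set es)"
  using assms
proof (induction es arbitrary: Y)
  case (Cons e es)
  show ?case
  proof (cases "forest en (insert e (X \<union> Y))")
    case True
    then show ?thesis using Cons.IH[of "insert e Y"] Cons.prems
      by (simp add: cycle_free_iff_forest)
  next
    case False
    obtain a b where ab: "en e = {a, b}" using Cons.prems(2)[of e] by auto
    have "e \<notin> X \<union> Y" using False Cons.prems(1) by (auto simp: insert_absorb)
    then have r: "(a, b) \<in> reach en (X \<union> Y)"
      using False forest_insert[of e "X \<union> Y" en a b] ab Cons.prems(1) by blast
    have "reach en (X \<union> Y \<union> set (e # es)) \<subseteq> reach en (X \<union> Y \<union> set es)"
    proof (rule reach_subsetI)
      fix f c d
      assume f: "f \<in> X \<union> Y \<union> set (e # es)" "en f = {c, d}"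
      have sub: "reach en (X \<union> Y) \<subseteq> reach en (X \<union> Y \<union> set es)" by (rule reach_mono) auto
      show "(c, d) \<in> reach en (X \<union> Y \<union> set es)"
      proof (cases "f = e")
        case True
        then have "c = a \<and> d = b \<or> c = b \<and> d = a" using f ab by (auto simp: doubleton_eq_iff)
        then show ?thesis using r sub reach_sym[OF r] by auto
      next
        case False
        then show ?thesis using f by (auto intro: reach_edge)
      qed
    qed
    moreover have "reach en (X \<union> Y \<union> set es) \<subseteq> reach en (X \<union> Y \<union> set (e # es))"
      by (rule reach_mono) auto
    ultimately show ?thesis using False Cons.IH[of Y] Cons.prems
      by (simp add: cycle_free_iff_forest)
  qed
qed simp

lemma greedy_response_accept_all:
  "forest en (X \<union> Y \<union> set es) \<Longrightarrow> greedy_response en X Y es = Y \<union> set es"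
proof (induction es arbitrary: Y)
  case (Cons e es)
  have "forest en (insert e (X \<union> Y))" by (rule forest_mono[OF Cons.prems]) auto
  then show ?case using Cons.IH[of "insert e Y"] Cons.prems by (simp add: cycle_free_iff_forest)
qed simp

lemma greedy_response_reject_all:
  assumes "\<And>e. e \<in> set es \<Longrightarrow> e \<notin> X \<union> Y \<and> (\<exists>a b. en e = {a, b} \<and> (a, b) \<in> reach en (X \<union> Y))"
  shows "greedy_response en X Y es = Y"
  using assms
proof (induction es)
  case (Cons e es)
  obtain a b where "e \<notin> X \<union> Y" "en e = {a, b}" "(a, b) \<in> reach en (X \<union> Y)"
    using Cons.prems[of e] by auto
  then have "\<not> forest en (insert e (X \<union> Y))" using forest_insert[of e "X \<union> Y" en a b] by blast
  then show ?case using Cons by (simp add: cycle_free_iff_forest)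
qed simp

section \<open>The gadget\<close>

text \<open>Trees are indexed by terminal sets instead of list positions. For nonempty pairwise
  disjoint sets this loses nothing, since different positions carry different sets.\<close>

definition disjoint_trees :: "('e \<Rightarrow> 'v set) \<Rightarrow> 'e set \<Rightarrow> 'v set set \<Rightarrow> ('v set \<Rightarrow> 'e set) \<Rightarrow> bool" where
  "disjoint_trees en E P T \<longleftrightarrow> (\<forall>S\<in>P. T S \<subseteq> E \<and> spanning_tree_of en S (T S)) \<and>
     (\<forall>S\<in>P. \<forall>S'\<in>P. S \<noteq> S' \<longrightarrow> tree_verts en S (T S) \<inter> tree_verts en S' (T S') = {})"

definition comp_of :: "('e \<Rightarrow> 'v set) \<Rightarrow> 'e set \<Rightarrow> 'v \<Rightarrow> 'v set" where
  "comp_of en F s = reach en F `` {s}"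

definition comp_edges :: "('e \<Rightarrow> 'v set) \<Rightarrow> 'e set \<Rightarrow> 'v \<Rightarrow> 'e set" where
  "comp_edges en F s = {e\<in>F. en e \<subseteq> comp_of en F s}"

lemma reach_comp_edges:
  assumes "(s, v) \<in> reach en F"
  shows "(s, v) \<in> reach en (comp_edges en F s)"
  using assms
proof (induction rule: reach_induct)
  case (step x y e)
  have "(s, y) \<in> reach en F"
    by (rule reach_trans[OF step.hyps(1) reach_edge]) (fact step.hyps)+
  then have "e \<in> comp_edges en F s"
    using step.hyps by (simp add: comp_edges_def comp_of_def)
  then have "(x, y) \<in> reach en (comp_edges en F s)" using step.hyps(3) by (rule reach_edge)
  with step.IH show ?case by (rule reach_trans)
qed simp

text \<open>In a forest, the edges inside one component already form a tree. It may have branches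
  without terminals, which is permitted; its cost is bounded later by that of all chosen
  edges.\<close>

lemma spanning_tree_comp_edges:
  assumes "forest en F" "S \<subseteq> comp_of en F s"
  shows "spanning_tree_of en S (comp_edges en F s)"
    and "tree_verts en S (comp_edges en F s) \<subseteq> comp_of en F s"
proof -
  show sub: "tree_verts en S (comp_edges en F s) \<subseteq> comp_of en F s"
    using assms(2) by (auto simp: tree_verts_def comp_edges_def)
  have "(u, v) \<in> reach en (comp_edges en F s)"
    if "u \<in> comp_of en F s" "v \<in> comp_of en F s" for u v
    using that reach_comp_edges[of s u en F] reach_comp_edges[of s v en F]
    by (simp add: comp_of_def) (metis reach_trans reach_sym)
  moreover have "forest en (comp_edges en F s)"
    by (rule forest_mono[OF assms(1)]) (auto simp: comp_edges_def)
  ultimately show "spanning_tree_of en S (comp_edges en F s)"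
    using sub unfolding spanning_tree_of_def connected_graph_iff cycle_free_iff_forest by blast
qed

text \<open>The gadget without edge numbers: \<open>r\<close> is the hub, \<open>spoke\<close> gives
  the leader's edges at the hub, \<open>M\<close> lists the links and \<open>stars\<close> the star
  edges. The links and the star edge of \<open>S\<close> all meet at \<open>root S\<close>.\<close>

locale gadget =
  fixes V :: "'v set" and r :: 'v and E :: "'e set" and en :: "'e \<Rightarrow> 'v set"
    and P :: "'v set set" and root :: "'v set \<Rightarrow> 'v"
    and spoke :: "'v \<Rightarrow> 'e" and M :: "'e list" and star :: "'v set \<Rightarrow> 'e" and stars :: "'e list"
    and l c :: "'e \<Rightarrow> real" and L :: real
  assumes fin: "finite V" "finite E" "finite P"
    and r: "r \<notin> V"
    and E: "\<And>e. e \<in> E \<Longrightarrow> \<exists>a\<in>V. \<exists>b\<in>V. en e = {a, b}"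
    and P: "\<And>S. S \<in> P \<Longrightarrow> S \<subseteq> V" "\<And>S. S \<in> P \<Longrightarrow> root S \<in> S"
      "\<And>S S'. S \<in> P \<Longrightarrow> S' \<in> P \<Longrightarrow> S \<noteq> S' \<Longrightarrow> S \<inter> S' = {}"
    and spoke: "\<And>v. v \<in> V \<Longrightarrow> en (spoke v) = {r, v}" "spoke ` V \<inter> E = {}"
    and M: "\<And>e. e \<in> set M \<Longrightarrow> \<exists>S\<in>P. \<exists>x\<in>S. en e = {root S, x}"
      "\<And>S x. S \<in> P \<Longrightarrow> x \<in> S \<Longrightarrow> x \<noteq> root S \<Longrightarrow> \<exists>e\<in>set M. en e = {root S, x}"
      "set M \<inter> (E \<union> spoke ` V) = {}"
    and star: "\<And>S. S \<in> P \<Longrightarrow> en (star S) = {r, root S}"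
      "set stars = star ` P" "set stars \<inter> (E \<union> spoke ` V \<union> set M) = {}"
    and l: "\<And>e. e \<in> E \<Longrightarrow> 0 \<le> l e" "sum l E < L"
    and c: "\<And>e. e \<in> E \<Longrightarrow> c e = l e + L" "\<And>v. v \<in> V \<Longrightarrow> c (spoke v) = L"
      "\<And>e. e \<in> set M \<Longrightarrow> c e = 2 * L" "\<And>e. e \<in> set stars \<Longrightarrow> c e = 0"
begin

definition feasible :: "'e set \<Rightarrow> bool" where
  "feasible X \<longleftrightarrow> X \<subseteq> E \<union> spoke ` V \<and> cycle_free en X \<and>
     connected_graph en (insert r V) (X \<union> (set M \<union> set stars))"

definition resp :: "'e set \<Rightarrow> 'e set" where
  "resp X = greedy_response en X {} (M @ stars)"

definition cost :: "'e set \<Rightarrow> real" where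
  "cost X = sum c (X \<union> resp X)"

lemma root_V: "S \<in> P \<Longrightarrow> root S \<in> V"
  using P by blast

lemma inj_star: "inj_on star P"
proof (rule inj_onI)
  fix S S'
  assume S: "S \<in> P" "S' \<in> P" "star S = star S'"
  then have "{r, root S} = {r, root S'}" using star(1)[OF S(1)] star(1)[OF S(2)] by simp
  then have "root S = root S'"
    using root_V[OF S(1)] root_V[OF S(2)] r by (auto simp: doubleton_eq_iff)
  then show "S = S'" using P(2)[OF S(1)] P(2)[OF S(2)] P(3)[OF S(1,2)] by auto
qed

lemma card_stars: "card (set stars) = card P"
  unfolding star(2) by (rule card_image[OF inj_star])

lemma L_pos: "0 < L"
proof -
  have "0 \<le> sum l E" by (rule sum_nonneg) (rule l(1))
  then show ?thesis using l(2) by linarith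
qed

lemma leader_finite: "X \<subseteq> E \<union> spoke ` V \<Longrightarrow> finite X"
  using fin finite_subset by blast

lemma sum_leader:
  assumes "X \<subseteq> E \<union> spoke ` V"
  shows "sum c X = L * card X + sum l (X \<inter> E)"
proof -
  have fX: "finite X" by (rule leader_finite[OF assms])
  have "sum c X = (\<Sum>e\<in>X. L + (if e \<in> E then l e else 0))"
  proof (rule sum.cong)
    show "c e = L + (if e \<in> E then l e else 0)" if "e \<in> X" for e
      using that assms c(1,2) by auto
  qed simp
  also have "\<dots> = L * card X + sum l (X \<inter> E)"
    using fX by (simp add: sum.distrib sum.inter_restrict)
  finally show ?thesis .
qed

lemma ends_V:
  assumes "e \<in> E \<union> spoke ` V \<union> (set M \<union> set stars)"
  shows "\<exists>a\<in>insert r V. \<exists>b\<in>insert r V. en e = {a, b}"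
proof -
  consider "e \<in> E" | "e \<in> spoke ` V" | "e \<in> set M" | "e \<in> set stars" using assms by blast
  then show ?thesis
  proof cases
    case 1
    then show ?thesis using E by blast
  next
    case 2
    then obtain v where "v \<in> V" "e = spoke v" by blast
    then show ?thesis using spoke(1)[of v] by auto
  next
    case 3
    then obtain S x where "S \<in> P" "x \<in> S" "en e = {root S, x}" using M(1) by blast
    then show ?thesis using P(1)[of S] root_V[of S] by auto
  next
    case 4
    then obtain S where "S \<in> P" "e = star S" unfolding star(2) by blast
    then show ?thesis using star(1)[of S] root_V[of S] by auto
  qed
qed

lemma resp_subset: "resp X \<subseteq> set M \<union> set stars"
  using greedy_response_subset[of en X "{}" "M @ stars"] by (simp add: resp_def)

lemma card_feasible:
  assumes "feasible X"
  shows "forest en (X \<union> resp X)" and "card X + card (resp X) = card V"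
proof -
  have X: "X \<subseteq> E \<union> spoke ` V" "forest en X"
    "connected_graph en (insert r V) (X \<union> (set M \<union> set stars))"
    using assms by (auto simp: feasible_def cycle_free_iff_forest)
  show f: "forest en (X \<union> resp X)"
    unfolding resp_def by (rule forest_greedy_response) (simp add: X)
  have "reach en (X \<union> resp X) = reach en (X \<union> {} \<union> set (M @ stars))"
    unfolding resp_def
  proof (rule reach_greedy_response)
    show "\<exists>a b. en e = {a, b}" if "e \<in> set (M @ stars)" for e
      using ends_V[of e] that by auto
  qed (simp add: X)
  then have conn: "connected_graph en (insert r V) (X \<union> resp X)"
    using X(3) by (simp add: connected_graph_iff)
  have finX: "finite X" by (rule leader_finite[OF X(1)])
  have finY: "finite (resp X)" using resp_subset finite_subset by blast
  have "Suc (card (X \<union> resp X)) = card (insert r V)"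
  proof (rule card_spanning_tree)
    show "\<exists>a\<in>insert r V. \<exists>b\<in>insert r V. en e = {a, b}" if "e \<in> X \<union> resp X" for e
      by (rule ends_V) (use that X(1) resp_subset in blast)
  qed (use fin finX finY f conn in auto)
  moreover have "X \<inter> resp X = {}"
    using X(1) resp_subset M(3) star(3) by blast
  ultimately show "card X + card (resp X) = card V"
    using finX finY fin r by (simp add: card_Un_disjoint)
qed

lemma cost_eq:
  assumes "feasible X"
  shows "cost X = L * (real (card V) + card (resp X \<inter> set M) - card (resp X \<inter> set stars)) +
    sum l (X \<inter> E)"
proof -
  have X: "X \<subseteq> E \<union> spoke ` V" using assms by (simp add: feasible_def)
  let ?Y = "resp X"
  have fin': "finite X" "finite ?Y"
    using leader_finite[OF X] resp_subset finite_subset by blast+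
  have dis: "X \<inter> ?Y = {}" using X resp_subset M(3) star(3) by blast
  have Y: "?Y = (?Y \<inter> set M) \<union> (?Y \<inter> set stars)" "(?Y \<inter> set M) \<inter> (?Y \<inter> set stars) = {}"
    using resp_subset star(3) by blast+
  have "cost X = sum c X + sum c ?Y"
    unfolding cost_def by (rule sum.union_disjoint[OF fin' dis])
  also have "sum c ?Y = sum c (?Y \<inter> set M) + sum c (?Y \<inter> set stars)"
    by (subst Y(1), rule sum.union_disjoint) (use Y(2) in auto)
  also have "sum c (?Y \<inter> set M) = 2 * L * card (?Y \<inter> set M)"
    using c(3) by simp
  also have "sum c (?Y \<inter> set stars) = 0"
    using c(4) by simp
  also have "sum c X = L * card X + sum l (X \<inter> E)" by (rule sum_leader[OF X])
  finally have cost: "cost X = L * card X + sum l (X \<inter> E) + 2 * L * card (?Y \<inter> set M)" by simp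
  have "card ?Y = card (?Y \<inter> set M) + card (?Y \<inter> set stars)"
    by (subst Y(1), rule card_Un_disjoint) (use Y(2) in auto)
  then have eq: "real (card V) =
      real (card X) + real (card (?Y \<inter> set M)) + real (card (?Y \<inter> set stars))"
    using card_feasible(2)[OF assms] by linarith
  show ?thesis unfolding cost eq by (simp add: algebra_simps)
qed

text \<open>
  A leader's choice that is cheap enough makes the follower take every star edge and no other one.
\<close>

lemma cheap_choice:
  assumes X: "feasible X" and cheap: "cost X < L * (real (card V) - card P + 1)"
  shows "cost X = L * (real (card V) - card P) + sum l (X \<inter> E)"
    and "\<And>S. S \<in> P \<Longrightarrow> S \<subseteq> comp_of en (X \<inter> E) (root S)"
    and "\<And>S S'. S \<in> P \<Longrightarrow> S' \<in> P \<Longrightarrow> S \<noteq> S' \<Longrightarrow>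
      comp_of en (X \<inter> E) (root S) \<inter> comp_of en (X \<inter> E) (root S') = {}"
proof -
  let ?m = "card (resp X \<inter> set M)" and ?s = "card (resp X \<inter> set stars)"
  have "0 \<le> sum l (X \<inter> E)" using l(1) by (intro sum_nonneg) auto
  then have "L * (real (card V) + ?m - ?s) < L * (real (card V) - card P + 1)"
    using cheap cost_eq[OF X] by linarith
  then have "real (card V) + ?m - ?s < real (card V) - card P + 1"
    using L_pos by (simp only: mult_less_cancel_left_pos)
  \<comment> \<open>Integers are compared, so being less than one unit above the minimum means
    attaining it: as there are only \<open>card P\<close> star edges, all are taken, and no link
    is.\<close>
  then have "card P + ?m \<le> ?s" by linarith
  moreover have "?s \<le> card P"
    using card_mono[of "set stars" "resp X \<inter> set stars"] card_stars by simp
  ultimately have s: "?s = card P" and m: "?m = 0" by linarith+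
  show "cost X = L * (real (card V) - card P) + sum l (X \<inter> E)"
    by (simp only: cost_eq[OF X] s m of_nat_0 add_0_right)
  have "resp X \<inter> set stars = set stars"
    by (rule card_subset_eq) (use s card_stars in auto)
  moreover have noM: "resp X \<inter> set M = {}" using m by simp
  ultimately have resp: "resp X = set stars" using resp_subset[of X] by blast
  have X': "X \<subseteq> E \<union> spoke ` V" "forest en X"
    using X by (auto simp: feasible_def cycle_free_iff_forest)
  \<comment> \<open>The answer to the links alone is part of the whole response, which has no link,
    so it is empty. Hence the ends of every link are connected by \<open>X\<close> itself.\<close>
  have "greedy_response en X {} M \<subseteq> resp X"
    unfolding resp_def greedy_response_append by (rule greedy_response_supset)
  then have "greedy_response en X {} M = {}"
    using greedy_response_subset[of en X "{}" M] noM by blast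
  moreover have "reach en (X \<union> greedy_response en X {} M) = reach en (X \<union> {} \<union> set M)"
  proof (rule reach_greedy_response)
    show "\<exists>a b. en e = {a, b}" if "e \<in> set M" for e
      using ends_V[of e] that by auto
  qed (simp add: X')
  ultimately have reachM: "reach en (X \<union> set M) = reach en X" by simp
  have forest: "forest en (X \<union> set stars)"
    using card_feasible(1)[OF X] resp by simp
  \<comment> \<open>The star edges belong to a forest, so each is the only connection between the
    hub and its root.\<close>
  have star_cut: "(r, root S) \<notin> reach en (X \<union> set stars - {star S})" if "S \<in> P" for S
  proof -
    have "star S \<in> X \<union> set stars" using star(2) that by simp
    with forest star(1)[OF that] show ?thesis unfolding forest_def by simp
  qed
  have star_notin: "star S \<notin> X" if "S \<in> P" for S
  proof -
    have "star S \<in> set stars" using star(2) that by simp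
    then show ?thesis using X'(1) star(3) by blast
  qed
  have sep_r: "(root S, r) \<notin> reach en X" if S: "S \<in> P" for S
  proof
    assume "(root S, r) \<in> reach en X"
    moreover have "reach en X \<subseteq> reach en (X \<union> set stars - {star S})"
      by (rule reach_mono) (use star_notin[OF S] in auto)
    ultimately have "(root S, r) \<in> reach en (X \<union> set stars - {star S})" by blast
    from reach_sym[OF this] show False using star_cut[OF S] by contradiction
  qed
  \<comment> \<open>Two roots connected by \<open>X\<close> would give a detour around
    \<open>star S\<close>: over \<open>star S'\<close> and then through \<open>X\<close>.\<close>
  have sep: "(root S, root S') \<notin> reach en X" if S: "S \<in> P" "S' \<in> P" "S \<noteq> S'" for S S'
  proof
    assume "(root S, root S') \<in> reach en X"
    moreover have "reach en X \<subseteq> reach en (X \<union> set stars - {star S})"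
      by (rule reach_mono) (use star_notin[OF S(1)] in auto)
    ultimately have "(root S, root S') \<in> reach en (X \<union> set stars - {star S})" by blast
    note backward = reach_sym[OF this]
    have "star S' \<in> X \<union> set stars - {star S}"
      using S inj_star star(2) by (auto simp: inj_on_def)
    then have "(r, root S') \<in> reach en (X \<union> set stars - {star S})"
      using star(1)[OF S(2)] by (rule reach_edge)
    from reach_trans[OF this backward] show False using star_cut[OF S(1)] by contradiction
  qed
  \<comment> \<open>A path in \<open>X\<close> that starts at a root avoids all spokes, since a
    spoke would put the hub on it; so it runs inside \<open>E\<close>.\<close>
  have inE: "(root S, v) \<in> reach en (X \<inter> E)" if "(root S, v) \<in> reach en X" "S \<in> P" for S v
    using that(1)
  proof (induction rule: reach_induct)
    case (step x y e)
    have y: "(root S, y) \<in> reach en X"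
      by (rule reach_trans[OF step.hyps(1) reach_edge]) (fact step.hyps)+
    have "e \<in> E"
    proof (rule ccontr)
      assume "e \<notin> E"
      then obtain v where "v \<in> V" "e = spoke v" using X'(1) step.hyps by blast
      then have "{x, y} = {r, v}" using spoke(1)[of v] step.hyps by simp
      then have "r \<in> {x, y}" by simp
      then show False using sep_r[OF that(2)] step.hyps y by auto
    qed
    then have "(x, y) \<in> reach en (X \<inter> E)" using step.hyps by (intro reach_edge) auto
    with step.IH show ?case by (rule reach_trans)
  qed simp
  have sub: "reach en (X \<inter> E) \<subseteq> reach en X" by (rule reach_mono) auto
  show "S \<subseteq> comp_of en (X \<inter> E) (root S)" if S: "S \<in> P" for S
  proof
    fix x
    assume x: "x \<in> S"
    show "x \<in> comp_of en (X \<inter> E) (root S)"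
    proof (cases "x = root S")
      case False
      then obtain e where e: "e \<in> set M" "en e = {root S, x}" using M(2) S x by blast
      then have "(root S, x) \<in> reach en (X \<union> set M)" by (intro reach_edge) auto
      then show ?thesis using inE S unfolding reachM comp_of_def by simp
    qed (simp add: comp_of_def)
  qed
  show "comp_of en (X \<inter> E) (root S) \<inter> comp_of en (X \<inter> E) (root S') = {}"
    if S: "S \<in> P" "S' \<in> P" "S \<noteq> S'" for S S'
  proof (rule ccontr)
    assume "\<not> ?thesis"
    then obtain v where v: "(root S, v) \<in> reach en (X \<inter> E)" "(root S', v) \<in> reach en (X \<inter> E)"
      by (auto simp: comp_of_def)
    from reach_trans[OF v(1) reach_sym[OF v(2)]] show False using sep[OF S] sub by blast
  qed
qed

text \<open>The witness consists of the trees and a spoke for every vertex outside all trees. With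
  the star edges, each tree hangs on the hub by its root and each other vertex by its spoke, so a
  spanning tree results.\<close>

lemma trees_choice:
  assumes T: "disjoint_trees en E P T"
  shows "\<exists>X. feasible X \<and>
    cost X = L * (real (card V) - card P) + (\<Sum>S\<in>P. sum l (T S)) \<and>
    cost X < L * (real (card V) - card P + 1)"
proof -
  define tv where "tv S = tree_verts en S (T S)" for S
  define U where "U = (\<Union>S\<in>P. tv S)"
  define X where "X = (\<Union>S\<in>P. T S) \<union> spoke ` (V - U)"
  define Z where "Z = X \<union> set stars"
  have TE: "T S \<subseteq> E" if "S \<in> P" for S
    using T that by (simp add: disjoint_trees_def)
  have Tf: "forest en (T S)" if "S \<in> P" for S
    using T that by (simp add: disjoint_trees_def spanning_tree_of_def cycle_free_iff_forest)
  have Tconn: "(u, v) \<in> reach en (T S)" if "S \<in> P" "u \<in> tv S" "v \<in> tv S" for S u v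
    using T that
    by (simp add: disjoint_trees_def spanning_tree_of_def connected_graph_iff tv_def)
  have tv_dis: "tv S \<inter> tv S' = {}" if "S \<in> P" "S' \<in> P" "S \<noteq> S'" for S S'
    using T that by (simp add: disjoint_trees_def tv_def)
  have en_tv: "en e \<subseteq> tv S" if "e \<in> T S" for e S
    using that by (auto simp: tv_def tree_verts_def)
  have S_tv: "S \<subseteq> tv S" for S by (auto simp: tv_def tree_verts_def)
  have root_tv: "root S \<in> tv S" if "S \<in> P" for S using P(2) that S_tv by blast
  have tv_V: "tv S \<subseteq> V" if S: "S \<in> P" for S
  proof -
    have "en e \<subseteq> V" if e: "e \<in> T S" for e
    proof -
      obtain a b where "a \<in> V" "b \<in> V" "en e = {a, b}" using E[of e] TE[OF S] e by blast
      then show ?thesis by simp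
    qed
    then show ?thesis using P(1)[OF S] by (auto simp: tv_def tree_verts_def)
  qed
  have UV: "U \<subseteq> V" using tv_V by (auto simp: U_def)
  have Xsub: "X \<subseteq> E \<union> spoke ` V" using TE by (auto simp: X_def)
  have Z_cases: "(\<exists>S\<in>P. e \<in> T S) \<or> (\<exists>v\<in>V - U. e = spoke v) \<or> (\<exists>S\<in>P. e = star S)" if "e \<in> Z" for e
    using that star(2) by (auto simp: Z_def X_def)
  \<comment> \<open>The only edge of \<open>Z\<close> that leaves the vertices of a tree is its star
    edge at the root. The target set \<open>A\<close> is left open, as the fact serves both for a
    whole tree and for a part cut off by deleting a tree edge.\<close>
  have outside: "y \<in> A"
    if f: "f \<in> Z" "en f = {x, y}" "x \<in> tv S" and S: "S \<in> P"
      and "f \<noteq> star S \<or> x \<noteq> root S"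
      and tree: "f \<in> T S \<Longrightarrow> y \<in> A" for f x y S A
  proof -
    have xV: "x \<in> V" "x \<in> U" using tv_V S f by (auto simp: U_def)
    consider S' where "S' \<in> P" "f \<in> T S'" | v where "v \<in> V - U" "f = spoke v"
      | S' where "S' \<in> P" "f = star S'"
      using Z_cases[OF f(1)] by blast
    then show ?thesis
    proof cases
      case 1
      then have "x \<in> tv S'" using en_tv[OF 1(2)] f by auto
      then have "S' = S" using tv_dis[of S S'] S 1 f by blast
      then show ?thesis using 1 tree by simp
    next
      case 2
      then have "{x, y} = {r, v}" using spoke(1)[of v] f by auto
      then show ?thesis using xV 2 r by (auto simp: doubleton_eq_iff)
    next
      case 3
      then have "{x, y} = {r, root S'}" using star(1) f by auto
      then have x: "x = root S'" using xV r by (auto simp: doubleton_eq_iff)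
      then have "S' = S" using tv_dis[of S S'] S 3 f root_tv[of S'] by blast
      then show ?thesis using that(5) 3 x by simp
    qed
  qed
  have forestZ: "forest en Z"
    unfolding forest_def
  proof (intro ballI allI impI notI)
    fix e a b
    assume e: "e \<in> Z" "en e = {a, b}" and ab: "(a, b) \<in> reach en (Z - {e})"
    consider S where "S \<in> P" "e \<in> T S" | v where "v \<in> V - U" "e = spoke v"
      | S where "S \<in> P" "e = star S"
      using Z_cases[OF e(1)] by blast
    then show False
    proof cases
      case (1 S)
      let ?H = "T S - {e}"
      have nab: "(a, b) \<notin> reach en ?H" using Tf[OF 1(1)] 1(2) e(2) unfolding forest_def by simp
      \<comment> \<open>Deleting \<open>e\<close> splits the tree. The part containing
        \<open>u\<close> lacks the root and therefore has no other exit, so it is closed under all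
        remaining edges of \<open>Z\<close> and \<open>w\<close> cannot be reached.\<close>
      have key: False if uw: "(u, w) \<in> reach en (Z - {e})" "(u, w) \<notin> reach en ?H" "u \<in> tv S"
        and ns: "(u, root S) \<notin> reach en ?H" for u w
      proof -
        have "w \<in> reach en ?H `` {u}"
        proof (rule reach_closed[OF uw(1)])
          fix f x y
          assume f: "f \<in> Z - {e}" "en f = {x, y}" "x \<in> reach en ?H `` {u}"
          then have ux: "(u, x) \<in> reach en ?H" by simp
          have "x \<in> tv S"
          proof (rule reach_closed[OF ux uw(3)])
            show "q \<in> tv S" if "g \<in> ?H" "en g = {p, q}" for g p q
            proof -
              have "en g \<subseteq> tv S" using that(1) by (intro en_tv) simp
              then show ?thesis using that(2) by simp
            qed
          qed
          moreover have "x \<noteq> root S" using ns ux by blast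
          moreover have "y \<in> reach en ?H `` {u}" if "f \<in> T S"
          proof -
            have "f \<in> ?H" using that f(1) by simp
            then have "(x, y) \<in> reach en ?H" using f(2) by (rule reach_edge)
            then show ?thesis using reach_trans[OF ux] by simp
          qed
          ultimately show "y \<in> reach en ?H `` {u}"
            using outside[of f x y S "reach en ?H `` {u}"] f(1,2) 1(1) by blast
        qed simp
        then show False using uw(2) by simp
      qed
      have tv: "a \<in> tv S" "b \<in> tv S" using en_tv[OF 1(2)] e(2) by auto
      have nba: "(b, a) \<notin> reach en ?H" using nab reach_sym[of b a en ?H] by blast
      \<comment> \<open>At least one end of \<open>e\<close> is cut off from the root; otherwise the
        two ends would be connected through it.\<close>
      show False
      proof (cases "(a, root S) \<in> reach en ?H")
        case True
        have "(b, root S) \<notin> reach en ?H"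
        proof
          assume "(b, root S) \<in> reach en ?H"
          from reach_trans[OF True reach_sym[OF this]] show False using nab by contradiction
        qed
        then show False by (rule key[OF reach_sym[OF ab] nba tv(2)])
      next
        case False
        then show False by (rule key[OF ab nab tv(1)])
      qed
    next
      case (2 v)
      then have "{a, b} = {r, v}" using spoke(1)[of v] e by auto
      then have vr: "(v, r) \<in> reach en (Z - {e})"
        using ab reach_sym[OF ab] by (auto simp: doubleton_eq_iff)
      \<comment> \<open>No tree and no star edge touches \<open>v\<close>, so the deleted spoke was
        the only edge at \<open>v\<close>.\<close>
      have "r \<in> {v}"
      proof (rule reach_closed[OF vr])
        fix f x y
        assume f: "f \<in> Z - {e}" "en f = {x, y}" "x \<in> {v}"
        then have fZ: "f \<in> Z" and v: "v \<in> en f" by auto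
        have nr: "v \<noteq> r" using 2 r by auto
        from Z_cases[OF fZ] show "y \<in> {v}"
        proof (elim disjE bexE)
          fix S assume "S \<in> P" "f \<in> T S"
          then show ?thesis using en_tv v 2 by (auto simp: U_def)
        next
          fix v' assume "v' \<in> V - U" "f = spoke v'"
          then show ?thesis using spoke(1)[of v'] v nr f 2 by auto
        next
          fix S assume "S \<in> P" "f = star S"
          then show ?thesis using star(1) v nr root_tv 2 by (auto simp: U_def)
        qed
      qed simp
      then show False using 2 r by auto
    next
      case (3 S)
      then have "{a, b} = {r, root S}" using star(1) e by auto
      then have sr: "(root S, r) \<in> reach en (Z - {e})"
        using ab reach_sym[OF ab] by (auto simp: doubleton_eq_iff)
      \<comment> \<open>Without its star edge, the tree has no exit at all.\<close>
      have "r \<in> tv S"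
      proof (rule reach_closed[OF sr root_tv[OF 3(1)]])
        fix f x y
        assume f: "f \<in> Z - {e}" "en f = {x, y}" "x \<in> tv S"
        show "y \<in> tv S"
          by (rule outside[of f x y S]) (use f 3 en_tv in auto)
      qed
      then show False using tv_V[OF 3(1)] r by auto
    qed
  qed
  have to_r: "(v, r) \<in> reach en Z" if "v \<in> insert r V" for v
  proof -
    consider "v = r" | "v \<in> V - U" | S where "S \<in> P" "v \<in> tv S"
      using \<open>v \<in> insert r V\<close> by (auto simp: U_def)
    then show ?thesis
    proof cases
      case 2
      then have "(r, v) \<in> reach en Z"
        by (intro reach_edge[of "spoke v"]) (use spoke(1) in \<open>auto simp: Z_def X_def\<close>)
      then show ?thesis by (rule reach_sym)
    next
      case 3
      have "(v, root S) \<in> reach en (T S)" using Tconn 3 root_tv by simp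
      moreover have "reach en (T S) \<subseteq> reach en Z"
        by (rule reach_mono) (use 3 in \<open>auto simp: Z_def X_def\<close>)
      moreover have "(r, root S) \<in> reach en Z"
        by (rule reach_edge[of "star S"]) (use 3 star in \<open>auto simp: Z_def\<close>)
      ultimately show ?thesis
        using reach_trans[OF _ reach_sym, of v "root S" en Z r] by blast
    qed simp
  qed
  have forestX: "forest en X" by (rule forest_mono[OF forestZ]) (simp add: Z_def)
  have "connected_graph en (insert r V) (X \<union> (set M \<union> set stars))"
    unfolding connected_graph_iff
  proof (intro ballI)
    fix u v
    assume "u \<in> insert r V" "v \<in> insert r V"
    then have "(u, v) \<in> reach en Z" using reach_trans[OF to_r reach_sym[OF to_r]] by simp
    moreover have "reach en Z \<subseteq> reach en (X \<union> (set M \<union> set stars))"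
      by (rule reach_mono) (auto simp: Z_def)
    ultimately show "(u, v) \<in> reach en (X \<union> (set M \<union> set stars))" by blast
  qed
  then have feas: "feasible X"
    using Xsub forestX by (simp add: feasible_def cycle_free_iff_forest)
  \<comment> \<open>Each link joins two vertices of one tree, so the follower rejects all links; the
    star edges are then all accepted because \<open>Z\<close> is a forest.\<close>
  have "greedy_response en X {} M = {}"
  proof (rule greedy_response_reject_all)
    fix e
    assume e: "e \<in> set M"
    obtain S x where S: "S \<in> P" "x \<in> S" "en e = {root S, x}" using M(1)[OF e] by blast
    have "(root S, x) \<in> reach en (T S)" using Tconn[OF S(1)] root_tv S S_tv by blast
    moreover have "reach en (T S) \<subseteq> reach en (X \<union> {})"
      by (rule reach_mono) (use S in \<open>auto simp: X_def\<close>)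
    moreover have "e \<notin> X \<union> {}" using e Xsub M(3) by blast
    ultimately show "e \<notin> X \<union> {} \<and> (\<exists>a b. en e = {a, b} \<and> (a, b) \<in> reach en (X \<union> {}))"
      using S(3) by blast
  qed
  then have resp: "resp X = set stars"
    unfolding resp_def greedy_response_append
    using greedy_response_accept_all[of en X "{}" stars] forestZ by (simp add: Z_def)
  have "resp X \<inter> set M = {}" "resp X \<inter> set stars = set stars" using resp star(3) by auto
  then have cost: "cost X = L * (real (card V) - card P) + sum l (X \<inter> E)"
    using cost_eq[OF feas] card_stars by simp
  have "sum l (X \<inter> E) \<le> sum l E"
    by (rule sum_mono2) (use fin(2) l(1) in auto)
  then have "cost X < L * (real (card V) - card P + 1)"
    using cost l(2) by (simp add: algebra_simps)
  moreover note cost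
  moreover have "X \<inter> E = (\<Union>S\<in>P. T S)" using TE spoke(2) by (auto simp: X_def)
  moreover have "sum l (\<Union>S\<in>P. T S) = (\<Sum>S\<in>P. sum l (T S))"
  proof (rule sum.UNION_disjoint)
    show "\<forall>S\<in>P. finite (T S)" using TE fin(2) finite_subset by blast
    show "\<forall>S\<in>P. \<forall>S'\<in>P. S \<noteq> S' \<longrightarrow> T S \<inter> T S' = {}"
    proof (intro ballI impI, rule ccontr)
      fix S S'
      assume S: "S \<in> P" "S' \<in> P" "S \<noteq> S'" "T S \<inter> T S' \<noteq> {}"
      then obtain e where e: "e \<in> T S" "e \<in> T S'" by blast
      then have "en e \<noteq> {}" using TE S(1) E by blast
      then show False using en_tv[OF e(1)] en_tv[OF e(2)] tv_dis S by blast
    qed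
  qed (rule fin)
  ultimately show ?thesis using feas by auto
qed

end

section \<open>Programs for the reduction\<close>

text \<open>Lengths appear as arbitrary pairs of natural numbers. In this way all encodings are
  built from \<open>enc_pair\<close> and \<open>enc_list\<close>, and the programs need no
  precondition on their input.\<close>

type_synonym raw_edge = "nat \<times> nat \<times> nat \<times> nat"
type_synonym raw_svdst = "nat list \<times> raw_edge list \<times> nat list list"

definition enc_raw_edge :: "raw_edge \<Rightarrow> val" where
  "enc_raw_edge = enc_pair Num (enc_pair Num (enc_pair Num Num))"

definition enc_raw_svdst :: "raw_svdst \<Rightarrow> val" where
  "enc_raw_svdst = enc_pair (enc_list Num) (enc_pair (enc_list enc_raw_edge) (enc_list (enc_list Num)))"

definition fraction :: "rat \<Rightarrow> nat \<times> nat" where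
  "fraction q = (nat (fst (quotient_of q)), nat (snd (quotient_of q)))"

definition raw_svdst :: "svdst_input \<Rightarrow> raw_svdst" where
  "raw_svdst I = (sv_verts I, map (\<lambda>(u, v, l). (u, v, fraction l)) (sv_edges I), sv_terminals I)"

lemma enc_list_map: "enc_list e (map f xs) = enc_list (\<lambda>x. e (f x)) xs"
  by (induction xs) auto

lemma enc_rat_fraction: "enc_rat q = enc_pair Num Num (fraction q)"
  by (simp add: enc_rat_def fraction_def split: prod.split)

lemma enc_raw_svdst_eq: "enc_raw_svdst (raw_svdst I) = enc_svdst I"
proof -
  have "(\<lambda>x. enc_raw_edge (case x of (u, v, l) \<Rightarrow> (u, v, fraction l))) =
      (\<lambda>(u, v, l). Node (Num u) (Node (Num v) (enc_rat l)))"
    by (auto simp: enc_raw_edge_def enc_rat_fraction fraction_def)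
  then show ?thesis
    by (simp add: enc_raw_svdst_def raw_svdst_def enc_svdst_def enc_list_map)
qed

text \<open>In \<open>x\<close> the edge number comes first, followed by the two ends. An end is
  added only if it is missing, so the list stays free of repetitions.\<close>

definition spread1 :: "nat \<times> raw_edge \<Rightarrow> nat list \<Rightarrow> nat list" where
  "spread1 x C =
     (if fst (snd x) \<in> set C
      then if fst (snd (snd x)) \<in> set C then C else fst (snd (snd x)) # C
      else if fst (snd (snd x)) \<in> set C then fst (snd x) # C else C)"

text \<open>
  One round follows every edge of \<open>F\<close>. As \<open>joins F\<close> below has at most \<open>2 * length F\<close> elements,
  so many rounds reach everything.
\<close>

definition reach_list :: "(nat \<times> raw_edge) list \<Rightarrow> nat \<Rightarrow> nat list" where
  "reach_list F s = fold (\<lambda>_. fold spread1 F) (F @ F) [s]"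

definition joins :: "(nat \<times> raw_edge) list \<Rightarrow> (nat \<times> nat) set" where
  "joins F = {(a, b). \<exists>x\<in>set F. {fst (snd x), fst (snd (snd x))} = {a, b}}"

lemma fold_spread1_supset: "set C \<subseteq> set (fold spread1 F C)"
  by (induction F arbitrary: C) (auto simp: spread1_def, (meson set_subset_Cons subset_eq)+)

lemma fold_spread1_joins:
  assumes "(a, b) \<in> joins F" "a \<in> set C"
  shows "b \<in> set (fold spread1 F C)"
  using assms
proof (induction F arbitrary: C)
  case (Cons x F)
  show ?case
  proof (cases "(a, b) \<in> joins F")
    case True
    moreover have "a \<in> set (spread1 x C)" using Cons.prems by (auto simp: spread1_def)
    ultimately show ?thesis using Cons.IH by simp
  next
    case False
    then have "{fst (snd x), fst (snd (snd x))} = {a, b}"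
      using Cons.prems(1) by (auto simp: joins_def)
    then have "b \<in> set (spread1 x C)"
      using Cons.prems(2) by (auto simp: spread1_def doubleton_eq_iff)
    then show ?thesis using fold_spread1_supset[of "spread1 x C" F] by auto
  qed
qed (simp add: joins_def)

lemma fold_spread1_sound:
  assumes "set C \<subseteq> (joins G)\<^sup>* `` {s}" "set F \<subseteq> set G"
  shows "set (fold spread1 F C) \<subseteq> (joins G)\<^sup>* `` {s}"
  using assms
proof (induction F arbitrary: C)
  case (Cons x F)
  have "(fst (snd x), fst (snd (snd x))) \<in> joins G" "(fst (snd (snd x)), fst (snd x)) \<in> joins G"
    using Cons.prems(2) by (auto simp: joins_def)
  then have "set (spread1 x C) \<subseteq> (joins G)\<^sup>* `` {s}"
    using Cons.prems(1) unfolding spread1_def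
    by (auto intro: rtrancl_into_rtrancl split: if_splits)
  then show ?case using Cons by simp
qed simp

text \<open>After \<open>k\<close> rounds everything within distance \<open>k\<close> has been
  found, and further rounds lose nothing. A reachable vertex needs at most as many steps as there
  are pairs in \<open>joins F\<close>, and each edge provides at most two, one per
  direction.\<close>

lemma set_reach_list: "set (reach_list F s) = (joins F)\<^sup>* `` {s}"
proof
  have "set (fold (\<lambda>_. fold spread1 F) ys C) \<subseteq> (joins F)\<^sup>* `` {s}"
    if "set C \<subseteq> (joins F)\<^sup>* `` {s}" for ys :: "(nat \<times> raw_edge) list" and C
    using that by (induction ys arbitrary: C) (simp_all add: fold_spread1_sound)
  from this[of "[s]" "F @ F"] show "set (reach_list F s) \<subseteq> (joins F)\<^sup>* `` {s}"
    by (simp add: reach_list_def)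
next
  have rounds: "b \<in> set (fold (\<lambda>_. fold spread1 F) ys C)"
    if "(a, b) \<in> joins F ^^ n" "n \<le> length ys" "a \<in> set C"
    for ys :: "(nat \<times> raw_edge) list" and a b n C
    using that
  proof (induction ys arbitrary: a n C)
    case (Cons y ys)
    show ?case
    proof (cases n)
      case 0
      then show ?thesis
        using Cons.IH[of b 0 "fold spread1 F C"] Cons.prems fold_spread1_supset[of C F] by auto
    next
      case (Suc m)
      then obtain c where "(a, c) \<in> joins F" "(c, b) \<in> joins F ^^ m"
        using Cons.prems(1) by (metis relpow_Suc_D2)
      then show ?thesis
        using Cons.IH[of c m] Cons.prems Suc fold_spread1_joins by simp
    qed
  qed simp
  have sub: "joins F \<subseteq> set (map (\<lambda>x. (fst (snd x), fst (snd (snd x)))) F @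
      map (\<lambda>x. (fst (snd (snd x)), fst (snd x))) F)" (is "_ \<subseteq> set ?L")
    by (auto simp: joins_def doubleton_eq_iff)
  then have "card (joins F) \<le> length ?L"
    by (meson card_length card_mono finite_set le_trans)
  then have card: "card (joins F) \<le> length (F @ F)" by simp
  have "finite (joins F)" using sub finite_subset by blast
  then have "(joins F)\<^sup>* = (\<Union>n\<in>{n. n \<le> card (joins F)}. joins F ^^ n)"
    by (rule rtrancl_finite_eq_relpow)
  then show "(joins F)\<^sup>* `` {s} \<subseteq> set (reach_list F s)"
    using rounds[of s _ _ "F @ F" "[s]"] card unfolding reach_list_def by force
qed

definition enc_sel :: "nat \<times> raw_edge \<Rightarrow> val" where
  "enc_sel = enc_pair Num enc_raw_edge"

text \<open>The growth in one round is bounded independently of \<open>C\<close>, as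
  \<open>ptime_fold\<close> demands for the outer loop.\<close>

lemma vsize_fold_spread1:
  "vsize (enc_list Num (fold spread1 F C)) \<le> vsize (enc_list Num C) + vsize (enc_list enc_sel F)"
proof (induction F arbitrary: C)
  case (Cons x F)
  have "vsize (enc_list Num (spread1 x C)) \<le> vsize (enc_list Num C) + vsize (enc_sel x)"
    by (cases x) (auto simp: spread1_def enc_sel_def enc_raw_edge_def)
  then show ?case using Cons[of "spread1 x C"] by simp
qed simp

lemma ptime_fold_spread1:
  assumes "ptime_fun e (enc_list enc_sel) F" "ptime_fun e (enc_list Num) C"
  shows "ptime_fun e (enc_list Num) (\<lambda>z. fold spread1 (F z) (C z))"
proof (rule ptime_fold[where f = "\<lambda>_. spread1" and q = "[:0, 1:]", OF assms])
  show "ptime_fun (enc_pair e (enc_pair enc_sel (enc_list Num))) (enc_list Num)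
      (\<lambda>w. spread1 (fst (snd w)) (snd (snd w)))"
    unfolding spread1_def enc_sel_def enc_raw_edge_def
    by (rule ptime_basic ptime_mem)+
  show "vsize (enc_list Num (spread1 x a)) \<le>
      vsize (enc_list Num a) + poly [:0, 1:] (vsize (e z) + vsize (enc_sel x))" for z x a
    by (cases x) (auto simp: spread1_def enc_sel_def enc_raw_edge_def)
qed

lemma ptime_reach_list:
  assumes F: "ptime_fun e (enc_list enc_sel) F" and s: "ptime_fun e Num s"
  shows "ptime_fun e (enc_list Num) (\<lambda>z. reach_list (F z) (s z))"
proof -
  obtain r where r: "\<And>z. vsize (enc_list enc_sel (F z)) \<le> poly r (vsize (e z))"
    using ptime_vsize[OF F] by blast
  show ?thesis
    unfolding reach_list_def
  proof (rule ptime_fold[where q = r])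
    show "ptime_fun e (enc_list enc_sel) (\<lambda>z. F z @ F z)" by (rule F ptime_append)+
    show "ptime_fun e (enc_list Num) (\<lambda>z. [s z])" by (rule s ptime_basic)+
    have "ptime_fun (enc_pair e (enc_pair enc_sel (enc_list Num))) (enc_list enc_sel) (\<lambda>w. F (fst w))"
      by (rule ptime_comp[OF F]) (rule ptime_basic)+
    then show "ptime_fun (enc_pair e (enc_pair enc_sel (enc_list Num))) (enc_list Num)
        (\<lambda>w. fold spread1 (F (fst w)) (snd (snd w)))"
      by (rule ptime_fold_spread1) (rule ptime_basic)+
    show "vsize (enc_list Num (fold spread1 (F z) a)) \<le>
        vsize (enc_list Num a) + poly r (vsize (e z) + vsize (enc_sel x))" for z x a
      using vsize_fold_spread1[of "F z" a] r[of z]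
        poly_nat_mono[of "vsize (e z)" "vsize (e z) + vsize (enc_sel x)" r] by linarith
  qed
qed

text \<open>A fresh vertex name: one more than the sum of all names exceeds each of them and takes
  only additions to compute.\<close>

definition hub :: "raw_svdst \<Rightarrow> nat" where
  "hub z = Suc (sum_list (fst z))"

text \<open>This is the constant \<open>L\<close>. The summands are the numerators of the lengths;
  on instances, denominators are at least 1, so no length exceeds its numerator and the sum plus one
  is strictly above the total length.\<close>

definition big :: "raw_svdst \<Rightarrow> nat" where
  "big z = Suc (sum_list (map (\<lambda>x. fst (snd (snd x))) (fst (snd z))))"

type_synonym raw_bmst_edge = "nat \<times> nat \<times> (nat \<times> nat) \<times> (nat \<times> nat)"

definition enc_raw_bmst_edge :: "raw_bmst_edge \<Rightarrow> val" where
  "enc_raw_bmst_edge = enc_pair Num (enc_pair Num (enc_pair (enc_pair Num Num) (enc_pair Num Num)))"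

text \<open>
  Adding an integer to a reduced fraction gives a reduced fraction, so no gcd has to be computed.
\<close>

definition raw_leader :: "raw_svdst \<Rightarrow> raw_bmst_edge list" where
  "raw_leader z =
     map (\<lambda>x. (fst x, fst (snd x),
        (fst (snd (snd x)) + big z * snd (snd (snd x)), snd (snd (snd x))), (0, 1))) (fst (snd z)) @
     map (\<lambda>v. (hub z, v, (big z, 1), (0, 1))) (fst z)"

text \<open>All costs of the follower are 0, so placing links before star edges is a legal order. A
  nonempty \<open>S\<close> contributes one link less than it has elements and one star edge; an
  empty one contributes nothing.\<close>

definition raw_follower :: "raw_svdst \<Rightarrow> raw_bmst_edge list" where
  "raw_follower z =
     concat (map (\<lambda>S. map (\<lambda>x. (head0 S, x, (2 * big z, 1), (0, 1))) (tl S)) (snd (snd z))) @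
     map (\<lambda>S. (hub z, head0 S, (0, 1), (0, 1))) (filter (\<lambda>S. S \<noteq> []) (snd (snd z)))"

definition raw_gadget :: "raw_svdst \<Rightarrow> nat list \<times> raw_bmst_edge list \<times> raw_bmst_edge list" where
  "raw_gadget z = (hub z # fst z, raw_leader z, raw_follower z)"

section \<open>Polynomial running time for building the gadget\<close>

lemmas enc_raw_defs = enc_raw_svdst_def enc_raw_edge_def enc_raw_bmst_edge_def enc_sel_def

lemma ptime_hub: "ptime_fun e enc_raw_svdst f \<Longrightarrow> ptime_fun e Num (\<lambda>z. hub (f z))"
  unfolding enc_raw_defs hub_def by (assumption | rule ptime_intros)+

lemma ptime_big: "ptime_fun e enc_raw_svdst f \<Longrightarrow> ptime_fun e Num (\<lambda>z. big (f z))"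
  unfolding enc_raw_defs big_def by (assumption | rule ptime_intros)+

lemma ptime_raw_leader: "ptime_fun enc_raw_svdst (enc_list enc_raw_bmst_edge) raw_leader"
  unfolding raw_leader_def[abs_def] enc_raw_defs
  by (rule ptime_hub[unfolded enc_raw_defs] ptime_big[unfolded enc_raw_defs] ptime_intros)+

lemma ptime_raw_follower: "ptime_fun enc_raw_svdst (enc_list enc_raw_bmst_edge) raw_follower"
  unfolding raw_follower_def[abs_def] enc_raw_defs
  by (rule ptime_hub[unfolded enc_raw_defs] ptime_big[unfolded enc_raw_defs] ptime_intros)+

lemma ptime_raw_gadget:
  "ptime_fun enc_raw_svdst
     (enc_pair (enc_list Num) (enc_pair (enc_list enc_raw_bmst_edge) (enc_list enc_raw_bmst_edge)))
     raw_gadget"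
proof -
  have "ptime_fun enc_raw_svdst (enc_list Num) (\<lambda>z. hub z # fst z)"
    unfolding enc_raw_defs by (rule ptime_hub[unfolded enc_raw_defs] ptime_intros)+
  from ptime_pair[OF this ptime_pair[OF ptime_raw_leader ptime_raw_follower]]
  show ?thesis unfolding raw_gadget_def[abs_def] .
qed

text \<open>The edges of the graph carry the same numbers in both problems, and the enumeration ends
  with them; the spokes in \<open>X\<close> are thereby discarded.\<close>

definition selected :: "raw_svdst \<Rightarrow> nat list \<Rightarrow> (nat \<times> raw_edge) list" where
  "selected z X = filter (\<lambda>x. fst x \<in> set X) (List.enumerate 0 (fst (snd z)))"

text \<open>For an empty terminal set \<open>head0\<close> would return 0, which may be the name of
  a vertex; hence the separate case.\<close>

definition comp_list :: "raw_svdst \<Rightarrow> nat list \<Rightarrow> nat list \<Rightarrow> nat list" where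
  "comp_list z X S = (if S = [] then [] else reach_list (selected z X) (head0 S))"

text \<open>
  Components that meet are equal, so the test also rules out that two terminal sets share one.
\<close>

definition separated :: "raw_svdst \<Rightarrow> nat list \<Rightarrow> bool" where
  "separated z X \<longleftrightarrow> (\<forall>S\<in>set (snd (snd z)). \<forall>S'\<in>set (snd (snd z)). \<forall>t\<in>set S'.
     t \<in> set (comp_list z X S) \<longleftrightarrow> t \<in> set S)"

text \<open>Testing one end suffices, because a selected edge with one end in a component has the
  other end there as well.\<close>

definition tree_lists :: "raw_svdst \<Rightarrow> nat list \<Rightarrow> nat list list" where
  "tree_lists z X = map (\<lambda>S. map fst
     (filter (\<lambda>x. fst (snd x) \<in> set (comp_list z X S)) (selected z X))) (snd (snd z))"

definition decode :: "raw_svdst \<Rightarrow> nat list \<Rightarrow> nat list list option" where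
  "decode z X = (if separated z X then Some (tree_lists z X) else None)"

section \<open>Polynomial running time of decoding\<close>

lemma ptime_selected:
  assumes "ptime_fun e enc_raw_svdst f" "ptime_fun e (enc_list Num) X"
  shows "ptime_fun e (enc_list enc_sel) (\<lambda>z. selected (f z) (X z))"
proof -
  have "ptime_fun (enc_pair e enc_sel) (enc_list Num) (\<lambda>w. X (fst w))"
    by (rule ptime_comp[OF assms(2)]) (rule ptime_basic)+
  then show ?thesis
    using assms unfolding enc_raw_defs selected_def by - (assumption | rule ptime_intros)+
qed

lemma ptime_comp_list:
  assumes "ptime_fun e enc_raw_svdst f" "ptime_fun e (enc_list Num) X" "ptime_fun e (enc_list Num) S"
  shows "ptime_fun e (enc_list Num) (\<lambda>z. comp_list (f z) (X z) (S z))"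
  unfolding comp_list_def by (rule assms ptime_reach_list ptime_selected ptime_basic)+

definition enc_instance_choice :: "raw_svdst \<times> nat list \<Rightarrow> val" where
  "enc_instance_choice = enc_pair enc_raw_svdst (enc_list Num)"

lemma ptime_separated: "ptime_fun enc_instance_choice enc_bool (\<lambda>z. separated (fst z) (snd z))"
  unfolding separated_def enc_instance_choice_def enc_raw_defs
  by (rule ptime_comp_list[unfolded enc_raw_defs] ptime_intros)+

lemma ptime_tree_lists:
  "ptime_fun enc_instance_choice (enc_list (enc_list Num)) (\<lambda>z. tree_lists (fst z) (snd z))"
  unfolding tree_lists_def enc_instance_choice_def enc_raw_defs
  by (rule ptime_comp_list[unfolded enc_raw_defs] ptime_selected[unfolded enc_raw_defs] ptime_intros)+

lemma ptime_decode:
  "ptime_fun enc_instance_choice (enc_out (SVDST K)) (\<lambda>z. decode (fst z) (snd z))"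
proof -
  have "ptime_fun enc_instance_choice (enc_out (SVDST K)) (\<lambda>z. None)"
    by (rule ptime_prim[where f = "Const 0" and c = 1]) (auto simp: SVDST_def)
  moreover have "ptime_fun enc_instance_choice (enc_out (SVDST K)) (\<lambda>z. Some (tree_lists (fst z) (snd z)))"
    by (rule ptime_recode[OF ptime_pair[OF ptime_nat[where n = 1] ptime_tree_lists]]) (simp add: SVDST_def)
  ultimately show ?thesis
    unfolding decode_def by (rule ptime_if[OF ptime_separated, rotated])
qed

section \<open>From instances to gadgets\<close>

lemma fraction_of_nat: "fraction (of_nat n) = (n, 1)"
  by (simp add: fraction_def)

text \<open>Adding a multiple of the denominator to the numerator preserves their gcd. For negative
  \<open>q\<close>, the truncation by \<open>nat\<close> would spoil the equation.\<close>

lemma fraction_add_of_nat: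
  assumes "0 \<le> q"
  shows "fraction (q + of_nat n) = (fst (fraction q) + n * snd (fraction q), snd (fraction q))"
proof -
  obtain a b where ab: "quotient_of q = (a, b)" by (cases "quotient_of q")
  have b: "0 < b" "coprime a b" and q: "q = of_int a / of_int b"
    using quotient_of_denom_pos[OF ab] quotient_of_coprime[OF ab] quotient_of_div[OF ab] .
  have a: "0 \<le> a"
  proof (rule ccontr)
    assume "\<not> 0 \<le> a"
    then have "q < 0" unfolding q using b by (intro divide_neg_pos) auto
    then show False using assms by simp
  qed
  have "gcd b (int n * b + a) = gcd b a" by (rule gcd_add_mult)
  then have "coprime (a + int n * b) b"
    using b(2) by (simp add: coprime_iff_gcd_eq_1 gcd.commute[of b] add.commute)
  have "quotient_of (q + of_nat n) = Rat.normalize (a + int n * b, b)"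
    by (simp add: rat_plus_code ab)
  also have "\<dots> = (a + int n * b, b)"
    by (rule normalize_stable) fact+
  finally have "quotient_of (q + of_nat n) = (a + int n * b, b)" .
  moreover have "nat (a + int n * b) = nat a + n * nat b"
    using a b(1) by (simp add: nat_add_distrib nat_mult_distrib)
  ultimately show ?thesis by (simp add: fraction_def ab)
qed

lemma le_fst_fraction:
  assumes "0 \<le> q"
  shows "q \<le> of_nat (fst (fraction q))"
proof -
  obtain a b where ab: "quotient_of q = (a, b)" by (cases "quotient_of q")
  have b: "0 < b" and q: "q = of_int a / of_int b"
    using quotient_of_denom_pos[OF ab] quotient_of_div[OF ab] .
  have a: "0 \<le> a"
  proof (rule ccontr)
    assume "\<not> 0 \<le> a"
    then have "q < 0" unfolding q using b by (intro divide_neg_pos) auto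
    then show False using assms by simp
  qed
  have "of_int a \<le> of_int a * (of_int b :: rat)"
    using mult_left_mono[of 1 "of_int b" "of_int a :: rat"] a b by simp
  then have "q \<le> of_int a" unfolding q using b by (simp add: divide_le_eq)
  then show ?thesis using a by (simp add: fraction_def ab)
qed

definition star_terminals :: "nat list list \<Rightarrow> nat list list" where
  "star_terminals TS = filter (\<lambda>S. S \<noteq> []) TS"

text \<open>The gadget with rational costs, on which correctness is argued. The program computes
  \<open>raw_gadget\<close>; the two are linked by having the same encoding.\<close>

definition gadget_input :: "svdst_input \<Rightarrow> bmst_input" where
  "gadget_input I =
     (let h = hub (raw_svdst I); L = of_nat (big (raw_svdst I)) in
     \<lparr>bm_verts = h # sv_verts I,
      bm_leader = map (\<lambda>(u, v, l). (u, v, l + L, 0)) (sv_edges I) @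
        map (\<lambda>v. (h, v, L, 0)) (sv_verts I),
      bm_follower = concat (map (\<lambda>S. map (\<lambda>x. (head0 S, x, 2 * L, 0)) (tl S)) (sv_terminals I)) @
        map (\<lambda>S. (h, head0 S, 0, 0)) (star_terminals (sv_terminals I))\<rparr>)"

lemma enc_bmst_raw:
  "enc_bmst J = enc_pair (enc_list Num)
     (enc_pair (enc_list enc_raw_bmst_edge) (enc_list enc_raw_bmst_edge))
     (bm_verts J, map (\<lambda>(u, v, c, d). (u, v, fraction c, fraction d)) (bm_leader J),
      map (\<lambda>(u, v, c, d). (u, v, fraction c, fraction d)) (bm_follower J))"
proof -
  have "(\<lambda>x. enc_raw_bmst_edge (case x of (u, v, c, d) \<Rightarrow> (u, v, fraction c, fraction d))) =
      (\<lambda>(u, v, c, d). Node (Num u) (Node (Num v) (Node (enc_rat c) (enc_rat d))))"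
    by (auto simp: enc_raw_bmst_edge_def enc_rat_fraction fraction_def)
  then show ?thesis by (simp add: enc_bmst_def Let_def enc_list_map)
qed

lemma enc_gadget_input:
  assumes "\<And>u v l. (u, v, l) \<in> set (sv_edges I) \<Longrightarrow> 0 \<le> l"
  shows "enc_bmst (gadget_input I) = enc_pair (enc_list Num)
     (enc_pair (enc_list enc_raw_bmst_edge) (enc_list enc_raw_bmst_edge)) (raw_gadget (raw_svdst I))"
proof -
  let ?n = "big (raw_svdst I)"
  let ?f = "\<lambda>(u, v, c, d). (u, v, fraction c, fraction d)"
  have two: "fraction (2 * of_nat k) = (2 * k, 1)" for k
    using fraction_of_nat[of "2 * k"] by simp
  have zero: "fraction 0 = (0, 1)" using fraction_of_nat[of 0] by simp
  have "map ?f (bm_leader (gadget_input I)) = raw_leader (raw_svdst I)"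
  proof -
    have "map ?f (map (\<lambda>(u, v, l). (u, v, l + of_nat ?n, 0)) (sv_edges I)) =
        map (\<lambda>x. (fst x, fst (snd x),
          (fst (snd (snd x)) + ?n * snd (snd (snd x)), snd (snd (snd x))), (0, 1)))
        (map (\<lambda>(u, v, l). (u, v, fraction l)) (sv_edges I))"
      using assms by (auto simp: zero fraction_add_of_nat)
    then show ?thesis
      by (simp add: gadget_input_def raw_leader_def Let_def fraction_of_nat zero raw_svdst_def)
  qed
  moreover have "map ?f (bm_follower (gadget_input I)) = raw_follower (raw_svdst I)"
    by (simp add: gadget_input_def raw_follower_def Let_def two zero map_concat comp_def
        star_terminals_def raw_svdst_def)
  ultimately show ?thesis
    unfolding enc_bmst_raw
    by (simp add: raw_gadget_def gadget_input_def Let_def raw_svdst_def)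
qed

text \<open>The end functions of the two problems are only known to agree on the edges of the given
  graph. This and the next two lemmas transfer notions from one function to the other.\<close>

lemma reach_cong:
  assumes "\<And>e. e \<in> F \<Longrightarrow> en e = en' e"
  shows "reach en F = reach en' F"
proof -
  have "{(a, b). \<exists>e\<in>F. en e = {a, b}} = {(a, b). \<exists>e\<in>F. en' e = {a, b}}"
    using assms by auto
  then show ?thesis by (simp add: reach_def)
qed

lemma tree_verts_cong:
  assumes "\<And>e. e \<in> T \<Longrightarrow> en e = en' e"
  shows "tree_verts en S T = tree_verts en' S T"
  using assms by (simp add: tree_verts_def)

lemma spanning_tree_of_cong:
  assumes "\<And>e. e \<in> T \<Longrightarrow> en e = en' e"
  shows "spanning_tree_of en S T = spanning_tree_of en' S T"
proof -
  have "reach en (T - {e}) = reach en' (T - {e})" for e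
    by (rule reach_cong) (simp add: assms)
  then have "forest en T = forest en' T"
    using assms by (simp add: forest_def)
  then show ?thesis
    using reach_cong[of T en en', OF assms] tree_verts_cong[of T en en' S, OF assms]
    by (simp add: spanning_tree_of_def connected_graph_iff cycle_free_iff_forest)
qed

lemma sum_disjoint_subsets_le:
  fixes l :: "'e \<Rightarrow> real"
  assumes "finite A" "finite F" "\<And>S. S \<in> A \<Longrightarrow> T S \<subseteq> F" "\<And>e. e \<in> F \<Longrightarrow> 0 \<le> l e"
    "\<And>S S'. S \<in> A \<Longrightarrow> S' \<in> A \<Longrightarrow> S \<noteq> S' \<Longrightarrow> T S \<inter> T S' = {}"
  shows "(\<Sum>S\<in>A. sum l (T S)) \<le> sum l F"
proof -
  have "finite (T S)" if "S \<in> A" for S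
    using finite_subset[OF assms(3)[OF that] assms(2)] .
  then have "(\<Sum>S\<in>A. sum l (T S)) = sum l (\<Union>S\<in>A. T S)"
    by (intro sum.UNION_disjoint[symmetric]) (use assms in auto)
  also have "\<dots> \<le> sum l F"
    by (rule sum_mono2) (use assms in auto)
  finally show ?thesis .
qed

text \<open>Only elements that pass the filter must differ from later ones: empty terminal sets may
  occur repeatedly in an input.\<close>

lemma distinct_filter_nth:
  assumes "\<And>i j. i < j \<Longrightarrow> j < length xs \<Longrightarrow> b (xs ! i) \<Longrightarrow> xs ! i \<noteq> xs ! j"
  shows "distinct (filter b xs)"
  using assms
proof (induction xs)
  case (Cons x xs)
  have "distinct (filter b xs)"
    by (rule Cons.IH) (use Cons.prems[of "Suc i" "Suc j" for i j] in auto)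
  moreover have "x \<notin> set xs" if "b x"
  proof
    assume "x \<in> set xs"
    then obtain j where "j < length xs" "xs ! j = x" by (auto simp: in_set_conv_nth)
    then show False using Cons.prems[of 0 "Suc j"] that by simp
  qed
  ultimately show ?case by simp
qed simp

lemma head0_tl: "S \<noteq> [] \<Longrightarrow> S = head0 S # tl S"
  by (cases S) (simp_all add: head0_def)

locale svdst_reduction =
  fixes I :: svdst_input and K :: nat
  assumes inst: "I \<in> insts (SVDST K)"
begin

abbreviation V where "V \<equiv> sv_verts I"
abbreviation ES where "ES \<equiv> sv_edges I"
abbreviation TS where "TS \<equiv> sv_terminals I"
abbreviation G where "G \<equiv> svdst_of I"
abbreviation B where "B \<equiv> bmst_of (gadget_input I)"
abbreviation h where "h \<equiv> hub (raw_svdst I)"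
abbreviation big_cost where "big_cost \<equiv> big (raw_svdst I)"
abbreviation FL where "FL \<equiv> star_terminals TS"
abbreviation enB where "enB \<equiv> ends B"

section \<open>The numbered edges of the gadget\<close>

definition links :: "(nat \<times> nat \<times> rat \<times> rat) list" where
  "links = concat (map (\<lambda>S. map (\<lambda>x. (head0 S, x, 2 * of_nat big_cost, 0)) (tl S)) TS)"

definition spikes :: "(nat \<times> nat \<times> rat \<times> rat) list" where
  "spikes = map (\<lambda>S. (h, head0 S, 0, 0)) FL"

definition n where "n = length ES"
definition m where "m = n + length V"

text \<open>Numbers below \<open>n\<close> are edges of the graph, those from \<open>n\<close> to
  below \<open>m\<close> the leader's edges at the hub; then come the follower's links and star
  edges, the latter listed in \<open>spikes\<close>.\<close>

definition edge_list :: "(nat \<times> nat \<times> rat \<times> rat) list" where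
  "edge_list = map (\<lambda>(u, v, l). (u, v, l + of_nat big_cost, 0)) ES @
     map (\<lambda>v. (h, v, of_nat big_cost, 0)) V @ links @ spikes"

lemma length_edge_list: "length edge_list = m + length links + length spikes"
  by (simp add: edge_list_def n_def m_def)

lemma B_simps:
  "verts B = insert h (set V)" "edges B = {..<length edge_list}"
  "leader_edges B = {..<m}" "follower_edges B = {m..<length edge_list}"
  "follower_order B = [m..<length edge_list]"
  "enB e = (case edge_list ! e of (u, v, c, d) \<Rightarrow> {u, v})"
  "leader_cost B e = (case edge_list ! e of (u, v, c, d) \<Rightarrow> of_rat c)"
  "follower_cost B e = (case edge_list ! e of (u, v, c, d) \<Rightarrow> of_rat d)"
  by (simp_all add: bmst_of_def gadget_input_def Let_def edge_list_def links_def spikes_def n_def m_def)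

lemma G_simps:
  "verts G = set V" "edges G = {..<n}" "terminals G = map set TS"
  "ends G e = (case ES ! e of (u, v, l) \<Rightarrow> {u, v})"
  "len G e = (case ES ! e of (u, v, l) \<Rightarrow> of_rat l)"
  by (simp_all add: svdst_of_def n_def)

lemma I_facts:
  shows dist_V: "distinct V"
    and dist_TS: "\<And>S. S \<in> set TS \<Longrightarrow> distinct S"
    and ends_G: "\<And>e. e < n \<Longrightarrow> ends G e \<subseteq> set V \<and> card (ends G e) = 2"
    and len_nonneg: "\<And>e. e < n \<Longrightarrow> 0 \<le> len G e"
    and TS_V: "\<And>S. S \<in> set TS \<Longrightarrow> set S \<subseteq> set V"
    and TS_disj: "\<And>i j. i < j \<Longrightarrow> j < length TS \<Longrightarrow> set (TS ! i) \<inter> set (TS ! j) = {}"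
    and K: "(\<Sum>S\<leftarrow>map set TS. card S) = K"
proof -
  have *: "distinct V" "\<forall>S\<in>set TS. distinct S" "svdst_instance G" "num_terminals G = K"
    using inst by (simp_all add: SVDST_def)
  show "distinct V" "(\<Sum>S\<leftarrow>map set TS. card S) = K"
    using * by (simp_all add: num_terminals_def G_simps)
  show "distinct S" if "S \<in> set TS" for S using * that by blast
  show "ends G e \<subseteq> set V \<and> card (ends G e) = 2" if "e < n" for e
    using *(3) that unfolding svdst_instance_def multigraph_def G_simps(1,2) by blast
  show "0 \<le> len G e" if "e < n" for e
    using *(3) that unfolding svdst_instance_def G_simps(1,2) by blast
  show "set S \<subseteq> set V" if "S \<in> set TS" for S
    using *(3) that unfolding svdst_instance_def G_simps(1,3) by simp
  show "set (TS ! i) \<inter> set (TS ! j) = {}" if "i < j" "j < length TS" for i j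
    using *(3) that unfolding svdst_instance_def G_simps(3) by auto
qed

lemma TS_disj': "i < length TS \<Longrightarrow> j < length TS \<Longrightarrow> i \<noteq> j \<Longrightarrow> set (TS ! i) \<inter> set (TS ! j) = {}"
  using TS_disj[of i j] TS_disj[of j i] by (cases "i < j") auto

lemma nonneg_weight: "(u, v, l) \<in> set ES \<Longrightarrow> 0 \<le> l"
proof -
  assume "(u, v, l) \<in> set ES"
  then obtain e where "e < n" "ES ! e = (u, v, l)" by (auto simp: in_set_conv_nth n_def)
  then show "0 \<le> l" using len_nonneg[of e] by (simp add: G_simps)
qed

lemma hub_fresh: "h \<notin> set V"
proof
  assume "h \<in> set V"
  then have "h \<le> sum_list V" by (intro member_le_sum_list) auto
  then show False by (simp add: hub_def raw_svdst_def)
qed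

lemma edge_list_nth:
  "e < n \<Longrightarrow> edge_list ! e = (case ES ! e of (u, v, l) \<Rightarrow> (u, v, l + of_nat big_cost, 0))"
  "j < length V \<Longrightarrow> edge_list ! (n + j) = (h, V ! j, of_nat big_cost, 0)"
  "j < length links \<Longrightarrow> edge_list ! (m + j) = links ! j"
  "j < length spikes \<Longrightarrow> edge_list ! (m + length links + j) = (h, head0 (FL ! j), 0, 0)"
  by (simp_all add: edge_list_def n_def m_def nth_append spikes_def)

lemma enB_G: "e < n \<Longrightarrow> enB e = ends G e"
  by (simp add: B_simps G_simps edge_list_nth split: prod.split)

section \<open>Terminal sets, their positions and their roots\<close>

lemma FL_iff: "S \<in> set FL \<longleftrightarrow> S \<in> set TS \<and> S \<noteq> []"
  by (auto simp: star_terminals_def)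

definition NE :: "nat set" where
  "NE = {i. i < length TS \<and> TS ! i \<noteq> []}"

definition P :: "nat set set" where
  "P = set ` set FL"

text \<open>Disjoint nonempty sets are different, so they determine their positions. Empty sets can
  coincide, which is why they are left out.\<close>

lemma bij_NE: "bij_betw (\<lambda>i. set (TS ! i)) NE P"
proof (rule bij_betw_imageI)
  show "inj_on (\<lambda>i. set (TS ! i)) NE"
  proof (rule inj_onI, rule ccontr)
    fix i j
    assume "i \<in> NE" "j \<in> NE" "set (TS ! i) = set (TS ! j)" "i \<noteq> j"
    then show False using TS_disj'[of i j] by (simp add: NE_def)
  qed
  show "(\<lambda>i. set (TS ! i)) ` NE = P"
  proof (intro equalityI subsetI)
    fix A
    assume "A \<in> (\<lambda>i. set (TS ! i)) ` NE"
    then show "A \<in> P" by (auto simp: NE_def P_def FL_iff)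
  next
    fix A
    assume "A \<in> P"
    then obtain S where S: "S \<in> set TS" "S \<noteq> []" "A = set S" by (auto simp: P_def FL_iff)
    then obtain i where "i < length TS" "TS ! i = S" by (auto simp: in_set_conv_nth)
    then show "A \<in> (\<lambda>i. set (TS ! i)) ` NE" using S by (auto simp: NE_def)
  qed
qed

text \<open>A set in \<open>P\<close> comes from only one list; otherwise its root, the first
  element of the list, would be ambiguous.\<close>

lemma set_inj_FL: "inj_on set (set FL)"
proof (rule inj_onI)
  fix S S'
  assume S: "S \<in> set FL" "S' \<in> set FL" "set S = set S'"
  then have "S \<in> set TS" "S' \<in> set TS" and ne: "S \<noteq> []" "S' \<noteq> []" by (simp_all add: FL_iff)
  then obtain i j where "i < length TS" "TS ! i = S" "j < length TS" "TS ! j = S'"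
    by (metis in_set_conv_nth)
  with ne have ij: "i \<in> NE" "TS ! i = S" "j \<in> NE" "TS ! j = S'" by (simp_all add: NE_def)
  then have "i = j" using bij_NE S(3) by (auto simp: bij_betw_def inj_on_def)
  then show "S = S'" using ij by simp
qed

lemma distinct_FL: "distinct FL"
  unfolding star_terminals_def
proof (rule distinct_filter_nth)
  fix i j
  assume "i < j" "j < length TS" "TS ! i \<noteq> []"
  then show "TS ! i \<noteq> TS ! j" using TS_disj[of i j] by auto
qed

definition idx :: "nat set \<Rightarrow> nat" where
  "idx = inv_into {..<length FL} (\<lambda>j. set (FL ! j))"

lemma bij_FL: "bij_betw (\<lambda>j. set (FL ! j)) {..<length FL} P"
proof -
  have "bij_betw (set \<circ> (!) FL) {..<length FL} P"
    by (rule bij_betw_trans[OF bij_betw_nth[OF distinct_FL refl refl]])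
      (simp add: bij_betw_def set_inj_FL P_def)
  then show ?thesis by (simp add: comp_def)
qed

lemma idx_props:
  assumes "A \<in> P"
  shows "idx A < length FL" "set (FL ! idx A) = A"
proof -
  have A: "A \<in> (\<lambda>j. set (FL ! j)) ` {..<length FL}" using assms bij_FL by (simp add: bij_betw_def)
  show "idx A < length FL" using inv_into_into[OF A] by (simp add: idx_def)
  show "set (FL ! idx A) = A" unfolding idx_def using A by (rule f_inv_into_f)
qed

lemma idx_nth: "j < length FL \<Longrightarrow> idx (set (FL ! j)) = j"
  unfolding idx_def using bij_FL by (intro inv_into_f_f) (auto simp: bij_betw_def)

definition root :: "nat set \<Rightarrow> nat" where
  "root A = head0 (FL ! idx A)"

definition spoke :: "nat \<Rightarrow> nat" where
  "spoke v = n + inv_into {..<length V} ((!) V) v"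

definition star :: "nat set \<Rightarrow> nat" where
  "star A = m + length links + idx A"

lemma root_set: "S \<in> set FL \<Longrightarrow> root (set S) = head0 S"
  unfolding root_def by (metis idx_nth in_set_conv_nth)

lemma spoke_obtain:
  assumes "v \<in> set V"
  obtains j where "j < length V" "V ! j = v" "spoke v = n + j"
proof -
  have v: "v \<in> (!) V ` {..<length V}"
    using assms by (auto simp: in_set_conv_nth)
  show thesis
    by (rule that[of "inv_into {..<length V} ((!) V) v"])
      (use inv_into_into[OF v] f_inv_into_f[OF v] in \<open>simp_all add: spoke_def\<close>)
qed

lemma spoke_image: "spoke ` set V = {n..<m}"
proof (intro equalityI subsetI)
  fix e
  assume "e \<in> spoke ` set V"
  then show "e \<in> {n..<m}" by (auto simp: m_def elim: spoke_obtain)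
next
  fix e
  assume "e \<in> {n..<m}"
  then have "e - n < length V" "e = n + (e - n)" by (auto simp: m_def)
  then have "spoke (V ! (e - n)) = e"
    using inv_into_f_f[of "(!) V" "{..<length V}" "e - n"] dist_V
    by (simp add: spoke_def inj_on_nth)
  then show "e \<in> spoke ` set V" using \<open>e - n < length V\<close> by (metis imageI nth_mem)
qed

lemma star_image: "star ` P = {m + length links..<length edge_list}"
proof -
  have "idx ` P = {..<length FL}"
    using bij_betw_inv_into[OF bij_FL] by (simp add: idx_def bij_betw_def)
  then have "star ` P = (\<lambda>j. m + length links + j) ` {..<length FL}"
    unfolding star_def by (metis image_image)
  then show ?thesis
    by (simp add: length_edge_list spikes_def lessThan_atLeast0 image_add_atLeastLessThan
        add.commute)
qed

lemma links_cases:
  assumes "e \<in> {m..<m + length links}"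
  obtains S x where "S \<in> set FL" "x \<in> set (tl S)"
    "edge_list ! e = (head0 S, x, 2 * of_nat big_cost, 0)"
proof -
  have e: "e - m < length links" "e = m + (e - m)" using assms by auto
  then have "edge_list ! e = links ! (e - m)" using edge_list_nth(3) by metis
  moreover have "links ! (e - m) \<in> set links" using e by simp
  then obtain S x where S: "S \<in> set TS" "x \<in> set (tl S)"
    "links ! (e - m) = (head0 S, x, 2 * of_nat big_cost, 0)"
    unfolding links_def by auto
  moreover have "S \<in> set FL" using S by (auto simp: FL_iff)
  ultimately show thesis using that by metis
qed

lemma links_exist:
  assumes "S \<in> set FL" "x \<in> set (tl S)"
  obtains e where "e \<in> {m..<m + length links}"
    "edge_list ! e = (head0 S, x, 2 * of_nat big_cost, 0)"
proof -
  have "(head0 S, x, 2 * of_nat big_cost, 0) \<in> set links"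
    using assms unfolding links_def by (auto simp: FL_iff)
  then obtain j where "j < length links" "links ! j = (head0 S, x, 2 * of_nat big_cost, 0)"
    by (auto simp: in_set_conv_nth)
  then show thesis using that[of "m + j"] edge_list_nth(3)[of j] by simp
qed

lemma FL_facts:
  assumes "S \<in> set FL"
  shows "head0 S \<in> set S" "head0 S \<notin> set (tl S)" "set (tl S) \<subseteq> set S" "set S \<subseteq> set V"
    "set S = insert (head0 S) (set (tl S))"
proof -
  have S: "S \<in> set TS" "S = head0 S # tl S" using assms head0_tl by (auto simp: FL_iff)
  show "set S = insert (head0 S) (set (tl S))" using S(2) by (metis list.simps(15))
  then show "head0 S \<in> set S" "set (tl S) \<subseteq> set S" by auto
  show "head0 S \<notin> set (tl S)" using dist_TS[OF S(1)] S(2) by (metis distinct.simps(2))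
  show "set S \<subseteq> set V" by (rule TS_V[OF S(1)])
qed

lemma star_edge:
  assumes "A \<in> P"
  shows "edge_list ! star A = (h, root A, 0, 0)"
  using edge_list_nth(4)[of "idx A"] idx_props[OF assms] by (simp add: star_def root_def spikes_def)

lemma spoke_edge:
  assumes "v \<in> set V"
  shows "edge_list ! spoke v = (h, v, of_nat big_cost, 0)"
  by (rule spoke_obtain[OF assms]) (metis edge_list_nth(2))

lemma P_facts:
  assumes "A \<in> P"
  shows "A \<subseteq> set V" "root A \<in> A"
proof -
  obtain S where S: "S \<in> set FL" "A = set S" using assms by (auto simp: P_def)
  then show "A \<subseteq> set V" "root A \<in> A" using FL_facts[OF S(1)] root_set[OF S(1)] by auto
qed

lemma ends_G_obtain:
  assumes "e < n"
  obtains a b where "a \<in> set V" "b \<in> set V" "a \<noteq> b" "enB e = {a, b}"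
proof -
  obtain a b where "ends G e = {a, b}" "a \<noteq> b" using ends_G[OF assms] by (auto simp: card_2_iff)
  then show thesis using that ends_G[OF assms] enB_G[OF assms] by auto
qed

lemma sum_len_less: "sum (len G) {..<n} < real big_cost"
proof -
  let ?num = "\<lambda>x :: nat \<times> nat \<times> rat. fst (fraction (snd (snd x)))"
  have "len G e \<le> real (?num (ES ! e))" if "e < n" for e
  proof -
    obtain u v q where q: "ES ! e = (u, v, q)" by (cases "ES ! e")
    then have "(u, v, q) \<in> set ES" using that by (metis n_def nth_mem)
    from le_fst_fraction[OF nonneg_weight[OF this]]
    have "(of_rat q :: real) \<le> of_rat (of_nat (fst (fraction q)))" by (simp only: of_rat_less_eq)
    then show ?thesis by (simp add: G_simps q)
  qed
  then have "sum (len G) {..<n} \<le> (\<Sum>e<n. real (?num (ES ! e)))" by (intro sum_mono) simp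
  also have "\<dots> = real (\<Sum>e<n. ?num (ES ! e))" by simp
  also have "(\<Sum>e<n. ?num (ES ! e)) = sum_list (map ?num ES)"
    by (simp add: sum_list_sum_nth n_def lessThan_atLeast0)
  also have "map ?num ES = map (\<lambda>x. fst (snd (snd x))) (fst (snd (raw_svdst I)))"
    by (auto simp: raw_svdst_def)
  finally show ?thesis by (simp add: big_def)
qed

section \<open>The numbered graph as an instance of the gadget\<close>

lemma enB_nth:
  "edge_list ! e = (a, b, c, d) \<Longrightarrow> enB e = {a, b}"
  "edge_list ! e = (a, b, c, d) \<Longrightarrow> leader_cost B e = of_rat c"
  "edge_list ! e = (a, b, c, d) \<Longrightarrow> follower_cost B e = of_rat d"
  by (simp_all add: B_simps)

lemma edge_cases:
  assumes "e < length edge_list"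
  obtains "e < n" | v where "v \<in> set V" "e = spoke v" | "e \<in> {m..<m + length links}"
    | A where "A \<in> P" "e = star A"
proof -
  consider "e < n" | "e \<in> {n..<m}" | "e \<in> {m..<m + length links}"
    | "e \<in> {m + length links..<length edge_list}"
    using assms by fastforce
  then show thesis
  proof cases
    case 2
    then show thesis using that(2) spoke_image by blast
  next
    case 4
    then show thesis using that(4) star_image by blast
  qed (use that in blast)+
qed

lemma gadget_instance:
  "gadget (set V) h {..<n} enB P root spoke [m..<m + length links] star
    [m + length links..<length edge_list] (len G) (leader_cost B) (real big_cost)"
proof
  show "finite P" by (simp add: P_def)
  show "\<exists>a\<in>set V. \<exists>b\<in>set V. enB e = {a, b}" if "e \<in> {..<n}" for e
  proof -
    have "e < n" using that by simp
    then obtain a b where "a \<in> set V" "b \<in> set V" "enB e = {a, b}" by (rule ends_G_obtain)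
    then show ?thesis by blast
  qed
  show "A \<subseteq> set V" "root A \<in> A" if "A \<in> P" for A using P_facts[OF that] by auto
  show "A \<inter> A' = {}" if A: "A \<in> P" "A' \<in> P" "A \<noteq> A'" for A A'
  proof -
    have "A \<in> (\<lambda>i. set (TS ! i)) ` NE" "A' \<in> (\<lambda>i. set (TS ! i)) ` NE"
      using A(1,2) bij_betw_imp_surj_on[OF bij_NE] by simp_all
    then obtain i j where "i \<in> NE" "A = set (TS ! i)" "j \<in> NE" "A' = set (TS ! j)" by blast
    then show ?thesis using TS_disj'[of i j] A(3) by (auto simp: NE_def)
  qed
  show "enB (spoke v) = {h, v}" "leader_cost B (spoke v) = real big_cost" if "v \<in> set V" for v
    using enB_nth(1,2)[OF spoke_edge[OF that]] by simp_all
  show "spoke ` set V \<inter> {..<n} = {}" unfolding spoke_image by auto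
  show "\<exists>A\<in>P. \<exists>x\<in>A. enB e = {root A, x}" if e: "e \<in> set [m..<m + length links]" for e
  proof -
    have "e \<in> {m..<m + length links}" using e by simp
    then obtain S x where S: "S \<in> set FL" "x \<in> set (tl S)"
      "edge_list ! e = (head0 S, x, 2 * of_nat big_cost, 0)" by (rule links_cases)
    then have "set S \<in> P" "x \<in> set S" "enB e = {root (set S), x}"
      using FL_facts(3)[OF S(1)] root_set[OF S(1)] enB_nth(1)[OF S(3)] by (auto simp: P_def)
    then show ?thesis by blast
  qed
  show "leader_cost B e = 2 * real big_cost" if e: "e \<in> set [m..<m + length links]" for e
  proof -
    have "e \<in> {m..<m + length links}" using e by simp
    then obtain S x where "edge_list ! e = (head0 S, x, 2 * of_nat big_cost, 0)"
      by (rule links_cases)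
    from enB_nth(2)[OF this] show ?thesis by (simp add: of_rat_mult)
  qed
  show "\<exists>e\<in>set [m..<m + length links]. enB e = {root A, x}" if A: "A \<in> P" "x \<in> A" "x \<noteq> root A" for A x
  proof -
    obtain S where S: "S \<in> set FL" "A = set S" using A(1) by (auto simp: P_def)
    then have "x \<in> set (tl S)" using A(2,3) FL_facts(5)[OF S(1)] root_set[OF S(1)] by auto
    then obtain e where e: "e \<in> {m..<m + length links}"
      "edge_list ! e = (head0 S, x, 2 * of_nat big_cost, 0)"
      using links_exist[OF S(1)] by blast
    then show ?thesis using enB_nth(1)[OF e(2)] root_set[OF S(1)] S(2) by auto
  qed
  show "enB (star A) = {h, root A}" if "A \<in> P" for A
    by (rule enB_nth(1)[OF star_edge[OF that]])
  show "set [m + length links..<length edge_list] = star ` P" by (simp add: star_image)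
  show "leader_cost B e = 0" if e: "e \<in> set [m + length links..<length edge_list]" for e
  proof -
    have "e \<in> star ` P" using e by (simp add: star_image)
    then obtain A where "A \<in> P" "e = star A" by blast
    then show ?thesis using enB_nth(2)[OF star_edge] by simp
  qed
  show "leader_cost B e = len G e + real big_cost" if "e \<in> {..<n}" for e
    using that edge_list_nth(1)[of e]
    by (cases "ES ! e") (simp add: B_simps G_simps of_rat_add)
  show "set [m..<m + length links] \<inter> ({..<n} \<union> spoke ` set V) = {}"
    "set [m + length links..<length edge_list] \<inter>
      ({..<n} \<union> spoke ` set V \<union> set [m..<m + length links]) = {}"
    unfolding spoke_image by (auto simp: m_def)
qed (use hub_fresh len_nonneg sum_len_less in auto)

sublocale gadget "set V" h "{..<n}" enB P root spoke "[m..<m + length links]" star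
  "[m + length links..<length edge_list]" "len G" "leader_cost B" "real big_cost"
  by (rule gadget_instance)

section \<open>Identification with the bilevel problem\<close>

lemma leader_set: "{..<n} \<union> spoke ` set V = {..<m}"
  unfolding spoke_image by (auto simp: m_def)

lemma follower_set:
  "set [m..<m + length links] \<union> set [m + length links..<length edge_list] = {m..<length edge_list}"
  by (auto simp: length_edge_list)

lemma follower_upt:
  "[m..<m + length links] @ [m + length links..<length edge_list] = [m..<length edge_list]"
  unfolding length_edge_list by (rule upt_add_eq_append[symmetric]) simp

lemma bmst_feasible_iff: "bmst_feasible B X \<longleftrightarrow> feasible X"
  unfolding bmst_feasible_def feasible_def B_simps(1,3,4) leader_set follower_set ..

lemma bmst_cost_eq: "bmst_cost B X = cost X"
  unfolding bmst_cost_def cost_def response_def resp_def B_simps(5) follower_upt ..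

lemma follower_card: "length links + length spikes = K"
proof -
  have "length (concat (map (\<lambda>S. map (\<lambda>x. (head0 S, x, 2 * (of_nat big_cost :: rat), 0 :: rat)) (tl S)) xs)) +
      length (filter (\<lambda>S. S \<noteq> []) xs) = sum_list (map length xs)" for xs
  proof (induction xs)
    case (Cons S xs)
    then show ?case by (cases S) simp_all
  qed simp
  from this[of TS] have "length links + length spikes = sum_list (map length TS)"
    by (simp add: links_def spikes_def star_terminals_def)
  also have "map length TS = map card (map set TS)"
    using dist_TS by (auto simp: distinct_card)
  finally show ?thesis using K by simp
qed

lemma gadget_in_insts: "gadget_input I \<in> insts (BMST K)"
proof -
  have ends: "enB e \<subseteq> verts B \<and> card (enB e) = 2" if "e < length edge_list" for e
    using that
  proof (cases rule: edge_cases)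
    case 1
    then show ?thesis by (rule ends_G_obtain) (simp add: B_simps(1))
  next
    case (2 v)
    then show ?thesis using spoke(1)[of v] hub_fresh by (auto simp: B_simps(1) card_insert_if)
  next
    case 3
    then obtain S x where S: "S \<in> set FL" "x \<in> set (tl S)"
      "edge_list ! e = (head0 S, x, 2 * of_nat big_cost, 0)" by (rule links_cases)
    then have "head0 S \<noteq> x" using FL_facts(2)[OF S(1)] by auto
    then show ?thesis
      using enB_nth(1)[OF S(3)] FL_facts[OF S(1)] S(2) by (auto simp: B_simps(1))
  next
    case (4 A)
    then have "root A \<noteq> h" "root A \<in> set V" using root_V[of A] hub_fresh by auto
    then show ?thesis using 4 star(1)[of A] by (auto simp: B_simps(1))
  qed
  have costs: "0 \<le> leader_cost B e \<and> follower_cost B e = 0" if "e < length edge_list" for e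
    using that
  proof (cases rule: edge_cases)
    case 1
    then show ?thesis
      using c(1)[of e] len_nonneg[of e] edge_list_nth(1)[of e]
      by (cases "ES ! e") (simp add: B_simps(8))
  next
    case (2 v)
    then show ?thesis using enB_nth(2,3)[OF spoke_edge[of v]] by simp
  next
    case 3
    then obtain S x where "edge_list ! e = (head0 S, x, 2 * of_nat big_cost, 0)"
      by (rule links_cases)
    from enB_nth(2,3)[OF this] show ?thesis by simp
  next
    case (4 A)
    then show ?thesis using enB_nth(2,3)[OF star_edge[of A]] by simp
  qed
  \<comment> \<open>Every vertex has a spoke, so any two vertices are connected through the
    hub.\<close>
  have hub_reach: "(h, v) \<in> reach enB {..<length edge_list}" if "v \<in> insert h (set V)" for v
  proof (cases "v = h")
    case False
    then have v: "v \<in> set V" using that by simp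
    then have "spoke v \<in> {n..<m}" using spoke_image by blast
    then have "spoke v \<in> {..<length edge_list}" by (simp add: length_edge_list)
    then show ?thesis using spoke(1)[OF v] by (rule reach_edge)
  qed simp
  have "connected_graph enB (verts B) (edges B)"
    unfolding connected_graph_iff B_simps(1,2)
    using reach_trans[OF reach_sym[OF hub_reach] hub_reach] by blast
  moreover have "multigraph B"
    unfolding multigraph_def B_simps(2) using ends by (simp add: B_simps(1))
  moreover have "sorted (map (follower_cost B) (follower_order B))"
  proof -
    have "map (follower_cost B) (follower_order B) =
        replicate (length (follower_order B)) 0"
      unfolding B_simps(5) by (rule replicate_eqI) (use costs in auto)
    then show ?thesis by (simp add: sorted_replicate)
  qed
  moreover have "m \<le> length edge_list" by (simp add: length_edge_list)
  ultimately have "bmst_instance B"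
    unfolding bmst_instance_def B_simps(2-5) using costs by auto
  moreover have "distinct (bm_verts (gadget_input I))"
    using hub_fresh dist_V by (simp add: gadget_input_def Let_def)
  moreover have "card (follower_edges B) = K"
    unfolding B_simps(4) using follower_card by (simp add: length_edge_list)
  ultimately show ?thesis by (simp add: BMST_def)
qed

section \<open>Correctness of the computed components and trees\<close>

lemma selected_iff:
  "x \<in> set (selected (raw_svdst I) X) \<longleftrightarrow>
    fst x \<in> set X \<inter> {..<n} \<and> (case ES ! fst x of (u, v, l) \<Rightarrow> snd x = (u, v, fraction l))"
proof -
  have "x \<in> set (selected (raw_svdst I) X) \<longleftrightarrow> fst x \<in> set X \<inter> {..<n} \<and>
      map (\<lambda>(u, v, l). (u, v, fraction l)) ES ! fst x = snd x"
    by (auto simp: selected_def in_set_enumerate_eq raw_svdst_def n_def)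
  then show ?thesis by (auto simp: n_def split: prod.splits)
qed

lemma selected_ends:
  assumes "x \<in> set (selected (raw_svdst I) X)"
  shows "enB (fst x) = {fst (snd x), fst (snd (snd x))}"
proof -
  obtain u v l where e: "ES ! fst x = (u, v, l)" by (cases "ES ! fst x")
  with assms have "snd x = (u, v, fraction l)" "fst x < n" by (simp_all add: selected_iff)
  then show ?thesis using e enB_G[of "fst x"] by (simp add: G_simps)
qed

lemma selected_exists:
  assumes "e \<in> set X \<inter> {..<n}"
  obtains x where "x \<in> set (selected (raw_svdst I) X)" "fst x = e"
proof -
  obtain u v l where "ES ! e = (u, v, l)" by (cases "ES ! e")
  then have "(e, u, v, fraction l) \<in> set (selected (raw_svdst I) X)"
    using assms by (simp add: selected_iff)
  then show thesis using that by simp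
qed

lemma set_comp_list:
  assumes "S \<noteq> []"
  shows "set (comp_list (raw_svdst I) X S) = comp_of enB (set X \<inter> {..<n}) (head0 S)"
proof -
  have "joins (selected (raw_svdst I) X) = {(a, b). \<exists>e\<in>set X \<inter> {..<n}. enB e = {a, b}}"
  proof (intro equalityI subsetI; clarify)
    fix a b
    assume "(a, b) \<in> joins (selected (raw_svdst I) X)"
    then obtain x where x: "x \<in> set (selected (raw_svdst I) X)"
      "{fst (snd x), fst (snd (snd x))} = {a, b}"
      by (auto simp: joins_def)
    then have "fst x \<in> set X \<inter> {..<n}" "enB (fst x) = {a, b}"
      using selected_ends[OF x(1)] selected_iff[of x X] by simp_all
    then show "\<exists>e\<in>set X \<inter> {..<n}. enB e = {a, b}" by blast
  next
    fix a b e
    assume e: "e \<in> set X" "e < n" "enB e = {a, b}"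
    then have "e \<in> set X \<inter> {..<n}" by simp
    then obtain x where x: "x \<in> set (selected (raw_svdst I) X)" "fst x = e"
      by (rule selected_exists)
    then have "{fst (snd x), fst (snd (snd x))} = {a, b}" using selected_ends[OF x(1)] e(3) by simp
    then show "(a, b) \<in> joins (selected (raw_svdst I) X)" using x(1) by (auto simp: joins_def)
  qed
  then show ?thesis
    using assms by (simp add: comp_list_def set_reach_list comp_of_def reach_def)
qed

lemma length_tree_lists: "length (tree_lists (raw_svdst I) X) = length TS"
  by (simp add: tree_lists_def raw_svdst_def)

lemma distinct_tree_lists: "T \<in> set (tree_lists (raw_svdst I) X) \<Longrightarrow> distinct T"
  by (auto simp: tree_lists_def selected_def intro!: distinct_map_filter)

lemma tree_lists_nth:
  assumes "i < length TS"
  shows "set (tree_lists (raw_svdst I) X ! i) =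
    (if TS ! i = [] then {} else comp_edges enB (set X \<inter> {..<n}) (head0 (TS ! i)))"
proof -
  let ?C = "set (comp_list (raw_svdst I) X (TS ! i))"
  have nth: "set (tree_lists (raw_svdst I) X ! i) =
      fst ` {x \<in> set (selected (raw_svdst I) X). fst (snd x) \<in> ?C}"
    using assms by (simp add: tree_lists_def raw_svdst_def)
  show ?thesis
  proof (cases "TS ! i = []")
    case True
    then show ?thesis unfolding nth by (simp add: comp_list_def)
  next
    case False
    note C = set_comp_list[OF False, of X]
    have "fst ` {x \<in> set (selected (raw_svdst I) X). fst (snd x) \<in> ?C} =
        comp_edges enB (set X \<inter> {..<n}) (head0 (TS ! i))"
    proof (intro equalityI subsetI)
      fix e
      assume "e \<in> fst ` {x \<in> set (selected (raw_svdst I) X). fst (snd x) \<in> ?C}"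
      then obtain x where x: "x \<in> set (selected (raw_svdst I) X)" "fst (snd x) \<in> ?C" "e = fst x"
        by blast
      have e: "e \<in> set X \<inter> {..<n}" "enB e = {fst (snd x), fst (snd (snd x))}"
        using x selected_ends[OF x(1)] selected_iff[of x X] by simp_all
      have r: "(head0 (TS ! i), fst (snd x)) \<in> reach enB (set X \<inter> {..<n})"
        using x(2) unfolding C by (simp add: comp_of_def)
      from reach_trans[OF r reach_edge[OF e(1), of enB, OF e(2)]] r
      show "e \<in> comp_edges enB (set X \<inter> {..<n}) (head0 (TS ! i))"
        using e by (simp add: comp_edges_def comp_of_def)
    next
      fix e
      assume e: "e \<in> comp_edges enB (set X \<inter> {..<n}) (head0 (TS ! i))"
      then have "e \<in> set X \<inter> {..<n}" by (simp add: comp_edges_def)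
      then obtain x where x: "x \<in> set (selected (raw_svdst I) X)" "fst x = e"
        by (rule selected_exists)
      then have "fst (snd x) \<in> enB e" using selected_ends[OF x(1)] by simp
      then have "fst (snd x) \<in> ?C" using e unfolding C by (auto simp: comp_edges_def)
      then show "e \<in> fst ` {x \<in> set (selected (raw_svdst I) X). fst (snd x) \<in> ?C}"
        using x by blast
    qed
    then show ?thesis unfolding nth using False by simp
  qed
qed

lemma separated_iff:
  "separated (raw_svdst I) X \<longleftrightarrow> (\<forall>S\<in>set FL. \<forall>S'\<in>set FL. \<forall>t\<in>set S'.
     t \<in> comp_of enB (set X \<inter> {..<n}) (head0 S) \<longleftrightarrow> t \<in> set S)" (is "?L \<longleftrightarrow> ?R")
proof -
  have TS: "snd (snd (raw_svdst I)) = TS" by (simp add: raw_svdst_def)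
  show ?thesis
  proof
    assume L: ?L
    show ?R
    proof (intro ballI)
      fix S S' t
      assume "S \<in> set FL" "S' \<in> set FL" "t \<in> set S'"
      then show "t \<in> comp_of enB (set X \<inter> {..<n}) (head0 S) \<longleftrightarrow> t \<in> set S"
        using L set_comp_list[of S X] unfolding separated_def TS FL_iff by blast
    qed
  next
    assume R: ?R
    show ?L
      unfolding separated_def TS
    proof (intro ballI)
      fix S S' t
      assume S: "S \<in> set TS" "S' \<in> set TS" "t \<in> set S'"
      show "t \<in> set (comp_list (raw_svdst I) X S) \<longleftrightarrow> t \<in> set S"
      proof (cases "S = []")
        case True
        then show ?thesis by (simp add: comp_list_def)
      next
        case False
        moreover have "S' \<noteq> []" using S(3) by auto
        ultimately show ?thesis using R S set_comp_list[of S X] by (simp add: FL_iff)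
      qed
    qed
  qed
qed

lemma NE_FL: "i \<in> NE \<Longrightarrow> TS ! i \<in> set FL"
  by (simp add: NE_def FL_iff)

lemma separated_disjoint:
  assumes sep: "separated (raw_svdst I) X" and ij: "i \<in> NE" "j \<in> NE" "i \<noteq> j"
  shows "comp_of enB (set X \<inter> {..<n}) (head0 (TS ! i)) \<inter>
    comp_of enB (set X \<inter> {..<n}) (head0 (TS ! j)) = {}"
proof (rule ccontr)
  let ?F = "set X \<inter> {..<n}"
  assume "\<not> ?thesis"
  then obtain v where v: "(head0 (TS ! i), v) \<in> reach enB ?F" "(head0 (TS ! j), v) \<in> reach enB ?F"
    by (auto simp: comp_of_def)
  have hj: "head0 (TS ! j) \<in> set (TS ! j)" by (rule FL_facts(1)[OF NE_FL[OF ij(2)]])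
  from reach_trans[OF v(1) reach_sym[OF v(2)]]
  have "head0 (TS ! j) \<in> comp_of enB ?F (head0 (TS ! i))" by (simp add: comp_of_def)
  then have "head0 (TS ! j) \<in> set (TS ! i)"
    using sep[unfolded separated_iff] NE_FL[OF ij(1)] NE_FL[OF ij(2)] hj by blast
  then show False using hj TS_disj'[of i j] ij by (auto simp: NE_def)
qed

section \<open>Comparing the leader's choice with Steiner trees\<close>

lemma svdst_cost_eq:
  assumes "length Ts = length TS"
  shows "svdst_cost G Ts = (\<Sum>i<length TS. sum (len G) (Ts ! i))"
  using assms by (simp add: svdst_cost_def sum_list_sum_nth lessThan_atLeast0)

text \<open>Each component of the forest is a tree, and separation keeps the components of different
  terminal sets apart. The cost is only bounded from above, since chosen edges outside these
  components are dropped.\<close>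

lemma decoded_feasible:
  assumes forest: "forest enB (set X)" and sep: "separated (raw_svdst I) X"
  shows "svdst_feasible G (map set (tree_lists (raw_svdst I) X))"
    and "svdst_cost G (map set (tree_lists (raw_svdst I) X)) \<le> sum (len G) (set X \<inter> {..<n})"
proof -
  let ?F = "set X \<inter> {..<n}"
  define T where "T i = set (tree_lists (raw_svdst I) X ! i)" for i
  have fF: "forest enB ?F" by (rule forest_mono[OF forest]) auto
  have T_NE: "T i = comp_edges enB ?F (head0 (TS ! i))" if "i \<in> NE" for i
    using that tree_lists_nth[of i X] by (simp add: T_def NE_def)
  have T_E: "T i = {}" if "i < length TS" "i \<notin> NE" for i
    using that tree_lists_nth[of i X] by (simp add: T_def NE_def)
  have T_F: "T i \<subseteq> ?F" if "i < length TS" for i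
    using T_NE[of i] T_E[of i] that by (cases "i \<in> NE") (auto simp: comp_edges_def)
  have cong: "enB e = ends G e" if "i < length TS" "e \<in> T i" for i e
    using T_F[OF that(1)] that(2) enB_G by auto
  have sub: "set (TS ! i) \<subseteq> comp_of enB ?F (head0 (TS ! i))" if "i \<in> NE" for i
    using sep[unfolded separated_iff] NE_FL[OF that] by blast
  have tree: "spanning_tree_of (ends G) (set (TS ! i)) (T i)" if "i < length TS" for i
  proof (cases "i \<in> NE")
    case True
    then have "spanning_tree_of enB (set (TS ! i)) (T i)"
      using spanning_tree_comp_edges(1)[OF fF sub[OF True]] T_NE by simp
    then show ?thesis
      using spanning_tree_of_cong[of "T i" enB "ends G"] cong[OF that] by simp
  next
    case False
    then show ?thesis
      using that T_E[OF that False]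
      by (simp add: NE_def spanning_tree_of_def tree_verts_def connected_graph_def
          cycle_free_iff_forest forest_def)
  qed
  have verts_NE: "tree_verts (ends G) (set (TS ! i)) (T i) \<subseteq> comp_of enB ?F (head0 (TS ! i))"
    if "i \<in> NE" for i
  proof -
    have "i < length TS" using that by (simp add: NE_def)
    then have "tree_verts (ends G) (set (TS ! i)) (T i) = tree_verts enB (set (TS ! i)) (T i)"
      using cong by (intro tree_verts_cong) simp
    then show ?thesis
      using spanning_tree_comp_edges(2)[OF fF sub[OF that]] T_NE[OF that] by simp
  qed
  have verts_E: "tree_verts (ends G) (set (TS ! i)) (T i) = {}" if "i < length TS" "i \<notin> NE" for i
    using that T_E[OF that] by (simp add: tree_verts_def NE_def)
  have disj: "tree_verts (ends G) (set (TS ! i)) (T i) \<inter> tree_verts (ends G) (set (TS ! j)) (T j) = {}"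
    if ij: "i < j" "j < length TS" for i j
  proof (cases "i \<in> NE \<and> j \<in> NE")
    case True
    then show ?thesis
      using verts_NE[of i] verts_NE[of j] separated_disjoint[OF sep, of i j] ij by blast
  next
    case False
    then show ?thesis using verts_E[of i] verts_E[of j] ij by auto
  qed
  have TE: "T i \<subseteq> {..<n}" if "i < length TS" for i using T_F[OF that] by blast
  show "svdst_feasible G (map set (tree_lists (raw_svdst I) X))"
    unfolding svdst_feasible_def G_simps(2,3) length_map length_tree_lists
    using TE tree disj by (simp add: length_tree_lists T_def)
  have T_disj: "T i \<inter> T j = {}" if ij: "i \<in> NE" "j \<in> NE" "i \<noteq> j" for i j
  proof (rule ccontr)
    assume "\<not> ?thesis"
    then obtain e where e: "e \<in> T i" "e \<in> T j" by blast
    then have "e < n" using T_NE[OF ij(1)] by (simp add: comp_edges_def)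
    then have "enB e \<noteq> {}" by (rule ends_G_obtain) simp
    moreover have "enB e \<subseteq> comp_of enB ?F (head0 (TS ! i))" "enB e \<subseteq> comp_of enB ?F (head0 (TS ! j))"
      using e T_NE ij by (simp_all add: comp_edges_def)
    ultimately show False using separated_disjoint[OF sep ij] by blast
  qed
  have "svdst_cost G (map set (tree_lists (raw_svdst I) X)) = (\<Sum>i<length TS. sum (len G) (T i))"
    by (simp add: svdst_cost_eq length_tree_lists T_def)
  also have "\<dots> = (\<Sum>i\<in>NE. sum (len G) (T i))"
    by (rule sum.mono_neutral_right) (auto simp: NE_def T_E)
  also have "\<dots> \<le> sum (len G) ?F"
  proof (rule sum_disjoint_subsets_le)
    show "T i \<subseteq> ?F" if "i \<in> NE" for i using that T_F by (simp add: NE_def)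
    show "0 \<le> len G e" if "e \<in> ?F" for e using that len_nonneg by simp
  qed (use T_disj in \<open>auto simp: NE_def\<close>)
  finally show "svdst_cost G (map set (tree_lists (raw_svdst I) X)) \<le> sum (len G) ?F" .
qed

text \<open>Feasible trees yield a cheap choice by \<open>trees_choice\<close>. An optimal choice
  costs no more, so \<open>cheap_choice\<close> applies to it too, and as both costs have the same
  leading term, the lengths can be compared. The first conclusion justifies the answer
  \<open>None\<close> when separation fails.\<close>

lemma optimal_choice_vs_trees:
  assumes opt: "bmst_optimal B (set X)" and Ts: "svdst_feasible G Ts"
  shows "separated (raw_svdst I) X" and "sum (len G) (set X \<inter> {..<n}) \<le> svdst_cost G Ts"
proof -
  \<comment> \<open>\<open>pos\<close> turns a terminal set back into its position, so that the list
    of trees becomes a family indexed by sets.\<close>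
  define pos where "pos = inv_into NE (\<lambda>i. set (TS ! i))"
  define T where "T A = Ts ! pos A" for A
  have bij: "bij_betw pos P NE"
    unfolding pos_def by (rule bij_betw_inv_into[OF bij_NE])
  have pos: "pos A \<in> NE" "set (TS ! pos A) = A" if "A \<in> P" for A
    using bij_betw_apply[OF bij that] bij_betw_inv_into_right[OF bij_NE that, folded pos_def] .
  have len: "length Ts = length TS"
    using Ts unfolding svdst_feasible_def G_simps(3) by simp
  have tree: "Ts ! i \<subseteq> {..<n} \<and> spanning_tree_of (ends G) (set (TS ! i)) (Ts ! i)"
    if i: "i < length TS" for i
  proof -
    have "Ts ! i \<subseteq> {..<n} \<and> spanning_tree_of (ends G) (map set TS ! i) (Ts ! i)"
      using Ts i len unfolding svdst_feasible_def G_simps(2,3) by simp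
    then show ?thesis using i by simp
  qed
  have disj: "tree_verts (ends G) (set (TS ! i)) (Ts ! i) \<inter>
      tree_verts (ends G) (set (TS ! j)) (Ts ! j) = {}" if ij: "i < j" "j < length TS" for i j
  proof -
    have "\<forall>i j. i < j \<longrightarrow> j < length Ts \<longrightarrow> tree_verts (ends G) (map set TS ! i) (Ts ! i) \<inter>
        tree_verts (ends G) (map set TS ! j) (Ts ! j) = {}"
      using Ts unfolding svdst_feasible_def G_simps(3) by (elim conjE)
    from this[rule_format, of i j] show ?thesis using ij len by simp
  qed
  have cong: "enB e = ends G e" if "i < length TS" "e \<in> Ts ! i" for i e
    using tree[OF that(1)] that(2) enB_G by auto
  have disj': "tree_verts (ends G) (set (TS ! i)) (Ts ! i) \<inter>
      tree_verts (ends G) (set (TS ! j)) (Ts ! j) = {}"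
    if "i < length TS" "j < length TS" "i \<noteq> j" for i j
    using that disj[of i j] disj[of j i] by (cases "i < j") auto
  have "disjoint_trees enB {..<n} P T"
    unfolding disjoint_trees_def
  proof (intro conjI ballI impI)
    fix A
    assume A: "A \<in> P"
    have i: "pos A < length TS" using pos[OF A] by (simp add: NE_def)
    show "T A \<subseteq> {..<n}" using tree[OF i] by (simp add: T_def)
    have "spanning_tree_of enB (set (TS ! pos A)) (Ts ! pos A) =
        spanning_tree_of (ends G) (set (TS ! pos A)) (Ts ! pos A)"
      using cong[OF i] by (rule spanning_tree_of_cong)
    then show "spanning_tree_of enB A (T A)"
      using tree[OF i] unfolding T_def pos(2)[OF A] by blast
    fix A'
    assume A': "A' \<in> P" "A \<noteq> A'"
    have j: "pos A' < length TS" using pos[OF A'(1)] by (simp add: NE_def)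
    have ne: "pos A \<noteq> pos A'"
    proof
      assume "pos A = pos A'"
      then have "set (TS ! pos A) = set (TS ! pos A')" by (rule arg_cong)
      then show False using A'(2) unfolding pos(2)[OF A] pos(2)[OF A'(1)] by contradiction
    qed
    have eq: "tree_verts enB (set (TS ! k)) (Ts ! k) = tree_verts (ends G) (set (TS ! k)) (Ts ! k)"
      if "k < length TS" for k
      using cong[OF that] by (rule tree_verts_cong)
    show "tree_verts enB A (T A) \<inter> tree_verts enB A' (T A') = {}"
      using disj'[OF i j ne, folded eq[OF i] eq[OF j]]
      unfolding T_def pos(2)[OF A] pos(2)[OF A'(1)] .
  qed
  from trees_choice[OF this] obtain X' where X': "feasible X'"
    "cost X' = real big_cost * (real (card (set V)) - card P) + (\<Sum>A\<in>P. sum (len G) (T A))"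
    "cost X' < real big_cost * (real (card (set V)) - card P + 1)" by blast
  have X: "feasible (set X)" "cost (set X) \<le> cost X'"
    using opt X'(1) unfolding bmst_optimal_def bmst_feasible_iff bmst_cost_eq by auto
  have cheap: "cost (set X) < real big_cost * (real (card (set V)) - card P + 1)"
    using X(2) X'(3) by linarith
  note choice = cheap_choice[OF X(1) cheap]
  show "separated (raw_svdst I) X"
    unfolding separated_iff
  proof (intro ballI)
    fix S S' t
    assume S: "S \<in> set FL" "S' \<in> set FL" "t \<in> set S'"
    have P: "set S \<in> P" "set S' \<in> P" using S by (simp_all add: P_def)
    note r = root_set[OF S(1)] root_set[OF S(2)]
    have sub: "set S \<subseteq> comp_of enB (set X \<inter> {..<n}) (head0 S)"
      "set S' \<subseteq> comp_of enB (set X \<inter> {..<n}) (head0 S')"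
      using choice(2)[OF P(1)] choice(2)[OF P(2)] unfolding r by auto
    show "t \<in> comp_of enB (set X \<inter> {..<n}) (head0 S) \<longleftrightarrow> t \<in> set S"
    proof (cases "set S = set S'")
      case False
      then have "comp_of enB (set X \<inter> {..<n}) (head0 S) \<inter> comp_of enB (set X \<inter> {..<n}) (head0 S') = {}"
        using choice(3)[OF P] unfolding r by blast
      then show ?thesis using sub S(3) by blast
    qed (use sub S in auto)
  qed
  have "sum (len G) (set X \<inter> {..<n}) \<le> (\<Sum>A\<in>P. sum (len G) (T A))"
    using choice(1) X(2) X'(2) by linarith
  also have "\<dots> = (\<Sum>i\<in>NE. sum (len G) (Ts ! i))"
    unfolding T_def by (rule sum.reindex_bij_betw[OF bij])
  \<comment> \<open>Trees given for empty terminal sets may have edges but have no counterpart in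
    the gadget; their nonnegative lengths only increase the right-hand side.\<close>
  also have "\<dots> \<le> (\<Sum>i<length TS. sum (len G) (Ts ! i))"
  proof (rule sum_mono2)
    show "0 \<le> sum (len G) (Ts ! i)" if "i \<in> {..<length TS} - NE" for i
      using that tree[of i] len_nonneg by (intro sum_nonneg) auto
  qed (auto simp: NE_def)
  also have "\<dots> = svdst_cost G Ts" by (rule svdst_cost_eq[OF len, symmetric])
  finally show "sum (len G) (set X \<inter> {..<n}) \<le> svdst_cost G Ts" .
qed

lemma decode_correct:
  assumes "X \<in> correct (BMST K) (gadget_input I)"
  shows "decode (raw_svdst I) X \<in> correct (SVDST K) I"
proof -
  have opt: "bmst_optimal B (set X)" using assms by (simp add: BMST_def)
  then have forest: "forest enB (set X)"
    by (simp add: bmst_optimal_def bmst_feasible_def cycle_free_iff_forest)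
  show ?thesis
  proof (cases "separated (raw_svdst I) X")
    case True
    note dec = decoded_feasible[OF forest True]
    have "svdst_optimal G (map set (tree_lists (raw_svdst I) X))"
      unfolding svdst_optimal_def
      using dec optimal_choice_vs_trees(2)[OF opt] order_trans by blast
    then show ?thesis
      using True distinct_tree_lists by (auto simp: SVDST_def decode_def)
  next
    case False
    then have "\<not> (\<exists>Ts. svdst_feasible G Ts)" using optimal_choice_vs_trees(1)[OF opt] by blast
    then show ?thesis using False by (simp add: SVDST_def decode_def)
  qed
qed

end

section \<open>The reduction as a pair of programs and its consequence\<close>

lemma ptime_reducible_SVDST_BMST: "ptime_reducible (SVDST K) (BMST K)"
proof -
  obtain f and rf :: "nat poly" where f: "\<And>z. runs f (enc_raw_svdst z)
      (enc_pair (enc_list Num) (enc_pair (enc_list enc_raw_bmst_edge) (enc_list enc_raw_bmst_edge))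
        (raw_gadget z)) (poly rf (vsize (enc_raw_svdst z)))"
    using ptime_funE[OF ptime_raw_gadget] by blast
  obtain g and rg :: "nat poly" where g: "\<And>w. runs g (enc_instance_choice w)
      (enc_out (SVDST K) (decode (fst w) (snd w))) (poly rg (vsize (enc_instance_choice w)))"
    using ptime_funE[OF ptime_decode[of K]] by blast
  show ?thesis
    unfolding ptime_reducible_def
  proof (rule exI[of _ f], rule exI[of _ g], rule exI[of _ "rf + rg"], intro ballI)
    fix I
    assume "I \<in> insts (SVDST K)"
    then interpret svdst_reduction I K by unfold_locales
    have in_eq: "enc_in (SVDST K) I = enc_raw_svdst (raw_svdst I)"
      by (simp add: SVDST_def enc_raw_svdst_eq)
    have out_eq: "enc_in (BMST K) (gadget_input I) =
        enc_pair (enc_list Num) (enc_pair (enc_list enc_raw_bmst_edge) (enc_list enc_raw_bmst_edge))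
          (raw_gadget (raw_svdst I))"
      using enc_gadget_input[of I] nonneg_weight by (simp add: BMST_def)
    have choice_eq: "Node (enc_raw_svdst (raw_svdst I)) (enc_out (BMST K) X) =
        enc_instance_choice (raw_svdst I, X)" for X
      by (simp add: BMST_def enc_instance_choice_def)
    show "\<exists>J\<in>insts (BMST K).
        (\<exists>t. exec f (enc_in (SVDST K) I) (enc_in (BMST K) J) t \<and>
          t \<le> poly (rf + rg) (vsize (enc_in (SVDST K) I))) \<and>
        (\<forall>X\<in>correct (BMST K) J. \<exists>y\<in>correct (SVDST K) I. \<exists>t.
          exec g (Node (enc_in (SVDST K) I) (enc_out (BMST K) X)) (enc_out (SVDST K) y) t \<and>
          t \<le> poly (rf + rg) (vsize (Node (enc_in (SVDST K) I) (enc_out (BMST K) X))))"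
    proof (rule bexI[OF _ gadget_in_insts], intro conjI ballI)
      obtain t where "exec f (enc_in (SVDST K) I) (enc_in (BMST K) (gadget_input I)) t"
        "t \<le> poly rf (vsize (enc_in (SVDST K) I))"
        unfolding in_eq out_eq using f unfolding runs_def by blast
      then show "\<exists>t. exec f (enc_in (SVDST K) I) (enc_in (BMST K) (gadget_input I)) t \<and>
          t \<le> poly (rf + rg) (vsize (enc_in (SVDST K) I))"
        unfolding poly_add by (meson trans_le_add1)
    next
      fix X
      assume X: "X \<in> correct (BMST K) (gadget_input I)"
      obtain t where "exec g (enc_instance_choice (raw_svdst I, X))
          (enc_out (SVDST K) (decode (raw_svdst I) X)) t"
        "t \<le> poly rg (vsize (enc_instance_choice (raw_svdst I, X)))"
        using g[of "(raw_svdst I, X)"] unfolding runs_def fst_conv snd_conv by blast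
      then show "\<exists>y\<in>correct (SVDST K) I. \<exists>t.
          exec g (Node (enc_in (SVDST K) I) (enc_out (BMST K) X)) (enc_out (SVDST K) y) t \<and>
          t \<le> poly (rf + rg) (vsize (Node (enc_in (SVDST K) I) (enc_out (BMST K) X)))"
        unfolding in_eq choice_eq poly_add
        using decode_correct[OF X] by (meson trans_le_add2)
    qed
  qed
qed

text \<open>The solver runs between \<open>f\<close> and \<open>g\<close>, while a fork keeps a copy
  of the original instance for \<open>g\<close>. By \<open>exec_vsize\<close> all intermediate trees
  have polynomial size, so the nested bounds are again polynomials.\<close>

lemma ptime_solvable_reducible:
  assumes red: "ptime_reducible A B" and sol: "ptime_solvable B"
  shows "ptime_solvable A"
proof -
  obtain f g and r :: "nat poly" where red: "\<And>x. x \<in> insts A \<Longrightarrow> \<exists>x'\<in>insts B.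
     (\<exists>t. exec f (enc_in A x) (enc_in B x') t \<and> t \<le> poly r (vsize (enc_in A x))) \<and>
     (\<forall>y'\<in>correct B x'. \<exists>y\<in>correct A x. \<exists>t.
        exec g (Node (enc_in A x) (enc_out B y')) (enc_out A y) t \<and>
        t \<le> poly r (vsize (Node (enc_in A x) (enc_out B y'))))"
    using red unfolding ptime_reducible_def by blast
  obtain p and s :: "nat poly" where sol: "\<And>x. x \<in> insts B \<Longrightarrow> \<exists>y\<in>correct B x. \<exists>t.
     exec p (enc_in B x) (enc_out B y) t \<and> t \<le> poly s (vsize (enc_in B x))"
    using sol unfolding ptime_solvable_def by blast
  \<comment> \<open>\<open>q\<close> bounds the solver's time on the constructed instance, and
    \<open>[:1, 1:] + q\<close> the size of the pair handed to \<open>g\<close>.\<close>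
  define q where "q = s \<circ>\<^sub>p r"
  define R where "R = [:10, 10:] + r + q + r \<circ>\<^sub>p ([:1, 1:] + q)"
  show ?thesis
    unfolding ptime_solvable_def
  proof (rule exI[of _ "Seq (Fork (Prim Id) (Seq f p)) g"], rule exI[of _ R], intro ballI)
    fix x
    assume "x \<in> insts A"
    from red[OF this] obtain x' t1 where x': "x' \<in> insts B"
      "exec f (enc_in A x) (enc_in B x') t1" "t1 \<le> poly r (vsize (enc_in A x))"
      and answer: "\<And>y'. y' \<in> correct B x' \<Longrightarrow> \<exists>y\<in>correct A x. \<exists>t.
        exec g (Node (enc_in A x) (enc_out B y')) (enc_out A y) t \<and>
        t \<le> poly r (vsize (Node (enc_in A x) (enc_out B y')))"
      by blast
    from sol[OF x'(1)] obtain y' t2 where y': "y' \<in> correct B x'"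
      "exec p (enc_in B x') (enc_out B y') t2" "t2 \<le> poly s (vsize (enc_in B x'))"
      by blast
    from answer[OF y'(1)] obtain y t3 where y: "y \<in> correct A x"
      "exec g (Node (enc_in A x) (enc_out B y')) (enc_out A y) t3"
      "t3 \<le> poly r (vsize (Node (enc_in A x) (enc_out B y')))"
      by blast
    let ?n = "vsize (enc_in A x)"
    have "vsize (enc_in B x') \<le> poly r ?n" using exec_vsize[OF x'(2)] x'(3) by linarith
    then have t2: "t2 \<le> poly q ?n"
      using y'(3) poly_nat_mono[of "vsize (enc_in B x')" "poly r ?n" s]
      by (simp add: q_def poly_pcompose)
    then have "vsize (Node (enc_in A x) (enc_out B y')) \<le> poly ([:1, 1:] + q) ?n"
      using exec_vsize[OF y'(2)] by simp
    from poly_nat_mono[OF this, of r] have t3: "t3 \<le> poly (r \<circ>\<^sub>p ([:1, 1:] + q)) ?n"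
      using y(3) by (simp add: poly_pcompose)
    have id: "exec (Prim Id) (enc_in A x) (enc_in A x) (Suc (?n + ?n))"
      using exec.Prim[of Id "enc_in A x"] by simp
    note run = exec.Seq[OF exec.Fork[OF id exec.Seq[OF x'(2) y'(2)]] y(2)]
    have "Suc (Suc (?n + Suc (?n + ?n) + Suc (t1 + t2)) + t3) \<le> poly R ?n"
      using x'(3) t2 t3 by (simp add: R_def)
    with run y(1) show "\<exists>y\<in>correct A x. \<exists>t.
        exec (Seq (Fork (Prim Id) (Seq f p)) g) (enc_in A x) (enc_out A y) t \<and> t \<le> poly R ?n"
      by blast
  qed
qed

theorem theorem5:
  fixes K :: nat
  shows "ptime_reducible (SVDST K) (BMST K) \<and>
    (ptime_solvable (BMST K) \<longrightarrow> ptime_solvable (SVDST K))"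
  using ptime_reducible_SVDST_BMST ptime_solvable_reducible by blast

end
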